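(* Consider the charged-particle equation $\ddot x=\dot x\times B(x)+E(x)$ in $\mathbb{R}^3$ with $B(x)=\frac1\varepsilon B_0+B_1(x)$, $|B_0|=1$, $0<\varepsilon\ll1$, and let $x(t)$, $v(t)=\dot x(t)$, $0\le t\le T$ (with $T$ independent of $\varepsilon$), be the solution with initial data satisfying $|x(0)|\le C_0$, $|\dot x(0)|\le C_1$ (with $C_0,C_1$ independent of $\varepsilon$). Let $(x^n,v^n)$ be the numerical solution obtained with a step size $h$ satisfying $\varepsilon\le h^2\ll1$ by one of the following three methods (defined in the context): (i) the Boris algorithm or (ii) the standard variational integrator, in both cases with starting position $x^0=x(0)$ or $x^0=x(0)+\varepsilon\dot x(0)\times B_0$ and starting velocity $v^0=P_0\dot x(0)+v^0_\perp$, where $P_0v^0_\perp=0$ and $|v^0_\perp|\le c_1\varepsilon$ with $c_1$ independent of $\varepsilon$ and $h$; (iii) the filtered variational integrator with $x^0=x(0)$, $v^0=\dot x(0)$, where in addition $h$ satisfies, for some $N\ge1$ and a positive constant $c$, the non-resonance conditions $|\sin(\frac{kh}{2\varepsilon})|\ge c$ and $|\cos(\frac{kh}{2\varepsilon})|\ge c$ for $k=1,\dots,N$, and $|\tan(\frac{kh}{2\varepsilon})-\tan(\frac{h}{2\varepsilon})|\ge c$ for $k=2,\dots,N$. Assume that the numerical solution $x^n$ stays in a compact set $K$ for $0\le nh\le T$, with $K$ independent of $\varepsilon$ and $h$. Then for each of the three methods the errors in the position $x$ and the parallel velocity $v_\parallel=P_0v$ at time $t_n=nh\le T$ are bounded by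 $$|x^n-x(t_n)|\le Ch^2,\qquad |v^n_\parallel-v_\parallel(t_n)|\le Ch^2\qquad(t_n\le T),$$ where $C$ is independent of $\varepsilon$, $h$ and $n$ with $h^2\ge\varepsilon$ and $nh\le T$ (but depends on $T$).
   Context: Setting: $B_0\in\mathbb{R}^3$ is a fixed unit vector and $P_0=B_0B_0^\top$; $B_1,E:\mathbb{R}^3\to\mathbb{R}^3$ are smooth with derivatives bounded independently of $\varepsilon$ on bounded subsets of $\mathbb{R}^3$. $B_1=\nabla\times A_1$ with a known vector potential $A_1$ (smooth, with the same kind of bounds), so $B=\nabla\times A$ with $A(x)=-\frac1{2\varepsilon}x\times B_0+A_1(x)$. The standing step-size regime is $0<\varepsilon\le h^2\ll1$ (i.e. $h$ is at most a sufficiently small constant independent of $\varepsilon$). Write $B^n=B(x^n)$, $E^n=E(x^n)$, $A'(x)=(\partial_jA_i(x))_{i,j=1}^3$, and $v^n_\parallel=P_0v^n$. Boris algorithm: $$\frac{x^{n+1}-2x^n+x^{n-1}}{h^2}=\frac{x^{n+1}-x^{n-1}}{2h}\times B^n+E^n .$$ Standard variational integrator: $$\frac{x^{n+1}-2x^n+x^{n-1}}{h^2}=A'(x^n)^\top\frac{x^{n+1}-x^{n-1}}{2h}-\frac{A(x^{n+1})-A(x^{n-1})}{2h}+E^n .$$ For these two methods $v^n=\frac{x^{n+1}-x^{n-1}}{2h}$. Filtered variational integrator: let $\widehat B_0$ be the skew-symmetric matrix with $-\widehat B_0v=v\times B_0$ for all $v$, $\operatorname{tanc}(\xi)=\tan(\xi)/\xi$,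 $\operatorname{sinc}(\xi)=\sin(\xi)/\xi$, $\Psi=I+(1-\operatorname{tanc}(\frac h{2\varepsilon}))\widehat B_0^2$, $\Phi=I+(1-\operatorname{sinc}(\frac h\varepsilon)^{-1})\widehat B_0^2$; then $$\frac{x^{n+1}-2x^n+x^{n-1}}{h^2}=\Psi\Bigl(A'(x^n)^\top\frac{x^{n+1}-x^{n-1}}{2h}-\frac{A(x^{n+1})-A(x^{n-1})}{2h}+E^n\Bigr),$$ $$v^n=\Phi\,\frac{x^{n+1}-x^{n-1}}{2h}+\varepsilon\Bigl(1-\operatorname{sinc}\bigl(\tfrac h\varepsilon\bigr)^{-1}\Bigr)E^n\times B_0 .$$ Each method is started from $x^0,v^0$ by determining $x^1,x^{-1}$ from the two-step relation and the velocity relation for $n=0$.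
   Formalization: For the two implicit variational integrators, the steps |x^{n+1}-x^n| for nh ≤ T are assumed bounded by an arbitrary constant independent of ε and h, since a spurious far-away root x^{n+1} just beyond T would violate the bound on the last v^n. *)

theory Defs
  imports "HOL-Analysis.Analysis"
begin

unbundle cross3_syntax

section \<open>Smooth families of vector fields\<close>

text \<open>Iterated partial derivatives: \<open>partials [j\<^sub>1, \<dots>, j\<^sub>k] F\<close> is \<open>\<partial>\<^sub>j\<^sub>1 \<dots> \<partial>\<^sub>j\<^sub>k F\<close>.\<close>

primrec partials :: "3 list \<Rightarrow> (real^3 \<Rightarrow> real^3) \<Rightarrow> real^3 \<Rightarrow> real^3" where
  "partials [] F = F"
| "partials (j # js) F = (\<lambda>x. frechet_derivative (partials js F) (at x) (axis j 1))"

text \<open>All iterated partial derivatives are Frechet differentiable everywhere, hence continuous,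
  so this is \<open>C\<^sup>\<infinity>\<close>.\<close>

definition smooth_field :: "(real^3 \<Rightarrow> real^3) \<Rightarrow> bool" where
  "smooth_field F \<longleftrightarrow> (\<forall>js x. partials js F differentiable (at x))"

text \<open>The fields may depend on \<open>\<epsilon>\<close>, as long as on each bounded set the derivatives of each order
  (order \<open>0\<close>, the field itself, included) are bounded independently of \<open>\<epsilon>\<close>. Since only small
  \<open>\<epsilon>\<close> matter, the index range is \<open>0 < \<epsilon> < 1\<close>. A field that does not depend on \<open>\<epsilon>\<close> is a
  constant family.\<close>

definition uniformly_smooth :: "(real \<Rightarrow> real^3 \<Rightarrow> real^3) \<Rightarrow> bool" where
  "uniformly_smooth F \<longleftrightarrow>
     (\<forall>\<epsilon>\<in>{0<..<1}. smooth_field (F \<epsilon>)) \<and>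
     (\<forall>js S. bounded S \<longrightarrow> (\<exists>M. \<forall>\<epsilon>\<in>{0<..<1}. \<forall>x\<in>S. norm (partials js (F \<epsilon>) x) \<le> M))"

text \<open>\<open>jacobian F (at x) $ i $ j\<close> is \<open>\<partial>\<^sub>j F\<^sub>i(x)\<close>.\<close>

definition curl :: "(real^3 \<Rightarrow> real^3) \<Rightarrow> real^3 \<Rightarrow> real^3" where
  "curl F x = (let J = jacobian F (at x) in
     vector [J $ 3 $ 2 - J $ 2 $ 3, J $ 1 $ 3 - J $ 3 $ 1, J $ 2 $ 1 - J $ 1 $ 2])"

section \<open>The charged-particle equation\<close>

definition par_proj :: "real^3 \<Rightarrow> real^3^3" where
  "par_proj B0 = (\<chi> i j. B0 $ i * B0 $ j)"

definition magnetic_field :: "real^3 \<Rightarrow> (real^3 \<Rightarrow> real^3) \<Rightarrow> real \<Rightarrow> real^3 \<Rightarrow> real^3" where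
  "magnetic_field B0 B1 \<epsilon> x = (1 / \<epsilon>) *\<^sub>R B0 + B1 x"

definition vector_potential :: "real^3 \<Rightarrow> (real^3 \<Rightarrow> real^3) \<Rightarrow> real \<Rightarrow> real^3 \<Rightarrow> real^3" where
  "vector_potential B0 A1 \<epsilon> x = - (1 / (2 * \<epsilon>)) *\<^sub>R (x \<times> B0) + A1 x"

definition charged_particle_solution ::
  "(real^3 \<Rightarrow> real^3) \<Rightarrow> (real^3 \<Rightarrow> real^3) \<Rightarrow> real \<Rightarrow> (real \<Rightarrow> real^3) \<Rightarrow> (real \<Rightarrow> real^3) \<Rightarrow> bool"
  where
  "charged_particle_solution B E T x v \<longleftrightarrow>
     (\<forall>t\<in>{0..T}. (x has_vector_derivative v t) (at t within {0..T}) \<and>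
                 (v has_vector_derivative (v t \<times> B (x t) + E (x t))) (at t within {0..T}))"

section \<open>The numerical methods\<close>

text \<open>A numerical solution is a pair of functions on the integers. The relations of a method are
  imposed for \<open>n \<ge> 0\<close> with \<open>n h \<le> T\<close>, so that \<open>x (-1), x 0, x 1, \<dots>\<close> are constrained up to the
  first time point beyond \<open>T\<close>. The relations for \<open>n = 0\<close>, together with given values of \<open>x 0\<close> and
  \<open>v 0\<close>, are the equations that determine the starting values \<open>x 1\<close> and \<open>x (-1)\<close>.\<close>

definition second_diff :: "real \<Rightarrow> (int \<Rightarrow> real^3) \<Rightarrow> int \<Rightarrow> real^3" where
  "second_diff h x n = (x (n + 1) - 2 *\<^sub>R x n + x (n - 1)) /\<^sub>R h\<^sup>2"

definition central_diff :: "real \<Rightarrow> (int \<Rightarrow> real^3) \<Rightarrow> int \<Rightarrow> real^3" where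
  "central_diff h x n = (x (n + 1) - x (n - 1)) /\<^sub>R (2 * h)"

definition boris ::
  "(real^3 \<Rightarrow> real^3) \<Rightarrow> (real^3 \<Rightarrow> real^3) \<Rightarrow> real \<Rightarrow> real \<Rightarrow>
   (int \<Rightarrow> real^3) \<Rightarrow> (int \<Rightarrow> real^3) \<Rightarrow> bool" where
  "boris B E T h x v \<longleftrightarrow>
     (\<forall>n::int. 0 \<le> n \<and> of_int n * h \<le> T \<longrightarrow>
        second_diff h x n = central_diff h x n \<times> B (x n) + E (x n) \<and>
        v n = central_diff h x n)"

definition discrete_lorentz_force ::
  "(real^3 \<Rightarrow> real^3) \<Rightarrow> (real^3 \<Rightarrow> real^3) \<Rightarrow> real \<Rightarrow> (int \<Rightarrow> real^3) \<Rightarrow> int \<Rightarrow> real^3" where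
  "discrete_lorentz_force A E h x n =
     transpose (jacobian A (at (x n))) *v central_diff h x n
       - (A (x (n + 1)) - A (x (n - 1))) /\<^sub>R (2 * h) + E (x n)"

definition standard_variational ::
  "(real^3 \<Rightarrow> real^3) \<Rightarrow> (real^3 \<Rightarrow> real^3) \<Rightarrow> real \<Rightarrow> real \<Rightarrow>
   (int \<Rightarrow> real^3) \<Rightarrow> (int \<Rightarrow> real^3) \<Rightarrow> bool" where
  "standard_variational A E T h x v \<longleftrightarrow>
     (\<forall>n::int. 0 \<le> n \<and> of_int n * h \<le> T \<longrightarrow>
        second_diff h x n = discrete_lorentz_force A E h x n \<and>
        v n = central_diff h x n)"

definition tanc :: "real \<Rightarrow> real" where
  "tanc \<xi> = tan \<xi> / \<xi>"

definition sinc :: "real \<Rightarrow> real" where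
  "sinc \<xi> = sin \<xi> / \<xi>"

text \<open>The sign convention is \<open>- (hat B0) v = v \<times> B0\<close>.\<close>

definition hat :: "real^3 \<Rightarrow> real^3^3" where
  "hat B0 = matrix (\<lambda>v. - (v \<times> B0))"

definition filter_Psi :: "real^3 \<Rightarrow> real \<Rightarrow> real \<Rightarrow> real^3^3" where
  "filter_Psi B0 \<epsilon> h = mat 1 + (1 - tanc (h / (2 * \<epsilon>))) *\<^sub>R (hat B0 ** hat B0)"

definition filter_Phi :: "real^3 \<Rightarrow> real \<Rightarrow> real \<Rightarrow> real^3^3" where
  "filter_Phi B0 \<epsilon> h = mat 1 + (1 - inverse (sinc (h / \<epsilon>))) *\<^sub>R (hat B0 ** hat B0)"

definition filtered_variational ::
  "real^3 \<Rightarrow> real \<Rightarrow> (real^3 \<Rightarrow> real^3) \<Rightarrow> (real^3 \<Rightarrow> real^3) \<Rightarrow> real \<Rightarrow> real \<Rightarrow>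
   (int \<Rightarrow> real^3) \<Rightarrow> (int \<Rightarrow> real^3) \<Rightarrow> bool" where
  "filtered_variational B0 \<epsilon> A E T h x v \<longleftrightarrow>
     (\<forall>n::int. 0 \<le> n \<and> of_int n * h \<le> T \<longrightarrow>
        second_diff h x n = filter_Psi B0 \<epsilon> h *v discrete_lorentz_force A E h x n \<and>
        v n = filter_Phi B0 \<epsilon> h *v central_diff h x n
              + (\<epsilon> * (1 - inverse (sinc (h / \<epsilon>)))) *\<^sub>R (E (x n) \<times> B0))"

text \<open>The variational integrators are implicit: \<open>x (n + 1)\<close> solves a nonlinear equation, which may
  have, besides the solution near \<open>x n\<close> that the method computes, spurious ones at a distance
  that tends to infinity as \<open>h \<rightarrow> 0\<close> (for instance when \<open>A1\<close> grows cubically). The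
  following condition, with an arbitrary \<open>\<rho>\<close> independent of \<open>\<epsilon>\<close> and \<open>h\<close>, excludes the latter. If the
  iterates up to time \<open>T\<close> stay in a set of diameter at most \<open>\<rho>\<close>, it restricts only the last
  update, to the first point beyond \<open>T\<close>, which enters the velocity at the last time point.\<close>

definition near_branch :: "real \<Rightarrow> real \<Rightarrow> real \<Rightarrow> (int \<Rightarrow> real^3) \<Rightarrow> bool" where
  "near_branch \<rho> T h x \<longleftrightarrow>
     (\<forall>n::int. 0 \<le> n \<and> of_int n * h \<le> T \<longrightarrow> norm (x (n + 1) - x n) \<le> \<rho>)"

definition nonresonant :: "nat \<Rightarrow> real \<Rightarrow> real \<Rightarrow> real \<Rightarrow> bool" where
  "nonresonant N c \<epsilon> h \<longleftrightarrow>
     (\<forall>k\<in>{1..N}. \<bar>sin (real k * h / (2 * \<epsilon>))\<bar> \<ge> c \<and> \<bar>cos (real k * h / (2 * \<epsilon>))\<bar> \<ge> c) \<and>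
     (\<forall>k\<in>{2..N}. \<bar>tan (real k * h / (2 * \<epsilon>)) - tan (h / (2 * \<epsilon>))\<bar> \<ge> c)"

section \<open>Starting values\<close>

definition slow_start ::
  "real^3 \<Rightarrow> real \<Rightarrow> real \<Rightarrow> real^3 \<Rightarrow> real^3 \<Rightarrow> real^3 \<Rightarrow> real^3 \<Rightarrow> bool" where
  "slow_start B0 \<epsilon> c1 q0 u0 x0 v0 \<longleftrightarrow>
     (x0 = q0 \<or> x0 = q0 + \<epsilon> *\<^sub>R (u0 \<times> B0)) \<and>
     (\<exists>w. v0 = par_proj B0 *v u0 + w \<and> par_proj B0 *v w = 0 \<and> norm w \<le> c1 * \<epsilon>)"

unbundle no cross3_syntax

end

(* On the time scale of the equation an error of size \<epsilon> \<le> h^2 is invisible, so it suffices to follow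
   slow variables up to O(\<epsilon>) for the exact solution and up to O(h^2) for the numerical one.
   For the exact solution, integrating the fast rotation by parts shows that the guiding center
   y = q + \<epsilon> u \<times> B0 and a corrected parallel velocity p satisfy y' = p B0 + O(\<epsilon>) and
   p' = B0 \<bullet> E(y) + O(\<epsilon>).
   For the increments w n = x n - x (n - 1), the component orthogonal to B0 obeys, in all three
   methods, a Cayley recursion w' - w = \<tau> ((w' + w) \<times> B0 + 2 h \<epsilon> f): an isometry up to a forcing
   of size h \<epsilon>, so it stays O(h^2), and since w' + w is the sum of a telescoping difference
   and a term of size h \<epsilon>, summation by parts removes its contribution to the parallel motion.
   Corrected positions and parallel velocities then satisfy a Stoermer-Verlet scheme for the slow system,
   and Gronwall's inequality compares the two. That the exact solution stays bounded follows
   from the estimate itself, applied up to the first exit time from a large ball. *)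

theory Submission
  imports Defs
begin

text \<open>The field turns the velocity through the angle \<open>h / \<epsilon>\<close> \<ge> 1 / h
  in one step, so no constant may grow with it. In the Cayley recursion \<tau> is
  \<open>h / (2 * \<epsilon>)\<close> or its tangent, and it enters only through bounds on
  \<open>1 / \<tau>\<close>, on \<open>\<tau> * \<epsilon> / h\<close> and on \<tau> times the
  starting value; this is why one estimate serves all three methods. The recursion has no damping: a
  perpendicular increment present at the start survives. The first two methods need starting values
  almost free of it; in the filtered one the factor \<open>sinc (h / \<epsilon>)\<close> reduces a
  perpendicular velocity of size 1 to O(\<epsilon> / h). The slow scheme is staggered: an increment
  divided by h is a velocity at a half step. It is compared with the exact slow velocity advanced by
  half a kick, \<open>p t + h / 2 * (B0 \<bullet> e (y t))\<close>; with this shift the local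
  defects are O(h^3) and add up to O(h^2). All constants must precede \<epsilon>, h and both
  solutions, hence the lemmas that produce them first and quantify everything else inside.\<close>

unbundle cross3_syntax

section \<open>Vectors relative to a fixed direction\<close>

definition perp :: "real^3 \<Rightarrow> real^3 \<Rightarrow> real^3" where
  "perp B0 a = a - (B0 \<bullet> a) *\<^sub>R B0"

lemma bilinear_cross3: "bounded_bilinear (\<lambda>x y. x \<times> y)"
  using bilinear_cross bilinear_conv_bounded_bilinear by blast

lemma norm_cross_le: "norm (a \<times> b) \<le> norm a * norm b"
proof -
  have "(norm (a \<times> b))\<^sup>2 \<le> (norm a * norm b)\<^sup>2"
    using norm_cross_dot[of a b] zero_le_power2[of "a \<bullet> b"] by linarith
  then show ?thesis by (rule power2_le_imp_le) simp
qed

lemma perp_add: "perp B0 (a + b) = perp B0 a + perp B0 b"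
  by (simp add: perp_def inner_add_right algebra_simps)

lemma perp_diff: "perp B0 (a - b) = perp B0 a - perp B0 b"
  by (simp add: perp_def inner_diff_right algebra_simps)

lemma perp_scaleR: "perp B0 (c *\<^sub>R a) = c *\<^sub>R perp B0 a"
  by (simp add: perp_def algebra_simps)

lemma perp_cross: "perp B0 a \<times> B0 = a \<times> B0"
  by (simp add: perp_def Cross3.left_diff_distrib cross_mult_left)

text \<open>The parallel part of \<open>a\<close> contributes a multiple of
  \<open>B0 \<times> b\<close>, which is orthogonal to B0. So the magnetic force along B0 comes from
  the perpendicular velocity alone, the quantity that can be summed by parts.\<close>

lemma inner_cross_perp: "B0 \<bullet> (perp B0 a \<times> b) = B0 \<bullet> (a \<times> b)"
  by (simp add: perp_def Cross3.left_diff_distrib cross_mult_left inner_diff_right dot_cross_self)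

lemma decomp: "a = (B0 \<bullet> a) *\<^sub>R B0 + perp B0 a"
  by (simp add: perp_def)

context
  fixes B0 :: "real^3"
  assumes unit: "norm B0 = 1"
begin

lemma inner_unit: "B0 \<bullet> B0 = 1"
  using unit by (simp add: dot_square_norm)

lemma inner_perp: "B0 \<bullet> perp B0 a = 0"
  by (simp add: perp_def inner_diff_right inner_unit)

lemma perp_of_cross: "perp B0 (a \<times> B0) = a \<times> B0"
  by (simp add: perp_def dot_cross_self)

lemma perp_self: "perp B0 B0 = 0"
  by (simp add: perp_def inner_unit)

text \<open>On the plane orthogonal to B0 the map a \<mapsto> \<open>a \<times> B0\<close> is a
  quarter turn, so its square is -1. Crossing an equation with B0 exchanges its rotated and
  unrotated terms, the device behind the cancellations of the fast motion below.\<close>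

lemma cross_cross_unit: "(a \<times> B0) \<times> B0 = - perp B0 a"
proof -
  have "(a \<times> B0) \<times> B0 = - (B0 \<times> (a \<times> B0))"
    by (rule cross_skew)
  then show ?thesis
    by (simp add: Lagrange inner_unit perp_def)
qed

lemma norm_perp: "(norm (perp B0 a))\<^sup>2 + (B0 \<bullet> a)\<^sup>2 = (norm a)\<^sup>2"
  unfolding power2_norm_eq_inner
  by (simp add: perp_def inner_diff_left inner_diff_right inner_unit inner_commute power2_eq_square)

lemma norm_perp_le: "norm (perp B0 a) \<le> norm a"
  by (rule power2_le_imp_le) (use norm_perp[of a] zero_le_power2[of "B0 \<bullet> a"] in linarith, simp)

lemma abs_inner_le: "\<bar>B0 \<bullet> a\<bar> \<le> norm a"
  using Cauchy_Schwarz_ineq2[of B0 a] unit by simp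

lemma norm_cross_unit: "norm (a \<times> B0) = norm (perp B0 a)"
proof -
  have "(norm (perp B0 a \<times> B0))\<^sup>2 = (norm (perp B0 a))\<^sup>2"
    using norm_cross_dot[of "perp B0 a" B0] inner_perp[of a] unit by (simp add: inner_commute)
  then show ?thesis by (simp add: perp_cross)
qed

lemma norm_le_components: "norm a \<le> \<bar>B0 \<bullet> a\<bar> + norm (perp B0 a)"
  using norm_triangle_ineq[of "(B0 \<bullet> a) *\<^sub>R B0" "perp B0 a"] unit decomp[of a B0] by simp

text \<open>A Cayley transform of a skew map is an isometry; the forcing enters with weight
  \<open>\<tau> / sqrt (1 + \<tau>\<^sup>2) \<le> 1\<close>.\<close>

lemma cayley_step_norm:
  assumes a: "perp B0 a = a" and b: "perp B0 b = b" and g: "perp B0 g = g"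
    and eq: "b - a = \<tau> *\<^sub>R ((b + a) \<times> B0 + g)"
  shows "norm b \<le> norm a + norm g"
proof -
  \<comment> \<open>\<open>x\<close> and \<open>x \<times> B0\<close> are orthogonal and equally
    long, so Pythagoras gives a factor that does not depend on the sign of \<open>s\<close>.\<close>
  have isom: "norm (x + s *\<^sub>R (x \<times> B0)) = sqrt (1 + s\<^sup>2) * norm x" if "perp B0 x = x" for x s
  proof -
    have "(norm (x + s *\<^sub>R (x \<times> B0)))\<^sup>2 = (norm x)\<^sup>2 + s\<^sup>2 * (norm (x \<times> B0))\<^sup>2"
      unfolding power2_norm_eq_inner
      by (simp add: inner_add_left inner_add_right dot_cross_self power2_eq_square)
    also have "\<dots> = (sqrt (1 + s\<^sup>2) * norm x)\<^sup>2"
      by (simp add: norm_cross_unit that power_mult_distrib distrib_right)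
    finally show ?thesis by (simp add: power2_eq_iff_nonneg)
  qed
  have "b + (-\<tau>) *\<^sub>R (b \<times> B0) = (a + \<tau> *\<^sub>R (a \<times> B0)) + \<tau> *\<^sub>R g"
    using eq by (simp add: cross_add_left algebra_simps)
  then have "norm (b + (-\<tau>) *\<^sub>R (b \<times> B0)) \<le> norm (a + \<tau> *\<^sub>R (a \<times> B0)) + \<bar>\<tau>\<bar> * norm g"
    by (metis norm_triangle_ineq norm_scaleR)
  then have "sqrt (1 + \<tau>\<^sup>2) * norm b \<le> sqrt (1 + \<tau>\<^sup>2) * norm a + \<bar>\<tau>\<bar> * norm g"
    using isom[OF b, of "-\<tau>"] isom[OF a, of \<tau>] by simp
  also have "\<bar>\<tau>\<bar> * norm g \<le> sqrt (1 + \<tau>\<^sup>2) * norm g"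
    by (intro mult_right_mono real_le_rsqrt) simp_all
  finally have "sqrt (1 + \<tau>\<^sup>2) * norm b \<le> sqrt (1 + \<tau>\<^sup>2) * (norm a + norm g)"
    by (simp add: algebra_simps)
  moreover have "0 < sqrt (1 + \<tau>\<^sup>2)"
    by (simp add: add_pos_nonneg)
  ultimately show ?thesis
    by (simp only: mult_le_cancel_left_pos)
qed

end

section \<open>Mean value and Gronwall inequalities\<close>

lemma mvt_bound:
  fixes f :: "real \<Rightarrow> 'a::real_normed_vector"
  assumes "a \<le> b"
    and "\<And>t. t \<in> {a..b} \<Longrightarrow> (f has_vector_derivative f' t) (at t within {a..b})"
    and "\<And>t. t \<in> {a..b} \<Longrightarrow> norm (f' t) \<le> B"
  shows "norm (f b - f a) \<le> B * (b - a)"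
proof -
  have "norm (f b - f a) \<le> B * norm (b - a)"
  proof (rule differentiable_bound[of "{a..b}" f "\<lambda>t s. s *\<^sub>R f' t"])
    show "onorm (\<lambda>s. s *\<^sub>R f' t) \<le> B" if "t \<in> {a..b}" for t
    proof (rule onorm_bound)
      show "0 \<le> B" using assms(3)[OF that] norm_ge_zero order_trans by blast
      show "norm (s *\<^sub>R f' t) \<le> B * norm s" for s :: real
        using mult_left_mono[OF assms(3)[OF that], of "\<bar>s\<bar>"] by (simp add: mult.commute)
    qed
  qed (use assms in \<open>auto simp: has_vector_derivative_def\<close>)
  then show ?thesis using assms(1) by simp
qed

lemma discrete_gronwall:
  fixes s :: "nat \<Rightarrow> real"
  assumes step: "\<And>n. n < N \<Longrightarrow> s (Suc n) \<le> (1 + a) * s n + b"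
    and "a \<ge> 0" "b \<ge> 0" "s 0 \<ge> 0" and "n \<le> N"
  shows "s n \<le> exp (a * real n) * (s 0 + b * real n)"
  using \<open>n \<le> N\<close>
proof (induction n)
  case 0
  then show ?case by simp
next
  case (Suc n)
  have "s (Suc n) \<le> (1 + a) * s n + b" using step Suc by simp
  also have "\<dots> \<le> (1 + a) * (exp (a * real n) * (s 0 + b * real n)) + b"
    using Suc assms by (intro add_right_mono mult_left_mono) auto
  also have "\<dots> \<le> exp a * (exp (a * real n) * (s 0 + b * real n)) + exp (a * real (Suc n)) * b"
    using assms by (intro add_mono mult_right_mono exp_ge_add_one_self)
      (auto simp: mult_le_cancel_right1 intro!: mult_nonneg_nonneg add_nonneg_nonneg)
  also have "\<dots> = exp (a * real (Suc n)) * (s 0 + b * real (Suc n))"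
    by (simp add: algebra_simps exp_add)
  finally show ?case .
qed

section \<open>The common two-step form of the three methods\<close>

text \<open>Here \<open>\<omega> n = x n - x (n - 1)\<close>. For the Boris and the standard variational method
  \<open>\<tau> = h / (2 \<epsilon>)\<close>, for the filtered method \<open>\<tau> = tan (h / (2 \<epsilon>))\<close>.\<close>

definition two_step ::
  "real^3 \<Rightarrow> real \<Rightarrow> real \<Rightarrow> real \<Rightarrow> real \<Rightarrow> nat \<Rightarrow> (nat \<Rightarrow> real^3) \<Rightarrow> (nat \<Rightarrow> real^3) \<Rightarrow> bool" where
  "two_step B0 M h \<epsilon> \<tau> N \<omega> f \<longleftrightarrow>
     0 < \<epsilon> \<and> \<epsilon> \<le> h\<^sup>2 \<and> 0 < h \<and> h \<le> 1 \<and> 6 * M * h \<le> 1 \<and> real N * h \<le> M \<and>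
     \<tau> \<noteq> 0 \<and> \<bar>1 / \<tau>\<bar> \<le> M \<and> \<bar>\<tau>\<bar> * \<epsilon> \<le> M * h \<and>
     (\<forall>n\<le>N. B0 \<bullet> (\<omega> (Suc n) - \<omega> n) = h\<^sup>2 * (B0 \<bullet> f n) \<and>
            perp B0 (\<omega> (Suc n) - \<omega> n)
              = \<tau> *\<^sub>R ((\<omega> (Suc n) + \<omega> n) \<times> B0 + (2 * h * \<epsilon>) *\<^sub>R perp B0 (f n)) \<and>
            norm (f n) \<le> M * (norm (\<omega> (Suc n) + \<omega> n) / h + 1)) \<and>
     \<bar>B0 \<bullet> (\<omega> 1 + \<omega> 0)\<bar> \<le> M * h \<and>
     norm (perp B0 (\<omega> 1 + \<omega> 0)) \<le> M * h\<^sup>2 \<and>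
     \<bar>\<tau>\<bar> * norm (perp B0 (\<omega> 1 + \<omega> 0)) \<le> M * h\<^sup>2"

text \<open>The force is bounded only in terms of the velocity, so the estimate takes two passes.
  Gronwall's inequality for the sum of the parallel and perpendicular sizes gives O(h), hence a
  bounded force. Then the isometry is used again with the forcing 2 h \<epsilon> F \<le> 2 h^3 F,
  which over O(1 / h) steps adds only O(h^2) to the perpendicular part.\<close>

lemma two_step_apriori:
  assumes unit: "norm B0 = 1" and M: "M \<ge> 1"
  obtains K where "K \<ge> M" and
    "\<And>h \<epsilon> \<tau> N \<omega> f n. two_step B0 M h \<epsilon> \<tau> N \<omega> f \<Longrightarrow> n \<le> Suc N \<Longrightarrow> norm (\<omega> n) \<le> K * h"
    "\<And>h \<epsilon> \<tau> N \<omega> f n. two_step B0 M h \<epsilon> \<tau> N \<omega> f \<Longrightarrow> n \<le> Suc N \<Longrightarrow> norm (perp B0 (\<omega> n)) \<le> K * h\<^sup>2"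
    "\<And>h \<epsilon> \<tau> N \<omega> f n. two_step B0 M h \<epsilon> \<tau> N \<omega> f \<Longrightarrow> n \<le> N \<Longrightarrow> norm (\<omega> (Suc n) - \<omega> n) \<le> K * h\<^sup>2"
    "\<And>h \<epsilon> \<tau> N \<omega> f n. two_step B0 M h \<epsilon> \<tau> N \<omega> f \<Longrightarrow> n \<le> N \<Longrightarrow> norm (f n) \<le> K"
proof -
  \<comment> \<open>The exponent is the growth rate \<open>12 * M * h\<close> times the number of
    steps, since (N + 1) h \<le> 2 M; \<open>6 * M^3\<close> comes from the start and
    \<open>12 * M\<^sup>2\<close> from the constant part of the force. \<open>F\<close> then bounds
    the force, and \<open>K2\<close> is the start \<open>4 * M^3\<close> plus the rate 2 F over the
    time 2 M.\<close>
  define K1 where "K1 = exp (24 * M * M) * (6 * M^3 + 12 * M\<^sup>2)"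
  define F where "F = M * (2 * K1 + 1)"
  define K2 where "K2 = 4 * M^3 + 4 * M * F"
  have M_le: "M \<le> M\<^sup>2" "M\<^sup>2 \<le> M^3" "1 \<le> M\<^sup>2"
    using M power_increasing[of 1 2 M] power_increasing[of 2 3 M] one_le_power[of M 2] by auto
  have K1_ge: "K1 \<ge> 18"
  proof -
    have "1 * 18 \<le> exp (24 * M * M) * (6 * M^3 + 12 * M\<^sup>2)"
      using M M_le by (intro mult_mono) auto
    then show ?thesis by (simp add: K1_def)
  qed
  have F_ge: "F \<ge> M" "F \<ge> 0" "K2 \<ge> 0"
    using M K1_ge mult_left_mono[of 1 "2 * K1 + 1" M] by (auto simp: F_def K2_def)
  have all: "(\<forall>n\<le>Suc N. norm (\<omega> n) \<le> K1 * h) \<and> (\<forall>n\<le>Suc N. norm (perp B0 (\<omega> n)) \<le> K2 * h\<^sup>2)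
      \<and> (\<forall>n\<le>N. norm (\<omega> (Suc n) - \<omega> n) \<le> (2 * K2 + F) * h\<^sup>2) \<and> (\<forall>n\<le>N. norm (f n) \<le> F)"
    if ts: "two_step B0 M h \<epsilon> \<tau> N \<omega> f" for h \<epsilon> \<tau> N \<omega> f
  proof -
    have h: "0 < h" "h \<le> 1" "6 * M * h \<le> 1" and eps: "0 < \<epsilon>" "\<epsilon> \<le> h\<^sup>2"
      and Nh: "real N * h \<le> M" and tau: "\<bar>\<tau>\<bar> * \<epsilon> \<le> M * h"
      and par: "\<And>n. n \<le> N \<Longrightarrow> B0 \<bullet> (\<omega> (Suc n) - \<omega> n) = h\<^sup>2 * (B0 \<bullet> f n)"
      and prp: "\<And>n. n \<le> N \<Longrightarrow> perp B0 (\<omega> (Suc n) - \<omega> n)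
              = \<tau> *\<^sub>R ((\<omega> (Suc n) + \<omega> n) \<times> B0 + (2 * h * \<epsilon>) *\<^sub>R perp B0 (f n))"
      and fb: "\<And>n. n \<le> N \<Longrightarrow> norm (f n) \<le> M * (norm (\<omega> (Suc n) + \<omega> n) / h + 1)"
      and st: "\<bar>B0 \<bullet> (\<omega> 1 + \<omega> 0)\<bar> \<le> M * h"
        "norm (perp B0 (\<omega> 1 + \<omega> 0)) \<le> M * h\<^sup>2"
        "\<bar>\<tau>\<bar> * norm (perp B0 (\<omega> 1 + \<omega> 0)) \<le> M * h\<^sup>2"
      using ts by (auto simp: two_step_def)
    have h2: "h\<^sup>2 \<le> h" using h by (simp add: power2_eq_square mult_left_le)
    have Nh': "real (Suc N) * h \<le> 2 * M" using Nh h M by (simp add: algebra_simps)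
    have eps_h: "h * \<epsilon> \<le> h\<^sup>2"
      unfolding power2_eq_square
      by (rule mult_left_mono) (use order.trans[OF eps(2) h2] h in auto)
    have prp_step: "norm (perp B0 (\<omega> (Suc n))) \<le> norm (perp B0 (\<omega> n)) + 2 * h * \<epsilon> * norm (f n)"
      if "n \<le> N" for n
    proof -
      let ?g = "(2 * h * \<epsilon>) *\<^sub>R perp B0 (f n)"
      have pp: "perp B0 (perp B0 a) = perp B0 a" for a
        by (simp add: perp_def[of B0 "perp B0 a"] inner_perp[OF unit])
      have "norm (perp B0 (\<omega> (Suc n))) \<le> norm (perp B0 (\<omega> n)) + norm ?g"
      proof (rule cayley_step_norm[OF unit, where \<tau> = \<tau>])
        show "perp B0 ?g = ?g" by (simp add: perp_scaleR pp)
        show "perp B0 (\<omega> (Suc n)) - perp B0 (\<omega> n)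
            = \<tau> *\<^sub>R ((perp B0 (\<omega> (Suc n)) + perp B0 (\<omega> n)) \<times> B0 + ?g)"
          using prp[OF that] by (simp add: perp_diff cross_add_left perp_cross)
      qed (simp_all add: pp)
      also have "norm ?g \<le> 2 * h * \<epsilon> * norm (f n)"
        using h eps norm_perp_le[OF unit, of "f n"] by simp
      finally show ?thesis by simp
    qed
    have par_step: "\<bar>B0 \<bullet> \<omega> (Suc n)\<bar> \<le> \<bar>B0 \<bullet> \<omega> n\<bar> + h\<^sup>2 * norm (f n)" if "n \<le> N" for n
    proof -
      have "B0 \<bullet> \<omega> (Suc n) = B0 \<bullet> \<omega> n + h\<^sup>2 * (B0 \<bullet> f n)"
        using par[OF that] by (simp add: inner_diff_right)
      moreover have "\<bar>h\<^sup>2 * (B0 \<bullet> f n)\<bar> \<le> h\<^sup>2 * norm (f n)"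
        using abs_inner_le[OF unit, of "f n"] by (simp add: abs_mult mult_left_mono)
      ultimately show ?thesis by linarith
    qed
    define s where "s n = \<bar>B0 \<bullet> \<omega> n\<bar> + norm (perp B0 (\<omega> n))" for n
    have s_nonneg: "s n \<ge> 0" for n by (simp add: s_def)
    have norm_s: "norm (\<omega> n) \<le> s n" for n
      unfolding s_def by (rule norm_le_components[OF unit])
    \<comment> \<open>The data control only the sum of the two starting increments. Their difference
      is read off from the relation at n = 0, and subtraction gives \<omega> 0. This multiplies the
      perpendicular sum by \<tau>, hence the separate smallness condition on that product in
      \<open>two_step\<close>.\<close>
    have start: "s 0 \<le> 6 * M^3 * h" "norm (perp B0 (\<omega> 0)) \<le> 4 * M^3 * h\<^sup>2"
    proof -
      have "norm (\<omega> 1 + \<omega> 0) \<le> M * h + M * h\<^sup>2"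
        using norm_le_components[OF unit, of "\<omega> 1 + \<omega> 0"] st by linarith
      also have "\<dots> \<le> (2 * M) * h" using M h2 by simp
      finally have "norm (\<omega> 1 + \<omega> 0) / h \<le> 2 * M"
        using h by (simp add: pos_divide_le_eq)
      then have "M * (norm (\<omega> 1 + \<omega> 0) / h + 1) \<le> M * (3 * M)"
        using M by (intro mult_left_mono) auto
      then have f0: "norm (f 0) \<le> 3 * M\<^sup>2"
        using fb[of 0] by (simp add: power2_eq_square)
      have "2 * (B0 \<bullet> \<omega> 0) = B0 \<bullet> (\<omega> 1 + \<omega> 0) - h\<^sup>2 * (B0 \<bullet> f 0)"
        using par[of 0] by (simp add: inner_diff_right inner_add_right)
      moreover have "\<bar>h\<^sup>2 * (B0 \<bullet> f 0)\<bar> \<le> h\<^sup>2 * (3 * M\<^sup>2)"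
        using abs_inner_le[OF unit, of "f 0"] f0 by (auto simp: abs_mult intro: mult_left_mono)
      ultimately have "2 * \<bar>B0 \<bullet> \<omega> 0\<bar> \<le> M * h + h\<^sup>2 * (3 * M\<^sup>2)"
        using st by linarith
      moreover have "h\<^sup>2 * (3 * M\<^sup>2) \<le> h * (3 * M^3)"
        using h2 M M_le h by (intro mult_mono) auto
      moreover have "M * h \<le> M^3 * h" using M_le h by simp
      ultimately have 1: "\<bar>B0 \<bullet> \<omega> 0\<bar> \<le> 2 * M^3 * h" by (simp add: algebra_simps)
      have "2 *\<^sub>R perp B0 (\<omega> 0) = perp B0 (\<omega> 1 + \<omega> 0) - perp B0 (\<omega> (Suc 0) - \<omega> 0)"
        by (simp add: perp_add perp_diff algebra_simps scaleR_2)
      also have "norm \<dots> \<le> norm (perp B0 (\<omega> 1 + \<omega> 0))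
          + norm (\<tau> *\<^sub>R ((\<omega> 1 + \<omega> 0) \<times> B0 + (2 * h * \<epsilon>) *\<^sub>R perp B0 (f 0)))"
        using prp[of 0] norm_triangle_ineq4 by (metis One_nat_def le0)
      also have "norm (\<tau> *\<^sub>R ((\<omega> 1 + \<omega> 0) \<times> B0 + (2 * h * \<epsilon>) *\<^sub>R perp B0 (f 0)))
         \<le> \<bar>\<tau>\<bar> * (norm (perp B0 (\<omega> 1 + \<omega> 0)) + 2 * h * \<epsilon> * norm (f 0))"
      proof -
        have "norm ((\<omega> 1 + \<omega> 0) \<times> B0 + (2 * h * \<epsilon>) *\<^sub>R perp B0 (f 0))
            \<le> norm (perp B0 (\<omega> 1 + \<omega> 0)) + 2 * h * \<epsilon> * norm (perp B0 (f 0))"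
          using norm_triangle_ineq[of "(\<omega> 1 + \<omega> 0) \<times> B0" "(2 * h * \<epsilon>) *\<^sub>R perp B0 (f 0)"] h eps
          by (simp add: norm_cross_unit[OF unit])
        also have "\<dots> \<le> norm (perp B0 (\<omega> 1 + \<omega> 0)) + 2 * h * \<epsilon> * norm (f 0)"
          using norm_perp_le[OF unit, of "f 0"] h eps by simp
        finally show ?thesis by (auto intro: mult_left_mono)
      qed
      also have "\<dots> = \<bar>\<tau>\<bar> * norm (perp B0 (\<omega> 1 + \<omega> 0)) + (\<bar>\<tau>\<bar> * \<epsilon>) * (2 * h * norm (f 0))"
        by (simp add: algebra_simps)
      also have "(\<bar>\<tau>\<bar> * \<epsilon>) * (2 * h * norm (f 0)) \<le> (M * h) * (2 * h * (3 * M\<^sup>2))"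
        using h M f0 by (intro mult_mono[OF tau]) auto
      finally have "norm (2 *\<^sub>R perp B0 (\<omega> 0)) \<le> M * h\<^sup>2 + M * h\<^sup>2 + (M * h) * (2 * h * (3 * M\<^sup>2))"
        using st by linarith
      then have "norm (perp B0 (\<omega> 0)) \<le> M * h\<^sup>2 + 3 * M^3 * h\<^sup>2"
        by (simp add: power2_eq_square power3_eq_cube algebra_simps)
      moreover have "M * h\<^sup>2 \<le> M^3 * h\<^sup>2" using M_le by (intro mult_right_mono) auto
      ultimately show p0: "norm (perp B0 (\<omega> 0)) \<le> 4 * M^3 * h\<^sup>2" by simp
      also have "\<dots> \<le> 4 * M^3 * h" using h2 M by (intro mult_left_mono) auto
      finally show "s 0 \<le> 6 * M^3 * h" using 1 by (simp add: s_def)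
    qed
    have s_step: "s (Suc n) \<le> (1 + 12 * M * h) * s n + 6 * M * h\<^sup>2" if "n < Suc N" for n
    proof -
      \<comment> \<open>The force involves the new increment, so \<open>s (Suc n)\<close> occurs on
        both sides. Multiplying by \<open>1 + 2 * z\<close> takes the place of dividing by
        \<open>1 - z\<close>, because (1 - z) (1 + 2 z) = 1 + z (1 - 2 z) \<ge> 1; here
        \<open>6 * M * h \<le> 1\<close> says 2 z \<le> 1.\<close>
      define z where "z = 3 * M * h"
      have z: "0 \<le> z" "2 * z \<le> 1" using h M by (auto simp: z_def)
      have "norm (\<omega> (Suc n) + \<omega> n) \<le> s (Suc n) + s n"
        using norm_triangle_ineq[of "\<omega> (Suc n)" "\<omega> n"] norm_s[of n] norm_s[of "Suc n"] by linarith
      then have "M * (norm (\<omega> (Suc n) + \<omega> n) / h + 1) \<le> M * ((s (Suc n) + s n) / h + 1)"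
        using h M by (intro mult_left_mono add_right_mono divide_right_mono) auto
      then have "norm (f n) \<le> M * ((s (Suc n) + s n) / h + 1)"
        using fb[of n] that by simp
      then have "h\<^sup>2 * norm (f n) \<le> h\<^sup>2 * (M * ((s (Suc n) + s n) / h + 1))"
        by (intro mult_left_mono) auto
      also have "\<dots> = M * h * (s (Suc n) + s n) + M * h\<^sup>2"
        using h by (simp add: field_simps power2_eq_square)
      finally have fh: "h\<^sup>2 * norm (f n) \<le> M * h * (s (Suc n) + s n) + M * h\<^sup>2" .
      have "h * \<epsilon> * norm (f n) \<le> h\<^sup>2 * norm (f n)"
        using eps_h by (intro mult_right_mono) auto
      then have "s (Suc n) \<le> s n + 3 * (h\<^sup>2 * norm (f n))"
        using prp_step[of n] par_step[of n] that by (simp add: s_def)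
      then have "s (Suc n) * (1 - z) \<le> (1 + z) * s n + z * h"
        using fh by (simp add: z_def algebra_simps power2_eq_square)
      then have "s (Suc n) * (1 - z) * (1 + 2 * z) \<le> ((1 + z) * s n + z * h) * (1 + 2 * z)"
        using z by (intro mult_right_mono) auto
      moreover have "s (Suc n) * (1 - z) * (1 + 2 * z) = s (Suc n) + s (Suc n) * (z * (1 - 2 * z))"
        by (simp add: algebra_simps)
      moreover have "s (Suc n) * (z * (1 - 2 * z)) \<ge> 0"
        using s_nonneg z by auto
      moreover have "((1 + z) * s n + z * h) * (1 + 2 * z)
         = (1 + 4 * z) * s n + 2 * z * h - (z * (1 - 2 * z)) * s n - z * h * (1 - 2 * z)"
        by (simp add: algebra_simps)
      moreover have "(z * (1 - 2 * z)) * s n \<ge> 0" "z * h * (1 - 2 * z) \<ge> 0"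
        using s_nonneg z h by auto
      ultimately have "s (Suc n) \<le> (1 + 4 * z) * s n + 2 * z * h" by linarith
      then show ?thesis by (simp add: z_def power2_eq_square algebra_simps)
    qed
    have s_bound: "s n \<le> K1 * h" if n: "n \<le> Suc N" for n
    proof -
      have "s n \<le> exp (12 * M * h * real n) * (s 0 + 6 * M * h\<^sup>2 * real n)"
        using s_step h M s_nonneg n by (intro discrete_gronwall[of "Suc N"]) auto
      also have "\<dots> \<le> exp (24 * M * M) * (6 * M^3 * h + 12 * M\<^sup>2 * h)"
      proof (intro mult_mono)
        have nh: "real n * h \<le> 2 * M"
        proof -
          have "real n * h \<le> real (Suc N) * h"
            using n h by (intro mult_right_mono) auto
          then show ?thesis using Nh' by linarith
        qed
        have "12 * M * (real n * h) \<le> 12 * M * (2 * M)"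
          using nh M by (intro mult_left_mono) auto
        then show "exp (12 * M * h * real n) \<le> exp (24 * M * M)"
          by (simp add: algebra_simps)
        have "(6 * M * h) * (real n * h) \<le> (6 * M * h) * (2 * M)"
          using nh M h by (intro mult_left_mono) auto
        then show "s 0 + 6 * M * h\<^sup>2 * real n \<le> 6 * M^3 * h + 12 * M\<^sup>2 * h"
          using start by (simp add: power2_eq_square algebra_simps)
      qed (use s_nonneg M h in auto)
      also have "\<dots> = K1 * h" by (simp add: K1_def algebra_simps)
      finally show ?thesis .
    qed
    have f_bound: "norm (f n) \<le> F" if "n \<le> N" for n
    proof -
      have "norm (\<omega> (Suc n) + \<omega> n) \<le> 2 * K1 * h"
        using norm_triangle_ineq[of "\<omega> (Suc n)" "\<omega> n"] norm_s[of n] norm_s[of "Suc n"]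
          s_bound[of n] s_bound[of "Suc n"] that by linarith
      then have "norm (\<omega> (Suc n) + \<omega> n) / h \<le> 2 * K1"
        using h by (simp add: pos_divide_le_eq)
      then have "M * (norm (\<omega> (Suc n) + \<omega> n) / h + 1) \<le> F"
        using M unfolding F_def by (intro mult_left_mono) auto
      then show ?thesis using fb[OF that] by linarith
    qed
    have prp_bound: "norm (perp B0 (\<omega> n)) \<le> 4 * M^3 * h\<^sup>2 + 2 * h * h\<^sup>2 * F * real n" if "n \<le> Suc N" for n
      using that
    proof (induction n)
      case 0
      then show ?case using start by simp
    next
      case (Suc n)
      have "2 * h * \<epsilon> * norm (f n) \<le> 2 * h * h\<^sup>2 * F"
        using f_bound[of n] Suc.prems eps h F_ge by (intro mult_mono) auto
      then show ?case using Suc prp_step[of n] by (simp add: algebra_simps)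
    qed
    have prp_bound': "norm (perp B0 (\<omega> n)) \<le> K2 * h\<^sup>2" if n: "n \<le> Suc N" for n
    proof -
      have "real n * h \<le> real (Suc N) * h"
        using n h by (intro mult_right_mono) auto
      then have "real n * h \<le> 2 * M" using Nh' by linarith
      then have "(2 * F * h\<^sup>2) * (real n * h) \<le> (2 * F * h\<^sup>2) * (2 * M)"
        using F_ge by (intro mult_left_mono) auto
      then show ?thesis using prp_bound[OF n] by (simp add: K2_def algebra_simps)
    qed
    have diff_bound: "norm (\<omega> (Suc n) - \<omega> n) \<le> (2 * K2 + F) * h\<^sup>2" if n: "n \<le> N" for n
    proof -
      have "\<bar>B0 \<bullet> (\<omega> (Suc n) - \<omega> n)\<bar> \<le> h\<^sup>2 * F"
        using par[OF n] f_bound[OF n] abs_inner_le[OF unit, of "f n"]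
        by (auto simp: abs_mult intro!: mult_left_mono)
      moreover have "norm (perp B0 (\<omega> (Suc n) - \<omega> n)) \<le> 2 * K2 * h\<^sup>2"
        using prp_bound'[of n] prp_bound'[of "Suc n"] n
          norm_triangle_ineq4[of "perp B0 (\<omega> (Suc n))" "perp B0 (\<omega> n)"] by (simp add: perp_diff)
      ultimately show ?thesis
        using norm_le_components[OF unit, of "\<omega> (Suc n) - \<omega> n"] by (simp add: algebra_simps)
    qed
    show ?thesis
      using s_bound norm_s prp_bound' diff_bound f_bound order_trans by blast
  qed
  define K where "K = K1 + 2 * K2 + F"
  show ?thesis
  proof (rule that[of K])
    show "M \<le> K" using F_ge K1_ge by (simp add: K_def)
    fix h \<epsilon> \<tau> N \<omega> f n
    assume ts: "two_step B0 M h \<epsilon> \<tau> N \<omega> f"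
    then have "h > 0" by (simp add: two_step_def)
    have "K1 \<le> K" "0 \<le> h" using F_ge \<open>h > 0\<close> M by (auto simp: K_def)
    then have up: "a \<le> K * h" if "a \<le> K1 * h" for a
      using that mult_right_mono[of K1 K h] by linarith
    have up2: "a \<le> K * h\<^sup>2" if "a \<le> K2 * h\<^sup>2 \<or> a \<le> (2 * K2 + F) * h\<^sup>2" for a
      using that mult_right_mono[of K2 K "h\<^sup>2"] mult_right_mono[of "2 * K2 + F" K "h\<^sup>2"] F_ge K1_ge
      by (auto simp: K_def)
    show "norm (\<omega> n) \<le> K * h" if "n \<le> Suc N" using all[OF ts] that up by blast
    show "norm (perp B0 (\<omega> n)) \<le> K * h\<^sup>2" if "n \<le> Suc N" using all[OF ts] that up2 by blast
    show "norm (\<omega> (Suc n) - \<omega> n) \<le> K * h\<^sup>2" if "n \<le> N" using all[OF ts] that up2 by blast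
    show "norm (f n) \<le> K" if "n \<le> N" using all[OF ts] that F_ge K1_ge by (force simp: K_def)
  qed
qed

section \<open>Slow variables of the numerical solution\<close>

text \<open>The first summand is the parallel velocity at the half step after n, the second the
  boundary term of the summation by parts. For \<tau> = h / (2 \<epsilon>) the factor
  \<open>1 / (2 * \<tau>)\<close> is \<epsilon> / h, which makes this the discrete form of
  \<open>guiding_velocity\<close>.\<close>

definition slow_velocity ::
  "real^3 \<Rightarrow> real \<Rightarrow> real \<Rightarrow> (nat \<Rightarrow> real^3) \<Rightarrow> (nat \<Rightarrow> real^3) \<Rightarrow> nat \<Rightarrow> real" where
  "slow_velocity B0 h \<tau> \<omega> b n =
     (B0 \<bullet> \<omega> (Suc n)) / h + 1 / (2 * \<tau>) * (B0 \<bullet> ((\<omega> (Suc n) \<times> B0) \<times> b n))"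

text \<open>A discrete guiding center: perpendicular to B0 it sits at the midpoint of x (n - 1) and
  x n, shifted by the gyration vector of the half-step velocity; along B0 it sits at x n.\<close>

definition slow_position ::
  "real^3 \<Rightarrow> real \<Rightarrow> (nat \<Rightarrow> real^3) \<Rightarrow> (nat \<Rightarrow> real^3) \<Rightarrow> nat \<Rightarrow> real^3" where
  "slow_position B0 \<tau> x \<omega> n = x n - (1 / 2) *\<^sub>R perp B0 (\<omega> n) + (1 / (2 * \<tau>)) *\<^sub>R (\<omega> n \<times> B0)"

text \<open>In leapfrog terms the second claim is a full kick, the third a drift, and the fourth
  half a kick backwards, which recovers the velocity at the grid point from the one at the half
  step. The corrections in \<open>X\<close> and \<open>Q\<close> are the boundary terms of the
  telescoping sum, hence defects O(h^3) although a perpendicular increment alone is O(h^2).\<close>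

lemma slow_variables:
  fixes B0 :: "real^3" and K h \<epsilon> \<tau> :: real and N :: nat and x \<omega> b f g :: "nat \<Rightarrow> real^3"
  defines "Q \<equiv> slow_velocity B0 h \<tau> \<omega> b" and "X \<equiv> slow_position B0 \<tau> x \<omega>"
  assumes unit: "norm B0 = 1" and K: "K \<ge> 1"
    and h: "0 < h" "h \<le> 1" and eps: "0 < \<epsilon>" "\<epsilon> \<le> h\<^sup>2"
    and tau: "\<tau> \<noteq> 0" "\<bar>1 / \<tau>\<bar> \<le> K"
    and par: "\<And>n. n \<le> N \<Longrightarrow> B0 \<bullet> (\<omega> (Suc n) - \<omega> n) = h\<^sup>2 * (B0 \<bullet> f n)"
    and prp: "\<And>n. n \<le> N \<Longrightarrow> perp B0 (\<omega> (Suc n) - \<omega> n)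
                = \<tau> *\<^sub>R ((\<omega> (Suc n) + \<omega> n) \<times> B0 + (2 * h * \<epsilon>) *\<^sub>R perp B0 (f n))"
    and x: "\<And>n. n \<le> N \<Longrightarrow> x (Suc n) = x n + \<omega> (Suc n)"
    and om: "\<And>n. n \<le> Suc N \<Longrightarrow> norm (\<omega> n) \<le> K * h"
    and omp: "\<And>n. n \<le> Suc N \<Longrightarrow> norm (perp B0 (\<omega> n)) \<le> K * h\<^sup>2"
    and f: "\<And>n. n \<le> N \<Longrightarrow> norm (f n) \<le> K"
    and b: "\<And>n. n \<le> N \<Longrightarrow> norm (b n) \<le> K"
    and bd: "\<And>n. Suc n \<le> N \<Longrightarrow> norm (b (Suc n) - b n) \<le> K * norm (\<omega> (Suc n))"
    and r: "\<And>n. n \<le> N \<Longrightarrow>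
      norm (f n - (((\<omega> (Suc n) + \<omega> n) /\<^sub>R (2 * h)) \<times> b n + g n)) \<le> K * h\<^sup>2"
  shows "\<And>n. n \<le> Suc N \<Longrightarrow> norm (X n - x n) \<le> K^2 * h\<^sup>2"
    and "\<And>n. Suc n \<le> N \<Longrightarrow> \<bar>Q (Suc n) - Q n - h * (B0 \<bullet> g (Suc n))\<bar> \<le> 3 * K^4 * h^3"
    and "\<And>n. n \<le> N \<Longrightarrow> norm (X (Suc n) - X n - (h * Q n) *\<^sub>R B0) \<le> 2 * K^3 * h^3"
    and "\<And>n. n \<le> N \<Longrightarrow>
      \<bar>(B0 \<bullet> (\<omega> (Suc n) + \<omega> n)) / (2 * h) - (Q n - h / 2 * (B0 \<bullet> g n))\<bar> \<le> 2 * K^3 * h\<^sup>2"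
proof -
  have Kp: "1 \<le> K^n" for n using K by (rule one_le_power)
  have Kle: "K^m \<le> K^n" if "m \<le> n" for m n using that K by (rule power_increasing)
  have h2: "h\<^sup>2 \<le> h" using h by (simp add: power2_eq_square mult_left_le)
  have hp: "h^3 = h * h\<^sup>2" "h^4 = h\<^sup>2 * h\<^sup>2" by (simp_all add: power2_eq_square power3_eq_cube power4_eq_xxxx)
  have tau2: "\<bar>1 / (2 * \<tau>)\<bar> \<le> K / 2" using tau(2) by (simp add: abs_mult)
  have J: "norm (\<omega> n \<times> B0) \<le> K * h\<^sup>2" if "n \<le> Suc N" for n
    using omp[OF that] by (simp add: norm_cross_unit[OF unit])
  have Jf: "norm (f n \<times> B0) \<le> K" if "n \<le> N" for n
    using f[OF that] norm_perp_le[OF unit, of "f n"] by (simp add: norm_cross_unit[OF unit])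
  \<comment> \<open>The relation gives the difference as \<tau> times the rotated sum. Rotating once
    more frees the sum at the price of dividing by \<tau>, harmless since \<open>1 / \<tau>\<close>
    is bounded: up to a term of size h \<epsilon> the sum is a difference of consecutive
    terms.\<close>
  have sum_eq: "(1/2) *\<^sub>R perp B0 (\<omega> (Suc n) + \<omega> n)
      = - (1 / (2 * \<tau>)) *\<^sub>R ((\<omega> (Suc n) - \<omega> n) \<times> B0) + (h * \<epsilon>) *\<^sub>R (f n \<times> B0)" if "n \<le> N" for n
  proof -
    have "(\<omega> (Suc n) - \<omega> n) \<times> B0 = perp B0 (\<omega> (Suc n) - \<omega> n) \<times> B0"
      by (simp add: perp_cross)
    also have "\<dots> = \<tau> *\<^sub>R (- perp B0 (\<omega> (Suc n) + \<omega> n) + (2 * h * \<epsilon>) *\<^sub>R (f n \<times> B0))"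
      unfolding prp[OF that]
      by (simp add: cross_add_left cross_mult_left cross_cross_unit[OF unit] perp_cross perp_add)
    finally have "(1 / (2 * \<tau>)) *\<^sub>R ((\<omega> (Suc n) - \<omega> n) \<times> B0)
        = (1/2) *\<^sub>R (- perp B0 (\<omega> (Suc n) + \<omega> n) + (2 * h * \<epsilon>) *\<^sub>R (f n \<times> B0))"
      using tau(1) by simp
    then show ?thesis by (simp add: algebra_simps)
  qed
  show Xx: "norm (X n - x n) \<le> K^2 * h\<^sup>2" if "n \<le> Suc N" for n
  proof -
    have "norm (X n - x n) \<le> norm ((1 / 2) *\<^sub>R perp B0 (\<omega> n)) + norm ((1 / (2 * \<tau>)) *\<^sub>R (\<omega> n \<times> B0))"
      unfolding X_def slow_position_def
      using norm_triangle_ineq[of "- ((1 / 2) *\<^sub>R perp B0 (\<omega> n))" "(1 / (2 * \<tau>)) *\<^sub>R (\<omega> n \<times> B0)"] by simp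
    also have "\<dots> \<le> 1 / 2 * (K * h\<^sup>2) + K / 2 * (K * h\<^sup>2)"
      using omp[OF that] mult_mono[OF tau2 J[OF that]] K by (simp del: abs_divide)
    also have "\<dots> \<le> K^2 * h\<^sup>2"
      using mult_right_mono[OF Kle[of 1 2], of "h\<^sup>2"] by (simp add: power2_eq_square)
    finally show ?thesis .
  qed
  have Qw: "\<bar>Q n - (B0 \<bullet> \<omega> (Suc n)) / h\<bar> \<le> K^3 * h\<^sup>2" if "n \<le> N" for n
  proof -
    have "\<bar>B0 \<bullet> ((\<omega> (Suc n) \<times> B0) \<times> b n)\<bar> \<le> norm (\<omega> (Suc n) \<times> B0) * norm (b n)"
      using abs_inner_le[OF unit] norm_cross_le order_trans by blast
    also have "\<dots> \<le> K * h\<^sup>2 * K"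
      using J[of "Suc n"] b[OF that] that K by (intro mult_mono) auto
    finally have "\<bar>1 / (2 * \<tau>)\<bar> * \<bar>B0 \<bullet> ((\<omega> (Suc n) \<times> B0) \<times> b n)\<bar> \<le> K / 2 * (K * h\<^sup>2 * K)"
      using tau2 K by (intro mult_mono) auto
    moreover have "K / 2 * (K * h\<^sup>2 * K) \<le> K^3 * h\<^sup>2"
      using K by (simp add: power3_eq_cube)
    ultimately show ?thesis
      by (simp add: Q_def slow_velocity_def abs_mult)
  qed
  show "\<bar>Q (Suc n) - Q n - h * (B0 \<bullet> g (Suc n))\<bar> \<le> 3 * K^4 * h^3" if n: "Suc n \<le> N" for n
  proof -
    define v where "v = (\<omega> (Suc (Suc n)) + \<omega> (Suc n)) /\<^sub>R (2 * h)"
    define \<rho> where "\<rho> = f (Suc n) - (v \<times> b (Suc n) + g (Suc n))"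
    have "norm \<rho> \<le> K * h\<^sup>2" using r[OF n] by (simp add: \<rho>_def v_def)
    then have 1: "\<bar>h * (B0 \<bullet> \<rho>)\<bar> \<le> K^4 * h^3"
    proof -
      have "\<bar>h * (B0 \<bullet> \<rho>)\<bar> \<le> h * (K * h\<^sup>2)"
        using abs_inner_le[OF unit, of \<rho>] \<open>norm \<rho> \<le> K * h\<^sup>2\<close> h by (simp add: abs_mult mult_left_mono)
      also have "\<dots> \<le> K^4 * h^3"
        using mult_right_mono[OF Kle[of 1 4], of "h^3"] h by (simp add: hp algebra_simps)
      finally show ?thesis .
    qed
    have hv: "h *\<^sub>R perp B0 v = - (1 / (2 * \<tau>)) *\<^sub>R ((\<omega> (Suc (Suc n)) - \<omega> (Suc n)) \<times> B0)
        + (h * \<epsilon>) *\<^sub>R (f (Suc n) \<times> B0)"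
      using sum_eq[OF n] h by (simp add: v_def perp_scaleR)
    have "h * (B0 \<bullet> (v \<times> b (Suc n))) = B0 \<bullet> ((h *\<^sub>R perp B0 v) \<times> b (Suc n))"
      by (simp add: cross_mult_left inner_cross_perp)
    also have "\<dots> = - (1 / (2 * \<tau>)) * (B0 \<bullet> (((\<omega> (Suc (Suc n)) - \<omega> (Suc n)) \<times> B0) \<times> b (Suc n)))
        + h * \<epsilon> * (B0 \<bullet> ((f (Suc n) \<times> B0) \<times> b (Suc n)))"
      unfolding hv by (simp add: cross_add_left cross_mult_left Cross3.left_diff_distrib inner_add_right inner_diff_right)
    finally have hv2: "h * (B0 \<bullet> (v \<times> b (Suc n)))
        = - (1 / (2 * \<tau>)) * (B0 \<bullet> (((\<omega> (Suc (Suc n)) - \<omega> (Suc n)) \<times> B0) \<times> b (Suc n)))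
        + h * \<epsilon> * (B0 \<bullet> ((f (Suc n) \<times> B0) \<times> b (Suc n)))" .
    have "(B0 \<bullet> \<omega> (Suc (Suc n))) / h - (B0 \<bullet> \<omega> (Suc n)) / h = h * (B0 \<bullet> f (Suc n))"
      using par[OF n] h by (simp add: inner_diff_right field_simps power2_eq_square)
    also have "\<dots> = h * (B0 \<bullet> (v \<times> b (Suc n))) + h * (B0 \<bullet> g (Suc n)) + h * (B0 \<bullet> \<rho>)"
      by (simp add: \<rho>_def inner_diff_right inner_add_right algebra_simps)
    \<comment> \<open>Discrete product rule: the increment of the correction in \<open>Q\<close>
      cancels the difference in \<open>hv2\<close> except where \<open>b\<close> changes between the
      steps. That leftover has a factor h^2 from \<open>\<omega> (Suc n) \<times> B0\<close> and a
      factor h from the change of \<open>b\<close>.\<close>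
    finally have "Q (Suc n) - Q n - h * (B0 \<bullet> g (Suc n)) = h * (B0 \<bullet> \<rho>)
        + h * \<epsilon> * (B0 \<bullet> ((f (Suc n) \<times> B0) \<times> b (Suc n)))
        + 1 / (2 * \<tau>) * (B0 \<bullet> ((\<omega> (Suc n) \<times> B0) \<times> (b (Suc n) - b n)))"
      unfolding Q_def slow_velocity_def using hv2
      by (simp add: Cross3.left_diff_distrib Cross3.right_diff_distrib inner_diff_right algebra_simps)
    moreover have "\<bar>h * \<epsilon> * (B0 \<bullet> ((f (Suc n) \<times> B0) \<times> b (Suc n)))\<bar> \<le> K^4 * h^3"
    proof -
      have "\<bar>B0 \<bullet> ((f (Suc n) \<times> B0) \<times> b (Suc n))\<bar> \<le> norm (f (Suc n) \<times> B0) * norm (b (Suc n))"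
        using abs_inner_le[OF unit] norm_cross_le order_trans by blast
      also have "\<dots> \<le> K * K" using Jf[OF n] b[OF n] K by (intro mult_mono) auto
      finally have "h * \<epsilon> * \<bar>B0 \<bullet> ((f (Suc n) \<times> B0) \<times> b (Suc n))\<bar> \<le> h * h\<^sup>2 * (K * K)"
        using h eps by (intro mult_mono) auto
      also have "\<dots> \<le> K^4 * h^3"
        using mult_right_mono[OF Kle[of 2 4], of "h^3"] h by (simp add: hp power2_eq_square algebra_simps)
      finally show ?thesis using h eps by (simp add: abs_mult)
    qed
    moreover have "\<bar>1 / (2 * \<tau>) * (B0 \<bullet> ((\<omega> (Suc n) \<times> B0) \<times> (b (Suc n) - b n)))\<bar> \<le> K^4 * h^3"
    proof -
      have "norm (b (Suc n) - b n) \<le> K * (K * h)"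
        using bd[OF n] om[of "Suc n"] n mult_left_mono[of "norm (\<omega> (Suc n))" "K * h" K] K by linarith
      moreover have "\<bar>B0 \<bullet> ((\<omega> (Suc n) \<times> B0) \<times> (b (Suc n) - b n))\<bar>
          \<le> norm (\<omega> (Suc n) \<times> B0) * norm (b (Suc n) - b n)"
        using abs_inner_le[OF unit] norm_cross_le order_trans by blast
      ultimately have "\<bar>B0 \<bullet> ((\<omega> (Suc n) \<times> B0) \<times> (b (Suc n) - b n))\<bar> \<le> (K * h\<^sup>2) * (K * (K * h))"
        using J[of "Suc n"] n K mult_mono[of "norm (\<omega> (Suc n) \<times> B0)" "K * h\<^sup>2" "norm (b (Suc n) - b n)" "K * (K * h)"]
        by simp
      then have "\<bar>1 / (2 * \<tau>)\<bar> * \<bar>B0 \<bullet> ((\<omega> (Suc n) \<times> B0) \<times> (b (Suc n) - b n))\<bar>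
          \<le> K / 2 * ((K * h\<^sup>2) * (K * (K * h)))"
        using tau2 K by (intro mult_mono) auto
      also have "\<dots> = K^4 * h^3 / 2" by (simp add: hp power4_eq_xxxx)
      also have "\<dots> \<le> K^4 * h^3" using K h by simp
      finally show ?thesis by (simp add: abs_mult)
    qed
    ultimately show ?thesis using 1 by linarith
  qed
  show "norm (X (Suc n) - X n - (h * Q n) *\<^sub>R B0) \<le> 2 * K^3 * h^3" if n: "n \<le> N" for n
  proof -
    have "X (Suc n) - X n = \<omega> (Suc n) - (1 / 2) *\<^sub>R perp B0 (\<omega> (Suc n) - \<omega> n)
        + (1 / (2 * \<tau>)) *\<^sub>R ((\<omega> (Suc n) - \<omega> n) \<times> B0)"
      unfolding X_def slow_position_def using x[OF n]
      by (simp add: perp_diff Cross3.left_diff_distrib algebra_simps)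
    \<comment> \<open>The shift by half a perpendicular increment turns the perpendicular part of
      \<open>\<omega> (Suc n)\<close> into the mean of two consecutive increments, the combination
      that \<open>sum_eq\<close> controls.\<close>
    also have "\<dots> = (B0 \<bullet> \<omega> (Suc n)) *\<^sub>R B0 + ((1 / 2) *\<^sub>R perp B0 (\<omega> (Suc n) + \<omega> n)
        + (1 / (2 * \<tau>)) *\<^sub>R ((\<omega> (Suc n) - \<omega> n) \<times> B0))"
    proof -
      have "\<omega> (Suc n) = (B0 \<bullet> \<omega> (Suc n)) *\<^sub>R B0 + (1/2) *\<^sub>R perp B0 (\<omega> (Suc n)) + (1/2) *\<^sub>R perp B0 (\<omega> (Suc n))"
        by (metis decomp scaleR_half_double scaleR_right_distrib add.assoc)
      then show ?thesis
        by (simp add: perp_diff perp_add algebra_simps)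
    qed
    also have "\<dots> = (B0 \<bullet> \<omega> (Suc n)) *\<^sub>R B0 + (h * \<epsilon>) *\<^sub>R (f n \<times> B0)"
      using sum_eq[OF n] by simp
    finally have "X (Suc n) - X n - (h * Q n) *\<^sub>R B0
        = (h * ((B0 \<bullet> \<omega> (Suc n)) / h - Q n)) *\<^sub>R B0 + (h * \<epsilon>) *\<^sub>R (f n \<times> B0)"
      using h by (simp add: algebra_simps)
    also have "norm \<dots> \<le> h * \<bar>(B0 \<bullet> \<omega> (Suc n)) / h - Q n\<bar> + h * \<epsilon> * norm (f n \<times> B0)"
      using norm_triangle_ineq[of "(h * ((B0 \<bullet> \<omega> (Suc n)) / h - Q n)) *\<^sub>R B0" "(h * \<epsilon>) *\<^sub>R (f n \<times> B0)"]
        h eps unit by (simp add: abs_mult)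
    also have "\<dots> \<le> h * (K^3 * h\<^sup>2) + h * h\<^sup>2 * K"
      using Qw[OF n] Jf[OF n] h eps by (intro add_mono mult_mono) (auto simp: abs_minus_commute)
    also have "\<dots> \<le> 2 * K^3 * h^3"
      using mult_right_mono[OF Kle[of 1 3], of "h^3"] h by (simp add: hp algebra_simps)
    finally show ?thesis .
  qed
  show "\<bar>(B0 \<bullet> (\<omega> (Suc n) + \<omega> n)) / (2 * h) - (Q n - h / 2 * (B0 \<bullet> g n))\<bar> \<le> 2 * K^3 * h\<^sup>2"
    if n: "n \<le> N" for n
  proof -
    define v where "v = (\<omega> (Suc n) + \<omega> n) /\<^sub>R (2 * h)"
    define \<rho> where "\<rho> = f n - (v \<times> b n + g n)"
    have rho: "norm \<rho> \<le> K * h\<^sup>2" using r[OF n] by (simp add: \<rho>_def v_def)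
    have "norm (perp B0 (\<omega> (Suc n) + \<omega> n)) \<le> 2 * K * h\<^sup>2"
      using omp[of n] omp[of "Suc n"] n norm_triangle_ineq[of "perp B0 (\<omega> (Suc n))" "perp B0 (\<omega> n)"]
      by (simp add: perp_add)
    then have pv: "norm (perp B0 v) \<le> K * h"
      using h unfolding v_def perp_scaleR by (simp add: field_simps power2_eq_square)
    have "\<bar>B0 \<bullet> (v \<times> b n)\<bar> \<le> norm (perp B0 v) * norm (b n)"
      using abs_inner_le[OF unit, of "perp B0 v \<times> b n"] norm_cross_le[of "perp B0 v" "b n"]
      by (simp add: inner_cross_perp)
    also have "\<dots> \<le> K * h * K" using pv b[OF n] K h by (intro mult_mono) auto
    finally have vb: "\<bar>B0 \<bullet> (v \<times> b n)\<bar> \<le> K * h * K" .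
    \<comment> \<open>The magnetic part of \<open>f n\<close> along B0 is O(h), because the
      perpendicular velocity is. Half a step of it is an O(h^2) error, so only \<open>g n\<close>
      remains in the backward half kick.\<close>
    have "(B0 \<bullet> (\<omega> (Suc n) + \<omega> n)) / (2 * h) = (B0 \<bullet> \<omega> (Suc n)) / h - h / 2 * (B0 \<bullet> f n)"
      using par[OF n] h by (simp add: inner_diff_right inner_add_right field_simps power2_eq_square)
    also have "B0 \<bullet> f n = B0 \<bullet> (v \<times> b n) + B0 \<bullet> g n + B0 \<bullet> \<rho>"
      by (simp add: \<rho>_def inner_diff_right inner_add_right)
    finally have "(B0 \<bullet> (\<omega> (Suc n) + \<omega> n)) / (2 * h) - (Q n - h / 2 * (B0 \<bullet> g n))
        = ((B0 \<bullet> \<omega> (Suc n)) / h - Q n) - h / 2 * (B0 \<bullet> (v \<times> b n) + B0 \<bullet> \<rho>)"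
      by (simp add: algebra_simps)
    moreover have "\<bar>h / 2 * (B0 \<bullet> (v \<times> b n) + B0 \<bullet> \<rho>)\<bar> \<le> h / 2 * (K * h * K + K * h\<^sup>2)"
      using vb abs_inner_le[OF unit, of \<rho>] rho h by (simp add: abs_mult)
    moreover have "h / 2 * (K * h * K + K * h\<^sup>2) \<le> K^3 * h\<^sup>2"
    proof -
      have "K * h\<^sup>2 \<le> K^2 * h"
        using mult_mono[OF Kle[of 1 2] h2] K h by simp
      then have "h / 2 * (K * h * K + K * h\<^sup>2) \<le> h / 2 * (2 * K^2 * h)"
        using h by (intro mult_left_mono) (auto simp: power2_eq_square)
      also have "\<dots> \<le> K^3 * h\<^sup>2"
        using mult_right_mono[OF Kle[of 2 3], of "h\<^sup>2"] by (simp add: power2_eq_square algebra_simps)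
      finally show ?thesis .
    qed
    ultimately show ?thesis using Qw[OF n] by linarith
  qed
qed

section \<open>Slow variables of the exact solution\<close>

text \<open>The magnetic force does no work, so the speed changes through \<open>e\<close> alone and
  the bound is independent of the size 1 / \<epsilon> of the field.\<close>

lemma velocity_bound:
  fixes q u :: "real \<Rightarrow> real^3"
  assumes sol: "charged_particle_solution B e T q u"
    and e: "\<And>t. t \<in> {0..T} \<Longrightarrow> norm (e (q t)) \<le> M" and t: "t \<in> {0..T}"
  shows "norm (u t) \<le> 1 + norm (u 0) + M * t"
proof -
  \<comment> \<open>A smooth substitute for the norm, which is not differentiable at 0; it costs the
    summand 1 in the bound.\<close>
  define \<phi> where "\<phi> t = sqrt (1 + u t \<bullet> u t)" for t
  have pos: "0 < 1 + u t \<bullet> u t" for t by (simp add: add_pos_nonneg)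
  have le: "norm (u t) \<le> \<phi> t" for t
    unfolding \<phi>_def by (rule real_le_rsqrt) (simp add: power2_norm_eq_inner)
  have "norm (\<phi> t - \<phi> 0) \<le> M * (t - 0)"
  proof (rule mvt_bound)
    fix s assume s: "s \<in> {0..t}"
    then have sT: "s \<in> {0..T}" using t by auto
    let ?u' = "u s \<times> B (q s) + e (q s)"
    have d: "(u has_vector_derivative ?u') (at s within {0..t})"
      by (rule has_vector_derivative_within_subset[of _ _ _ "{0..T}"])
        (use sol sT t in \<open>auto simp: charged_particle_solution_def\<close>)
    have "((\<lambda>t. 1 + u t \<bullet> u t) has_real_derivative (2 * (u s \<bullet> e (q s)))) (at s within {0..t})"
    proof -
      have "((\<lambda>t. u t \<bullet> u t) has_vector_derivative (u s \<bullet> ?u' + ?u' \<bullet> u s)) (at s within {0..t})"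
        by (rule bounded_bilinear.has_vector_derivative[OF bounded_bilinear_inner d d])
      then have "((\<lambda>t. 1 + u t \<bullet> u t) has_vector_derivative (0 + (u s \<bullet> ?u' + ?u' \<bullet> u s))) (at s within {0..t})"
        by (intro derivative_intros)
      then show ?thesis
        by (simp add: has_real_derivative_iff_has_vector_derivative inner_add_right inner_add_left
            dot_cross_self inner_commute)
    qed
    then have "(\<phi> has_real_derivative (inverse (\<phi> s) / 2 * (2 * (u s \<bullet> e (q s))))) (at s within {0..t})"
      unfolding \<phi>_def
      by (rule DERIV_chain2[where f = sqrt and g = "\<lambda>t. 1 + u t \<bullet> u t", OF DERIV_real_sqrt[OF pos]])
    then show "(\<phi> has_vector_derivative (inverse (\<phi> s) / 2 * (2 * (u s \<bullet> e (q s))))) (at s within {0..t})"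
      by (simp add: has_real_derivative_iff_has_vector_derivative)
    have "\<bar>u s \<bullet> e (q s)\<bar> \<le> norm (u s) * norm (e (q s))"
      by (rule Cauchy_Schwarz_ineq2)
    also have "\<dots> \<le> \<phi> s * M"
      using le[of s] e[OF sT] norm_ge_zero order_trans by (intro mult_mono) blast+
    moreover have "\<phi> s > 0" unfolding \<phi>_def using pos by simp
    ultimately show "norm (inverse (\<phi> s) / 2 * (2 * (u s \<bullet> e (q s)))) \<le> M"
      by (simp add: abs_mult field_simps)
  qed (use t in auto)
  moreover have "\<phi> 0 \<le> 1 + norm (u 0)"
    unfolding \<phi>_def by (rule real_le_lsqrt) (auto simp: power2_eq_square algebra_simps power2_norm_eq_inner[symmetric])
  ultimately show ?thesis using le[of t] by (simp add: abs_le_iff)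
qed

definition guiding_center :: "real^3 \<Rightarrow> real \<Rightarrow> (real \<Rightarrow> real^3) \<Rightarrow> (real \<Rightarrow> real^3) \<Rightarrow> real \<Rightarrow> real^3" where
  "guiding_center B0 \<epsilon> q u t = q t + \<epsilon> *\<^sub>R (u t \<times> B0)"

definition guiding_velocity ::
  "real^3 \<Rightarrow> real \<Rightarrow> (real^3 \<Rightarrow> real^3) \<Rightarrow> (real \<Rightarrow> real^3) \<Rightarrow> (real \<Rightarrow> real^3) \<Rightarrow> real \<Rightarrow> real" where
  "guiding_velocity B0 \<epsilon> b q u t = B0 \<bullet> u t + \<epsilon> * (B0 \<bullet> ((u t \<times> B0) \<times> b (q t)))"

text \<open>Since \<open>\<epsilon> (u \<times> B0)' = - perp B0 u + O(\<epsilon>)\<close>, the two corrections absorb the fast rotation of the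
  velocity, and what remains is \<open>y' = p B0 + O(\<epsilon>)\<close> and \<open>p' = B0 \<bullet> E(y) + O(\<epsilon>)\<close>.\<close>

lemma guiding_center_system:
  fixes B0 :: "real^3" and \<epsilon> T :: real and q u :: "real \<Rightarrow> real^3" and b e :: "real^3 \<Rightarrow> real^3"
  defines "y \<equiv> guiding_center B0 \<epsilon> q u" and "p \<equiv> guiding_velocity B0 \<epsilon> b q u"
  assumes unit: "norm B0 = 1" and M: "M \<ge> 1" and U: "U \<ge> 1" and L: "L \<ge> 4 * M\<^sup>2 * U\<^sup>2"
    and eps: "0 < \<epsilon>" "\<epsilon> \<le> 1"
    and sol: "charged_particle_solution (magnetic_field B0 b \<epsilon>) e T q u"
    and db: "\<And>x. (b has_derivative b' x) (at x)"
    and ub: "\<And>t. t \<in> {0..T} \<Longrightarrow> norm (u t) \<le> U"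
    and bb: "\<And>t. t \<in> {0..T} \<Longrightarrow> norm (b (q t)) \<le> M"
    and bb': "\<And>t v. t \<in> {0..T} \<Longrightarrow> norm (b' (q t) v) \<le> M * norm v"
    and eb: "\<And>t. t \<in> {0..T} \<Longrightarrow> norm (e (q t)) \<le> M"
    and el: "\<And>t. t \<in> {0..T} \<Longrightarrow> norm (e (q t) - e (y t)) \<le> M * norm (q t - y t)"
  obtains y' p' where
    "\<And>t. t \<in> {0..T} \<Longrightarrow> (y has_vector_derivative y' t) (at t within {0..T})"
    "\<And>t. t \<in> {0..T} \<Longrightarrow> (p has_vector_derivative p' t) (at t within {0..T})"
    "\<And>t. t \<in> {0..T} \<Longrightarrow> norm (y' t - p t *\<^sub>R B0) \<le> L * \<epsilon>"
    "\<And>t. t \<in> {0..T} \<Longrightarrow> \<bar>p' t - B0 \<bullet> e (y t)\<bar> \<le> L * \<epsilon>"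
    "\<And>t. t \<in> {0..T} \<Longrightarrow> norm (y t - q t) \<le> L * \<epsilon>"
    "\<And>t. t \<in> {0..T} \<Longrightarrow> \<bar>p t - B0 \<bullet> u t\<bar> \<le> L * \<epsilon>"
    "\<And>t. t \<in> {0..T} \<Longrightarrow> \<bar>p t\<bar> \<le> L"
proof -
  \<comment> \<open>\<open>F\<close> is the acceleration without its 1 / \<epsilon> part. In the
    derivatives of the two corrections the fast part appears with the factor \<epsilon> / \<epsilon>
    and cancels exactly, so at order 1 only the parallel velocity is left in \<open>y'\<close> and
    only the force \<open>e\<close> in \<open>p'\<close>.\<close>
  define F where "F t = u t \<times> b (q t) + e (q t)" for t
  define y' where "y' t = (B0 \<bullet> u t) *\<^sub>R B0 + \<epsilon> *\<^sub>R (F t \<times> B0)" for t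
  define p' where "p' t = B0 \<bullet> e (q t)
     + \<epsilon> * (B0 \<bullet> ((F t \<times> B0) \<times> b (q t)) + B0 \<bullet> ((u t \<times> B0) \<times> b' (q t) (u t)))" for t
  have "U * 1 \<le> U * U" "M * 1 \<le> M * M" "1 \<le> M * U"
    using U M mult_mono[of 1 M 1 U] by auto
  then have MU: "U \<le> U\<^sup>2" "M \<le> M\<^sup>2" "1 \<le> M * U" by (auto simp: power2_eq_square)
  have small: "c * \<epsilon> \<le> L * \<epsilon>" if "c \<le> 4 * M\<^sup>2 * U\<^sup>2" for c
    using that L eps by (intro mult_right_mono) auto
  have MU1: "M * U \<le> M\<^sup>2 * U\<^sup>2" "U \<le> M\<^sup>2 * U\<^sup>2" "M * U\<^sup>2 \<le> M\<^sup>2 * U\<^sup>2" "M\<^sup>2 * U \<le> M\<^sup>2 * U\<^sup>2" "M \<le> M * U"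
    using MU M U mult_mono[of 1 "M\<^sup>2" U "U\<^sup>2"] mult_mono[of M "M\<^sup>2" U "U\<^sup>2"] by (auto intro!: mult_mono)
  have du: "(u has_vector_derivative ((1 / \<epsilon>) *\<^sub>R (u t \<times> B0) + F t)) (at t within {0..T})"
    and dq: "(q has_vector_derivative u t) (at t within {0..T})" if "t \<in> {0..T}" for t
    using sol that by (auto simp: charged_particle_solution_def magnetic_field_def F_def
        cross_add_right cross_mult_right add.assoc)
  have duB: "((\<lambda>t. u t \<times> B0) has_vector_derivative (1 / \<epsilon>) *\<^sub>R (- perp B0 (u t)) + F t \<times> B0)
      (at t within {0..T})" if "t \<in> {0..T}" for t
  proof -
    have "((\<lambda>t. u t \<times> B0) has_vector_derivative u t \<times> 0 + ((1 / \<epsilon>) *\<^sub>R (u t \<times> B0) + F t) \<times> B0)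
      (at t within {0..T})"
      by (rule bounded_bilinear.has_vector_derivative[OF bilinear_cross3 du[OF that] has_vector_derivative_const])
    then show ?thesis
      by (simp add: cross_add_left cross_mult_left cross_cross_unit[OF unit])
  qed
  have nF: "norm (F t) \<le> 2 * M * U" if "t \<in> {0..T}" for t
  proof -
    have "norm (F t) \<le> norm (u t) * norm (b (q t)) + norm (e (q t))"
      unfolding F_def using norm_triangle_ineq norm_cross_le
      by (meson add_right_mono order_trans)
    also have "\<dots> \<le> U * M + M"
      using ub bb eb that U by (intro add_mono mult_mono) auto
    finally show ?thesis using MU1 by (simp add: algebra_simps)
  qed
  have crossB0: "norm (a \<times> B0) \<le> norm a" for a
    using norm_cross_le[of a B0] unit by simp
  have triple: "\<bar>B0 \<bullet> ((a \<times> B0) \<times> c)\<bar> \<le> norm a * norm c" for a c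
  proof -
    have "\<bar>B0 \<bullet> ((a \<times> B0) \<times> c)\<bar> \<le> norm (a \<times> B0) * norm c"
      using abs_inner_le[OF unit] norm_cross_le order_trans by blast
    also have "\<dots> \<le> norm a * norm c" using crossB0 by (intro mult_right_mono) auto
    finally show ?thesis .
  qed
  have 6: "\<bar>p t - B0 \<bullet> u t\<bar> \<le> M * U * \<epsilon>" if "t \<in> {0..T}" for t
  proof -
    have "norm (u t) * norm (b (q t)) \<le> U * M" using ub bb that U by (intro mult_mono) auto
    then have "\<bar>B0 \<bullet> ((u t \<times> B0) \<times> b (q t))\<bar> \<le> M * U"
      using triple[of "u t" "b (q t)"] by (simp add: mult.commute)
    then show ?thesis using eps mult_left_mono[of _ "M * U" \<epsilon>]
      by (simp add: p_def guiding_velocity_def abs_mult mult.commute)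
  qed
  have 5: "norm (y t - q t) \<le> U * \<epsilon>" if "t \<in> {0..T}" for t
    using crossB0[of "u t"] ub[OF that] eps by (simp add: y_def guiding_center_def mult.commute)
  show ?thesis
  proof (rule that[of y' p'])
    fix t assume t: "t \<in> {0..T}"
    have "(y has_vector_derivative u t + \<epsilon> *\<^sub>R ((1 / \<epsilon>) *\<^sub>R (- perp B0 (u t)) + F t \<times> B0)) (at t within {0..T})"
      unfolding y_def guiding_center_def[abs_def]
      by (intro has_vector_derivative_add dq[OF t]
          bounded_linear.has_vector_derivative[OF bounded_linear_scaleR_right] duB[OF t])
    moreover have "u t + \<epsilon> *\<^sub>R ((1 / \<epsilon>) *\<^sub>R (- perp B0 (u t)) + F t \<times> B0) = y' t"
      using eps by (simp add: y'_def perp_def algebra_simps)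
    ultimately show "(y has_vector_derivative y' t) (at t within {0..T})" by simp
    have "((\<lambda>t. b (q t)) has_vector_derivative b' (q t) (u t)) (at t within {0..T})"
      using has_derivative_compose[OF dq[OF t, unfolded has_vector_derivative_def] db]
      by (simp add: has_vector_derivative_def linear_scale[OF has_derivative_linear[OF db]])
    from bounded_bilinear.has_vector_derivative[OF bilinear_cross3 duB[OF t] this]
    have "((\<lambda>t. B0 \<bullet> u t + \<epsilon> * (B0 \<bullet> ((u t \<times> B0) \<times> b (q t)))) has_vector_derivative
        B0 \<bullet> ((1 / \<epsilon>) *\<^sub>R (u t \<times> B0) + F t) + \<epsilon> * (B0 \<bullet> ((u t \<times> B0) \<times> b' (q t) (u t)
         + ((1 / \<epsilon>) *\<^sub>R (- perp B0 (u t)) + F t \<times> B0) \<times> b (q t)))) (at t within {0..T})"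
      by (intro has_vector_derivative_add du[OF t]
          bounded_linear.has_vector_derivative[OF bounded_linear_inner_right]
          bounded_linear.has_vector_derivative[OF bounded_linear_mult_right])
    \<comment> \<open>The term \<open>u \<times> b\<close> inside \<open>F\<close> meets
      \<open>- perp B0 u \<times> b\<close> from the correction; along B0 the two agree up to sign
      by \<open>inner_cross_perp\<close>.\<close>
    moreover have "B0 \<bullet> ((1 / \<epsilon>) *\<^sub>R (u t \<times> B0) + F t) + \<epsilon> * (B0 \<bullet> ((u t \<times> B0) \<times> b' (q t) (u t)
         + ((1 / \<epsilon>) *\<^sub>R (- perp B0 (u t)) + F t \<times> B0) \<times> b (q t))) = p' t"
      using eps by (simp add: p'_def F_def inner_add_right dot_cross_self cross_add_left cross_mult_left
          Cross3.left_diff_distrib inner_diff_right inner_cross_perp algebra_simps)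
    ultimately show "(p has_vector_derivative p' t) (at t within {0..T})"
      by (simp add: p_def guiding_velocity_def[abs_def])
    have "norm (y' t - p t *\<^sub>R B0) = norm ((B0 \<bullet> u t - p t) *\<^sub>R B0 + \<epsilon> *\<^sub>R (F t \<times> B0))"
      by (simp add: y'_def algebra_simps)
    also have "\<dots> \<le> \<bar>B0 \<bullet> u t - p t\<bar> + \<epsilon> * norm (F t \<times> B0)"
      using norm_triangle_ineq[of "(B0 \<bullet> u t - p t) *\<^sub>R B0" "\<epsilon> *\<^sub>R (F t \<times> B0)"] unit eps by simp
    also have "\<dots> \<le> \<bar>B0 \<bullet> u t - p t\<bar> + \<epsilon> * norm (F t)"
      using eps crossB0 by (intro add_left_mono mult_left_mono) auto
    also have "\<dots> \<le> M * U * \<epsilon> + \<epsilon> * (2 * M * U)"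
      using 6[OF t] nF[OF t] eps by (intro add_mono mult_left_mono) (auto simp: abs_minus_commute)
    finally have "norm (y' t - p t *\<^sub>R B0) \<le> M * U * \<epsilon> + \<epsilon> * (2 * M * U)" .
    then show "norm (y' t - p t *\<^sub>R B0) \<le> L * \<epsilon>"
    proof -
      have "3 * M * U \<le> 4 * M\<^sup>2 * U\<^sup>2" using MU1(1) MU(3) by linarith
      with small[of "3 * M * U"]
        \<open>norm (y' t - p t *\<^sub>R B0) \<le> M * U * \<epsilon> + \<epsilon> * (2 * M * U)\<close>
      show ?thesis by (simp add: algebra_simps)
    qed
    have "\<bar>B0 \<bullet> e (q t) - B0 \<bullet> e (y t)\<bar> \<le> M * (U * \<epsilon>)"
    proof -
      have "\<bar>B0 \<bullet> (e (q t) - e (y t))\<bar> \<le> M * norm (q t - y t)"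
        using abs_inner_le[OF unit] el[OF t] order_trans by blast
      also have "\<dots> \<le> M * (U * \<epsilon>)"
        using 5[OF t] M by (intro mult_left_mono) (auto simp: norm_minus_commute)
      finally show ?thesis by (simp add: inner_diff_right)
    qed
    moreover have "\<bar>p' t - B0 \<bullet> e (q t)\<bar> \<le> \<epsilon> * (2 * M * U * M + U * (M * U))"
    proof -
      have "norm (F t) * norm (b (q t)) \<le> 2 * M * U * M"
        using nF[OF t] bb[OF t] M U by (intro mult_mono) auto
      moreover have "norm (u t) * norm (b' (q t) (u t)) \<le> U * (M * U)"
      proof (intro mult_mono)
        show "norm (b' (q t) (u t)) \<le> M * U"
          using bb'[OF t, of "u t"] mult_left_mono[OF ub[OF t], of M] M by linarith
      qed (use ub t U in auto)
      ultimately have "\<bar>B0 \<bullet> ((F t \<times> B0) \<times> b (q t)) + B0 \<bullet> ((u t \<times> B0) \<times> b' (q t) (u t))\<bar>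
          \<le> 2 * M * U * M + U * (M * U)"
        using triple[of "F t" "b (q t)"] triple[of "u t" "b' (q t) (u t)"] by linarith
      then show ?thesis using eps by (simp add: p'_def abs_mult)
    qed
    ultimately have "\<bar>p' t - B0 \<bullet> e (y t)\<bar> \<le> (2 * (M\<^sup>2 * U) + M * U\<^sup>2 + M * U) * \<epsilon>"
      by (simp add: power2_eq_square algebra_simps)
    also have "\<dots> \<le> L * \<epsilon>" using MU1 by (intro small) linarith
    finally show "\<bar>p' t - B0 \<bullet> e (y t)\<bar> \<le> L * \<epsilon>" .
    show "norm (y t - q t) \<le> L * \<epsilon>" "\<bar>p t - B0 \<bullet> u t\<bar> \<le> L * \<epsilon>"
      using 5[OF t] 6[OF t] small[of U] small[of "M * U"] MU1(1,2) MU(3) U by linarith+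
    have "\<bar>p t\<bar> \<le> M * U * \<epsilon> + U"
      using 6[OF t] abs_inner_le[OF unit, of "u t"] ub[OF t] by linarith
    also have "M * U * \<epsilon> \<le> M * U" using eps M U by (simp add: mult_left_le)
    finally show "\<bar>p t\<bar> \<le> L" using MU1(1,2) L U MU(3) by linarith
  qed
qed

text \<open>The exact slow flow satisfies the same leapfrog relations as the numerical one, with
  \<open>P\<close> in the role of the half-step velocity. The small difference between y' and p B0
  may oscillate on the time scale \<epsilon>, so y cannot be differentiated twice with uniform
  bounds. Nested mean value estimates replace Taylor's formula: derivatives are compared only up to
  additive terms O(\<epsilon>), and \<epsilon> \<le> h^2.\<close>

lemma slow_system_local_error:
  fixes B0 :: "real^3" and h :: real and y y' :: "real \<Rightarrow> real^3" and p p' :: "real \<Rightarrow> real" and e :: "real^3 \<Rightarrow> real^3"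
  defines "P \<equiv> (\<lambda>t. p t + h / 2 * (B0 \<bullet> e (y t)))"
  assumes unit: "norm B0 = 1" and L: "L \<ge> 1" and h: "0 < h" "h \<le> 1" and eps: "0 < \<epsilon>" "\<epsilon> \<le> h\<^sup>2"
    and dy: "\<And>t. t \<in> {0..T} \<Longrightarrow> (y has_vector_derivative y' t) (at t within {0..T})"
    and dp: "\<And>t. t \<in> {0..T} \<Longrightarrow> (p has_vector_derivative p' t) (at t within {0..T})"
    and y': "\<And>t. t \<in> {0..T} \<Longrightarrow> norm (y' t - p t *\<^sub>R B0) \<le> L * \<epsilon>"
    and p': "\<And>t. t \<in> {0..T} \<Longrightarrow> \<bar>p' t - B0 \<bullet> e (y t)\<bar> \<le> L * \<epsilon>"
    and pb: "\<And>t. t \<in> {0..T} \<Longrightarrow> \<bar>p t\<bar> \<le> L"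
    and de: "\<And>x. (e has_derivative e' x) (at x)"
    and eb: "\<And>t. t \<in> {0..T} \<Longrightarrow> norm (e (y t)) \<le> L"
    and eb': "\<And>t v. t \<in> {0..T} \<Longrightarrow> norm (e' (y t) v) \<le> L * norm v"
    and el': "\<And>t s v. t \<in> {0..T} \<Longrightarrow> s \<in> {0..T} \<Longrightarrow>
      norm (e' (y t) v - e' (y s) v) \<le> L * norm (y t - y s) * norm v"
    and t: "0 \<le> t" "t + h \<le> T"
  shows "norm (y (t + h) - y t - (h * P t) *\<^sub>R B0) \<le> 4 * L\<^sup>2 * h^3"
    and "\<bar>P (t + h) - P t - h * (B0 \<bullet> e (y (t + h)))\<bar> \<le> 7 * L^3 * h^3"
proof -
  define g where "g t = B0 \<bullet> e (y t)" for t
  define g' where "g' t = B0 \<bullet> e' (y t) (y' t)" for t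
  have Lp: "L \<le> L\<^sup>2" "L\<^sup>2 \<le> L^3" "L \<le> L^3"
    using L power_increasing[of 1 2 L] power_increasing[of 2 3 L] power_increasing[of 1 3 L] by auto
  have h2: "h\<^sup>2 \<le> h" "h\<^sup>2 \<le> 1" using h by (simp_all add: power2_eq_square mult_left_le mult_le_one)
  have eps1: "\<epsilon> \<le> 1" "L * \<epsilon> \<le> L" "L * \<epsilon> \<le> L * h\<^sup>2" using eps h2 L by (auto simp: mult_left_le)
  have sub: "s \<in> {t..t + h} \<Longrightarrow> s \<in> {0..T}" for s using t by auto
  have within: "(f has_vector_derivative D) (at s within {t..r})"
    if "(f has_vector_derivative D) (at s within {0..T})" "r \<le> t + h" for f :: "real \<Rightarrow> 'a::real_normed_vector" and D s r
    using that(1) by (rule has_vector_derivative_within_subset) (use t that(2) in auto)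
  have ny': "norm (y' s) \<le> 2 * L" if "s \<in> {0..T}" for s
    using y'[OF that] pb[OF that] eps1 norm_triangle_sub[of "y' s" "p s *\<^sub>R B0"] unit by simp
  have ng: "\<bar>g s\<bar> \<le> L" if "s \<in> {0..T}" for s
    using abs_inner_le[OF unit, of "e (y s)"] eb[OF that] by (simp add: g_def)
  have np': "\<bar>p' s\<bar> \<le> 2 * L" if "s \<in> {0..T}" for s
    using p'[OF that] ng[OF that] eps1 by (simp add: g_def)
  have ng': "\<bar>g' s\<bar> \<le> 2 * L\<^sup>2" if "s \<in> {0..T}" for s
  proof -
    have "\<bar>g' s\<bar> \<le> L * norm (y' s)"
      unfolding g'_def using abs_inner_le[OF unit] eb'[OF that] order_trans by blast
    also have "\<dots> \<le> L * (2 * L)" using ny'[OF that] L by (intro mult_left_mono) auto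
    finally show ?thesis by (simp add: power2_eq_square)
  qed
  have dg: "(g has_vector_derivative g' s) (at s within {0..T})" if "s \<in> {0..T}" for s
  proof -
    have "((\<lambda>s. e (y s)) has_vector_derivative e' (y s) (y' s)) (at s within {0..T})"
      using has_derivative_compose[OF dy[OF that, unfolded has_vector_derivative_def] de]
      by (simp add: has_vector_derivative_def linear_scale[OF has_derivative_linear[OF de]])
    then show ?thesis unfolding g_def[abs_def] g'_def
      by (rule bounded_linear.has_vector_derivative[OF bounded_linear_inner_right])
  qed
  have lip: "norm (f s - f r) \<le> c * (s - r)"
    if "\<And>s. s \<in> {0..T} \<Longrightarrow> (f has_vector_derivative f' s) (at s within {0..T})"
      and "\<And>s. s \<in> {0..T} \<Longrightarrow> norm (f' s) \<le> c" and "0 \<le> r" "r \<le> s" "s \<le> T"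
    for f f' :: "real \<Rightarrow> 'b::real_normed_vector" and c r s
  proof (rule mvt_bound)
    fix a assume "a \<in> {r..s}"
    then have "a \<in> {0..T}" "{r..s} \<subseteq> {0..T}" using that by auto
    then show "(f has_vector_derivative f' a) (at a within {r..s})" "norm (f' a) \<le> c"
      using that(1,2) has_vector_derivative_within_subset by blast+
  qed (use that in auto)
  have lg: "\<bar>g s - g r\<bar> \<le> 2 * L\<^sup>2 * (s - r)" if "0 \<le> r" "r \<le> s" "s \<le> T" for r s
    using lip[of g g' "2 * L\<^sup>2" r s] dg ng' that by simp
  have ly: "norm (y s - y r) \<le> 2 * L * (s - r)" if "0 \<le> r" "r \<le> s" "s \<le> T" for r s
    using lip[of y y' "2 * L" r s] dy ny' that by simp
  have lp: "\<bar>p s - p r\<bar> \<le> 2 * L * (s - r)" if "0 \<le> r" "r \<le> s" "s \<le> T" for r s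
    using lip[of p p' "2 * L" r s] dp np' that by simp
  \<comment> \<open>Both values of y' are compared with p B0, which is Lipschitz uniformly in
    \<epsilon>; each comparison costs L \<epsilon>, hence the term with \<epsilon>.\<close>
  have lg': "\<bar>g' r - g' s\<bar> \<le> 2 * L\<^sup>2 * \<epsilon> + 6 * L^3 * (s - r)" if rs: "0 \<le> r" "r \<le> s" "s \<le> T" for r s
  proof -
    have m: "r \<in> {0..T}" "s \<in> {0..T}" using that by auto
    have "y' r - y' s = (y' r - p r *\<^sub>R B0) - (y' s - p s *\<^sub>R B0) + (p r - p s) *\<^sub>R B0"
      by (simp add: scaleR_left_diff_distrib)
    moreover have "norm (a - b + c) \<le> norm a + norm b + norm c" for a b c :: "real^3"
      using norm_triangle_ineq[of "a - b" c] norm_triangle_ineq4[of a b] by linarith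
    ultimately have "norm (y' r - y' s)
        \<le> norm (y' r - p r *\<^sub>R B0) + norm (y' s - p s *\<^sub>R B0) + norm ((p r - p s) *\<^sub>R B0)"
      by metis
    also have "\<dots> \<le> 2 * L * \<epsilon> + 2 * L * (s - r)"
      using y'[OF m(1)] y'[OF m(2)] lp[OF rs] unit by (simp add: abs_minus_commute)
    finally have 1: "norm (y' r - y' s) \<le> 2 * L * \<epsilon> + 2 * L * (s - r)" .
    have "g' r - g' s = B0 \<bullet> (e' (y r) (y' r - y' s) + (e' (y r) (y' s) - e' (y s) (y' s)))"
      by (simp add: g'_def inner_diff_right inner_add_right linear_diff[OF has_derivative_linear[OF de]])
    then have "\<bar>g' r - g' s\<bar> \<le> norm (e' (y r) (y' r - y' s)) + norm (e' (y r) (y' s) - e' (y s) (y' s))"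
      using abs_inner_le[OF unit] norm_triangle_ineq order_trans by metis
    also have "\<dots> \<le> L * norm (y' r - y' s) + L * norm (y r - y s) * norm (y' s)"
      using eb'[OF m(1)] el'[OF m] by (intro add_mono) auto
    also have "\<dots> \<le> L * (2 * L * \<epsilon> + 2 * L * (s - r)) + L * (2 * L * (s - r)) * (2 * L)"
      using 1 ly[OF rs] ny'[OF m(2)] L rs
      by (intro add_mono mult_mono) (auto simp: norm_minus_commute)
    also have "\<dots> = 2 * L\<^sup>2 * \<epsilon> + (2 * L\<^sup>2 + 4 * L^3) * (s - r)"
      by (simp add: power2_eq_square power3_eq_cube algebra_simps)
    also have "\<dots> \<le> 2 * L\<^sup>2 * \<epsilon> + 6 * L^3 * (s - r)"
      using Lp rs by (intro add_left_mono mult_right_mono) auto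
    finally show ?thesis .
  qed
  have t0: "t \<in> {0..T}" using t h by auto
  have pt: "\<bar>p s - p t - (s - t) * g t\<bar> \<le> 3 * L\<^sup>2 * h\<^sup>2" if s: "s \<in> {t..t + h}" for s
  proof -
    have "norm ((p s - p t - (s - t) * g t) - (p t - p t - (t - t) * g t)) \<le> (L * h + 2 * L\<^sup>2 * h) * (s - t)"
    proof (rule mvt_bound)
      fix r assume r: "r \<in> {t..s}"
      then have rT: "r \<in> {0..T}" using sub[of r] s by auto
      show "((\<lambda>s. p s - p t - (s - t) * g t) has_vector_derivative (p' r - g t)) (at r within {t..s})"
        by (rule derivative_eq_intros within[OF dp[OF rT]] | use s in simp)+
      have "\<bar>p' r - g t\<bar> \<le> L * \<epsilon> + 2 * L\<^sup>2 * (r - t)"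
        using p'[OF rT] lg[of t r] r t rT by (simp add: g_def)
      also have "\<dots> \<le> L * h + 2 * L\<^sup>2 * h"
        using eps h2 L s r by (intro add_mono mult_left_mono) auto
      finally show "norm (p' r - g t) \<le> L * h + 2 * L\<^sup>2 * h" by simp
    qed (use s in auto)
    also have "\<dots> \<le> (L * h + 2 * L\<^sup>2 * h) * h"
      using s h L by (intro mult_left_mono) auto
    also have "\<dots> = (L + 2 * L\<^sup>2) * h\<^sup>2" by (simp add: power2_eq_square algebra_simps)
    also have "\<dots> \<le> 3 * L\<^sup>2 * h\<^sup>2" using Lp by (intro mult_right_mono) auto
    finally show ?thesis by simp
  qed
  have "norm ((y (t + h) - y t - (h * p t + h\<^sup>2 / 2 * g t) *\<^sub>R B0)
      - (y t - y t - ((t - t) * p t + (t - t)\<^sup>2 / 2 * g t) *\<^sub>R B0)) \<le> 4 * L\<^sup>2 * h\<^sup>2 * ((t + h) - t)"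
  proof -
    have "norm ((y (t + h) - y t - ((t + h - t) * p t + (t + h - t)\<^sup>2 / 2 * g t) *\<^sub>R B0)
      - (y t - y t - ((t - t) * p t + (t - t)\<^sup>2 / 2 * g t) *\<^sub>R B0)) \<le> 4 * L\<^sup>2 * h\<^sup>2 * ((t + h) - t)"
    proof (rule mvt_bound)
      fix r assume r: "r \<in> {t..t + h}"
      then have rT: "r \<in> {0..T}" using sub[of r] by auto
      show "((\<lambda>s. y s - y t - ((s - t) * p t + (s - t)\<^sup>2 / 2 * g t) *\<^sub>R B0) has_vector_derivative
          (y' r - (p t + (r - t) * g t) *\<^sub>R B0)) (at r within {t..t + h})"
      proof -
        have "((\<lambda>s. (s - t) * p t + (s - t)\<^sup>2 / 2 * g t) has_real_derivative p t + (r - t) * g t)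
            (at r within {t..t + h})"
          by (auto intro!: derivative_eq_intros)
        then have "((\<lambda>s. ((s - t) * p t + (s - t)\<^sup>2 / 2 * g t) *\<^sub>R B0) has_vector_derivative
            (p t + (r - t) * g t) *\<^sub>R B0) (at r within {t..t + h})"
          unfolding has_real_derivative_iff_has_vector_derivative
          by (rule bounded_linear.has_vector_derivative[OF bounded_linear_scaleR_left])
        moreover have "((\<lambda>s. y s - y t) has_vector_derivative y' r - 0) (at r within {t..t + h})"
          by (intro has_vector_derivative_diff has_vector_derivative_const within[OF dy[OF rT]]) simp
        ultimately show ?thesis
          using has_vector_derivative_diff by fastforce
      qed
      have "norm (y' r - (p t + (r - t) * g t) *\<^sub>R B0)
          \<le> norm (y' r - p r *\<^sub>R B0) + norm ((p r - p t - (r - t) * g t) *\<^sub>R B0)"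
        using norm_triangle_ineq[of "y' r - p r *\<^sub>R B0" "(p r - p t - (r - t) * g t) *\<^sub>R B0"]
        by (simp add: algebra_simps)
      also have "\<dots> \<le> L * h\<^sup>2 + 3 * L\<^sup>2 * h\<^sup>2"
        using y'[OF rT] pt[OF r] unit eps1 by simp
      also have "\<dots> \<le> 4 * L\<^sup>2 * h\<^sup>2"
        using mult_right_mono[OF Lp(1), of "h\<^sup>2"] by simp
      finally show "norm (y' r - (p t + (r - t) * g t) *\<^sub>R B0) \<le> 4 * L\<^sup>2 * h\<^sup>2" .
    qed (use h in auto)
    then show ?thesis by simp
  qed
  then show "norm (y (t + h) - y t - (h * P t) *\<^sub>R B0) \<le> 4 * L\<^sup>2 * h^3"
    by (simp add: P_def g_def power2_eq_square power3_eq_cube algebra_simps)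
  \<comment> \<open>The claim on \<open>P\<close> is the error of the trapezoidal rule for p' = g.
    The derivative of that error in the upper limit r is the defect p' - g plus, up to sign, half
    the Taylor remainder of g expanded about r and evaluated at t.\<close>
  have "norm ((p (t + h) - p t - (t + h - t) / 2 * (g t + g (t + h))) - (p t - p t - (t - t) / 2 * (g t + g t)))
      \<le> 7 * L^3 * h\<^sup>2 * ((t + h) - t)"
  proof (rule mvt_bound)
    fix r assume r: "r \<in> {t..t + h}"
    then have rT: "r \<in> {0..T}" using sub[of r] by auto
    show "((\<lambda>s. p s - p t - (s - t) / 2 * (g t + g s)) has_vector_derivative
        ((p' r - g r) + 1 / 2 * (g r - g t - (r - t) * g' r))) (at r within {t..t + h})"
    proof -
      have "(p has_real_derivative p' r) (at r within {t..t + h})"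
        "(g has_real_derivative g' r) (at r within {t..t + h})"
        unfolding has_real_derivative_iff_has_vector_derivative
        by (auto intro: within dp[OF rT] dg[OF rT])
      then show ?thesis
        unfolding has_real_derivative_iff_has_vector_derivative[symmetric]
        by (auto intro!: derivative_eq_intros simp: field_simps)
    qed
    have "norm ((g r - g t - (r - t) * g' r) - (g t - g t - (t - t) * g' r)) \<le> 8 * L^3 * h * (r - t)"
    proof (rule mvt_bound)
      fix a assume a: "a \<in> {t..r}"
      then have aT: "a \<in> {0..T}" using sub[of a] r by auto
      show "((\<lambda>s. g s - g t - (s - t) * g' r) has_vector_derivative (g' a - g' r)) (at a within {t..r})"
        by (rule derivative_eq_intros within[OF dg[OF aT]] | use r in simp)+
      have "\<bar>g' a - g' r\<bar> \<le> 2 * L\<^sup>2 * \<epsilon> + 6 * L^3 * (r - a)"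
        using lg'[of a r] a t rT by auto
      also have "\<dots> \<le> 2 * L^3 * h + 6 * L^3 * h"
        using Lp L eps h2 a r by (intro add_mono mult_mono) auto
      finally show "norm (g' a - g' r) \<le> 8 * L^3 * h" by (simp add: algebra_simps)
    qed (use r in auto)
    also have "\<dots> \<le> 8 * L^3 * h * h"
      using r L h by (intro mult_left_mono) auto
    finally have "\<bar>g r - g t - (r - t) * g' r\<bar> \<le> 8 * L^3 * h\<^sup>2"
      by (simp add: power2_eq_square)
    moreover have "\<bar>p' r - g r\<bar> \<le> L^3 * h\<^sup>2"
      using p'[OF rT] eps1 mult_right_mono[OF Lp(3), of "h\<^sup>2"] by (simp add: g_def)
    moreover have "0 \<le> L^3 * h\<^sup>2" using L by simp
    moreover have "\<bar>a + 1 / 2 * c\<bar> \<le> 7 * m" if "\<bar>c\<bar> \<le> 8 * m" "\<bar>a\<bar> \<le> m" "0 \<le> m" for a c m :: real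
      using that by (simp add: abs_le_iff)
    ultimately show "norm ((p' r - g r) + 1 / 2 * (g r - g t - (r - t) * g' r)) \<le> 7 * L^3 * h\<^sup>2"
      unfolding real_norm_def by (simp only: mult.assoc)
  qed (use h in auto)
  moreover have "P (t + h) - P t - h * (B0 \<bullet> e (y (t + h))) = p (t + h) - p t - h / 2 * (g t + g (t + h))"
    by (simp add: P_def g_def algebra_simps)
  ultimately show "\<bar>P (t + h) - P t - h * (B0 \<bullet> e (y (t + h)))\<bar> \<le> 7 * L^3 * h^3"
    by (simp add: power2_eq_square power3_eq_cube algebra_simps)
qed

section \<open>Uniform bounds for smooth families of fields\<close>

text \<open>Quantitative C^{1,1} bounds on a ball, with one constant for the value, the derivative
  and the Lipschitz constant of the derivative: this is the form in which the error analysis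
  consumes the smoothness of \<open>b\<close> and \<open>e\<close>.\<close>

definition field_bounds ::
  "(real^3 \<Rightarrow> real^3) \<Rightarrow> (real^3 \<Rightarrow> real^3 \<Rightarrow> real^3) \<Rightarrow> real \<Rightarrow> real \<Rightarrow> bool" where
  "field_bounds F F' r M \<longleftrightarrow>
     (\<forall>x. (F has_derivative F' x) (at x)) \<and>
     (\<forall>x\<in>cball 0 r. norm (F x) \<le> M \<and> (\<forall>v. norm (F' x v) \<le> M * norm v) \<and>
        (\<forall>y\<in>cball 0 r. \<forall>v. norm (F' x v - F' y v) \<le> M * norm (x - y) * norm v))"

lemma field_bounds_mono:
  assumes "field_bounds F F' r M" "M \<le> M'"
  shows "field_bounds F F' r M'"
proof -
  have "M * c \<le> M' * c" "M * c * d \<le> M' * c * d" if "0 \<le> c" "0 \<le> d" for c d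
    using assms(2) that by (auto intro!: mult_right_mono)
  then show ?thesis
    using assms unfolding field_bounds_def by (meson norm_ge_zero order_trans)
qed

lemma derivative_bound_lipschitz:
  fixes F :: "'a::real_normed_vector \<Rightarrow> 'b::real_normed_vector"
  assumes "\<And>x. (F has_derivative F' x) (at x)"
    and "\<And>x v. x \<in> cball 0 r \<Longrightarrow> norm (F' x v) \<le> M * norm v"
    and "M \<ge> 0" and "x \<in> cball 0 r" "y \<in> cball 0 r"
  shows "norm (F x - F y) \<le> M * norm (x - y)"
proof (rule differentiable_bound[OF convex_cball _ _ assms(4,5)])
  show "(F has_derivative F' x) (at x within cball 0 r)" for x
    using assms(1) by (rule has_derivative_at_withinI)
  fix z :: 'a assume z: "z \<in> cball 0 r"
  show "onorm (F' z) \<le> M" using assms(3) assms(2)[OF z] by (rule onorm_bound)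
qed

lemma field_bounds_lipschitz:
  assumes "field_bounds F F' r M" and "x \<in> cball 0 r" "y \<in> cball 0 r"
  shows "norm (F x - F y) \<le> M * norm (x - y)"
proof (rule derivative_bound_lipschitz[of F F' r M])
  have "norm (F x) \<le> M" using assms by (auto simp: field_bounds_def)
  then show "0 \<le> M" using norm_ge_zero order_trans by blast
qed (use assms in \<open>auto simp: field_bounds_def\<close>)

lemma field_bounds_taylor:
  assumes fb: "field_bounds F F' r M" and M: "M \<ge> 0" and x: "x \<in> cball 0 r" and xk: "x + k \<in> cball 0 r"
  shows "norm (F (x + k) - F x - F' x k) \<le> M * (norm k)\<^sup>2"
proof -
  have seg: "closed_segment x (x + k) \<subseteq> cball 0 r"
    using x xk by (intro closed_segment_subset) auto
  have "norm (F (x + k) - F x - F' x (x + k - x)) \<le> norm (x + k - x) * (M * norm k)"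
  proof (rule differentiable_bound_linearization[where S = "closed_segment x (x + k)"
        and f = F and f' = F' and a = x and b = "x + k" and ?x0.0 = x])
    fix z assume z: "z \<in> closed_segment x (x + k)"
    show "(F has_derivative F' z) (at z within closed_segment x (x + k))"
      using fb by (auto simp: field_bounds_def intro: has_derivative_at_withinI)
    have zx: "norm (z - x) \<le> norm k"
      using segment_bound(1)[OF z] by simp
    show "onorm (F' z - F' x) \<le> M * norm k"
    proof (rule onorm_bound)
      show "0 \<le> M * norm k" using M by simp
      fix v
      have "norm (F' z v - F' x v) \<le> M * norm (z - x) * norm v"
        using fb z x seg unfolding field_bounds_def by blast
      also have "\<dots> \<le> M * norm k * norm v"
        using zx M by (intro mult_right_mono mult_left_mono) auto
      finally show "norm ((F' z - F' x) v) \<le> M * norm k * norm v" by simp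
    qed
  next
    show "x + t *\<^sub>R (x + k - x) \<in> closed_segment x (x + k)" if "t \<in> {0..1}" for t
      using that by (auto simp: in_segment algebra_simps)
  qed simp
  then show ?thesis by (simp add: power2_eq_square algebra_simps)
qed

lemma partials_append: "partials js (partials ks F) = partials (js @ ks) F"
  by (induction js) simp_all

text \<open>Raises every estimate by one order: Lipschitz bounds for the partial derivatives,
  themselves a smooth family, become a Lipschitz bound for the derivative.\<close>

lemma uniformly_smooth_partial:
  assumes "uniformly_smooth F"
  shows "uniformly_smooth (\<lambda>\<epsilon>. partials ks (F \<epsilon>))"
  using assms unfolding uniformly_smooth_def smooth_field_def partials_append by blast

lemma frechet_derivative_partials:
  assumes "F differentiable (at x)"
  shows "frechet_derivative F (at x) v = (\<Sum>j\<in>UNIV. v $ j *\<^sub>R partials [j] F x)"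
proof -
  have lin: "linear (frechet_derivative F (at x))"
    using assms by (rule linear_frechet_derivative)
  have "v = (\<Sum>j\<in>UNIV. v $ j *\<^sub>R axis j 1)"
    using basis_expansion[of v] by (simp add: scalar_mult_eq_scaleR)
  then have "frechet_derivative F (at x) v = frechet_derivative F (at x) (\<Sum>j\<in>UNIV. v $ j *\<^sub>R axis j 1)"
    by simp
  also have "\<dots> = (\<Sum>j\<in>UNIV. v $ j *\<^sub>R frechet_derivative F (at x) (axis j 1))"
    by (simp add: linear_sum[OF lin] linear_scale[OF lin])
  finally show ?thesis by simp
qed

lemma norm_sum_components:
  fixes v :: "real^3" and w :: "3 \<Rightarrow> 'a::real_normed_vector"
  assumes "\<And>j. norm (w j) \<le> M"
  shows "norm (\<Sum>j\<in>UNIV. v $ j *\<^sub>R w j) \<le> 3 * M * norm v"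
proof -
  have M: "0 \<le> M" using assms[of 1] norm_ge_zero order_trans by blast
  have "norm (\<Sum>j\<in>UNIV. v $ j *\<^sub>R w j) \<le> (\<Sum>j\<in>(UNIV::3 set). norm v * M)"
    by (rule sum_norm_le) (use assms component_le_norm_cart[of v] M in \<open>auto intro!: mult_mono\<close>)
  then show ?thesis by (simp add: algebra_simps)
qed

lemma uniformly_smooth_differentiable:
  assumes "uniformly_smooth F" "\<epsilon> \<in> {0<..<1}"
  shows "F \<epsilon> differentiable (at x)"
proof -
  have "partials [] (F \<epsilon>) differentiable (at x)"
    using assms unfolding uniformly_smooth_def smooth_field_def by blast
  then show ?thesis by simp
qed

lemma uniformly_smooth_bounded_partials:
  assumes "uniformly_smooth F"
  obtains M where "M \<ge> 0"
    "\<And>\<epsilon> x j. \<epsilon> \<in> {0<..<1} \<Longrightarrow> x \<in> cball 0 r \<Longrightarrow> norm (partials (j # ks) (F \<epsilon>) x) \<le> M"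
proof -
  have "\<exists>M. \<forall>\<epsilon>\<in>{0<..<1}. \<forall>x\<in>cball 0 r. norm (partials (j # ks) (F \<epsilon>) x) \<le> M" for j
    using assms unfolding uniformly_smooth_def using bounded_cball by blast
  then obtain M where M: "\<And>j. \<forall>\<epsilon>\<in>{0<..<1}. \<forall>x\<in>cball 0 r. norm (partials (j # ks) (F \<epsilon>) x) \<le> M j"
    by metis
  show ?thesis
  proof (rule that[of "\<Sum>j\<in>UNIV. \<bar>M j\<bar>"])
    show "0 \<le> (\<Sum>j\<in>UNIV. \<bar>M j\<bar>)" by (simp add: sum_nonneg)
    fix \<epsilon> :: real and x :: "real^3" and j assume *: "\<epsilon> \<in> {0<..<1}" "x \<in> cball 0 r"
    have "\<bar>M j\<bar> \<le> (\<Sum>j\<in>UNIV. \<bar>M j\<bar>)" by (rule member_le_sum) auto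
    with M[of j] * show "norm (partials (j # ks) (F \<epsilon>) x) \<le> (\<Sum>j\<in>UNIV. \<bar>M j\<bar>)" by force
  qed
qed

lemma uniformly_smooth_lipschitz:
  assumes F: "uniformly_smooth F"
  obtains M where "M \<ge> 0"
    "\<And>\<epsilon> x v. \<epsilon> \<in> {0<..<1} \<Longrightarrow> x \<in> cball 0 r \<Longrightarrow> norm (frechet_derivative (F \<epsilon>) (at x) v) \<le> M * norm v"
    "\<And>\<epsilon> x y. \<epsilon> \<in> {0<..<1} \<Longrightarrow> x \<in> cball 0 r \<Longrightarrow> y \<in> cball 0 r \<Longrightarrow>
      norm (F \<epsilon> x - F \<epsilon> y) \<le> M * norm (x - y)"
proof -
  obtain M where M: "M \<ge> 0"
    "\<And>\<epsilon> x j. \<epsilon> \<in> {0<..<1} \<Longrightarrow> x \<in> cball 0 r \<Longrightarrow> norm (partials [j] (F \<epsilon>) x) \<le> M"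
    using uniformly_smooth_bounded_partials[OF F, of r "[]"] by metis
  have d: "norm (frechet_derivative (F \<epsilon>) (at x) v) \<le> (3 * M) * norm v"
    if "\<epsilon> \<in> {0<..<1}" "x \<in> cball 0 r" for \<epsilon> x v
    unfolding frechet_derivative_partials[OF uniformly_smooth_differentiable[OF F that(1)]]
    using M(2)[OF that] by (rule norm_sum_components)
  show ?thesis
  proof (rule that[of "3 * M"])
    fix \<epsilon> :: real and x y :: "real^3" assume *: "\<epsilon> \<in> {0<..<1}" "x \<in> cball 0 r" "y \<in> cball 0 r"
    show "norm (F \<epsilon> x - F \<epsilon> y) \<le> 3 * M * norm (x - y)"
      using uniformly_smooth_differentiable[OF F *(1)] d[OF *(1)] * M(1)
      by (intro derivative_bound_lipschitz[where F' = "\<lambda>x. frechet_derivative (F \<epsilon>) (at x)"])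
        (auto simp: frechet_derivative_works[symmetric])
  qed (use M d in auto)
qed

lemma uniformly_smooth_field_bounds:
  assumes F: "uniformly_smooth F"
  obtains M where "M \<ge> 1"
    "\<And>\<epsilon>. \<epsilon> \<in> {0<..<1} \<Longrightarrow> field_bounds (F \<epsilon>) (\<lambda>x. frechet_derivative (F \<epsilon>) (at x)) r M"
proof -
  obtain M0 where M0: "\<And>\<epsilon> x. \<epsilon> \<in> {0<..<1} \<Longrightarrow> x \<in> cball 0 r \<Longrightarrow> norm (F \<epsilon> x) \<le> M0"
  proof -
    have "\<exists>M. \<forall>\<epsilon>\<in>{0<..<1}. \<forall>x\<in>cball 0 r. norm (partials [] (F \<epsilon>) x) \<le> M"
      using F unfolding uniformly_smooth_def using bounded_cball by blast
    then obtain M where "\<forall>\<epsilon>\<in>{0<..<1}. \<forall>x\<in>cball 0 r. norm (partials [] (F \<epsilon>) x) \<le> M" by blast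
    then show ?thesis using that[of M] by simp
  qed
  obtain M1 where M1: "M1 \<ge> 0" "\<And>\<epsilon> x v. \<epsilon> \<in> {0<..<1} \<Longrightarrow> x \<in> cball 0 r \<Longrightarrow>
      norm (frechet_derivative (F \<epsilon>) (at x) v) \<le> M1 * norm v"
    using uniformly_smooth_lipschitz[OF F, of r] by metis
  have "\<exists>M. M \<ge> 0 \<and> (\<forall>\<epsilon>\<in>{0<..<1}. \<forall>x\<in>cball 0 r. \<forall>y\<in>cball 0 r.
      norm (partials [j] (F \<epsilon>) x - partials [j] (F \<epsilon>) y) \<le> M * norm (x - y))" for j
    using uniformly_smooth_lipschitz[OF uniformly_smooth_partial[OF F, of "[j]"], of r] by metis
  then obtain L where L: "\<And>j. L j \<ge> 0" "\<And>j \<epsilon> x y. \<epsilon> \<in> {0<..<1} \<Longrightarrow> x \<in> cball 0 r \<Longrightarrow> y \<in> cball 0 r \<Longrightarrow>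
      norm (partials [j] (F \<epsilon>) x - partials [j] (F \<epsilon>) y) \<le> L j * norm (x - y)"
    by metis
  define M2 where "M2 = (\<Sum>j\<in>UNIV. L j)"
  have M2: "0 \<le> M2" "L j \<le> M2" for j
    unfolding M2_def by (auto intro!: sum_nonneg member_le_sum L)
  show ?thesis
  proof (rule that[of "1 + \<bar>M0\<bar> + M1 + 3 * M2"])
    show "1 \<le> 1 + \<bar>M0\<bar> + M1 + 3 * M2" using M1 M2 by simp
    fix \<epsilon> :: real assume e: "\<epsilon> \<in> {0<..<1}"
    note diff = uniformly_smooth_differentiable[OF F e]
    have "norm (frechet_derivative (F \<epsilon>) (at x) v - frechet_derivative (F \<epsilon>) (at y) v)
        \<le> 3 * M2 * norm (x - y) * norm v" if "x \<in> cball 0 r" "y \<in> cball 0 r" for x y v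
    proof -
      have "frechet_derivative (F \<epsilon>) (at x) v - frechet_derivative (F \<epsilon>) (at y) v
          = (\<Sum>j\<in>UNIV. v $ j *\<^sub>R (partials [j] (F \<epsilon>) x - partials [j] (F \<epsilon>) y))"
        unfolding frechet_derivative_partials[OF diff]
        by (simp add: sum_subtractf scaleR_right_diff_distrib)
      also have "norm \<dots> \<le> 3 * (M2 * norm (x - y)) * norm v"
        using L(2)[OF e that] M2(2) by (intro norm_sum_components) (meson mult_right_mono norm_ge_zero order_trans)
      finally show ?thesis by (simp add: mult.assoc)
    qed
    note lip = this
    show "field_bounds (F \<epsilon>) (\<lambda>x. frechet_derivative (F \<epsilon>) (at x)) r (1 + \<bar>M0\<bar> + M1 + 3 * M2)"
      unfolding field_bounds_def
    proof (intro conjI allI ballI)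
      fix x show "(F \<epsilon> has_derivative frechet_derivative (F \<epsilon>) (at x)) (at x)"
        using diff frechet_derivative_works by blast
    next
      fix x :: "real^3" assume x: "x \<in> cball 0 r"
      show "norm (F \<epsilon> x) \<le> 1 + \<bar>M0\<bar> + M1 + 3 * M2" using M0[OF e x] M1 M2 by linarith
      show "norm (frechet_derivative (F \<epsilon>) (at x) v) \<le> (1 + \<bar>M0\<bar> + M1 + 3 * M2) * norm v" for v
        using M1(2)[OF e x, of v] M2(1)
          mult_right_mono[of M1 "1 + \<bar>M0\<bar> + M1 + 3 * M2" "norm v"] by simp
      fix y :: "real^3" assume y: "y \<in> cball 0 r"
      fix v
      show "norm (frechet_derivative (F \<epsilon>) (at x) v - frechet_derivative (F \<epsilon>) (at y) v)
          \<le> (1 + \<bar>M0\<bar> + M1 + 3 * M2) * norm (x - y) * norm v"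
        using lip[OF x y, of v] M1(1) mult_right_mono[of "3 * M2" "1 + \<bar>M0\<bar> + M1 + 3 * M2" "norm (x - y) * norm v"]
        by (simp add: mult.assoc)
    qed
  qed
qed

text \<open>The chord \<open>x - m + d, x + m + d\<close> joins \<open>x (n - 1)\<close> to \<open>x (n + 1)\<close>, with \<open>m\<close> half the central
  difference and \<open>d\<close> half the second difference.\<close>

lemma uniformly_smooth_central_difference:
  assumes A: "uniformly_smooth A"
  obtains M where "M \<ge> 0"
    "\<And>\<epsilon> x m d. \<epsilon> \<in> {0<..<1} \<Longrightarrow> norm x + norm m + norm d \<le> r \<Longrightarrow>
      norm (A \<epsilon> (x + m + d) - A \<epsilon> (x - m + d) - 2 *\<^sub>R frechet_derivative (A \<epsilon>) (at x) m)
        \<le> M * ((norm m)^3 + norm m * norm d)"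
proof -
  obtain M1 where M1: "M1 \<ge> 1" "\<And>\<epsilon>. \<epsilon> \<in> {0<..<1} \<Longrightarrow>
      field_bounds (A \<epsilon>) (\<lambda>x. frechet_derivative (A \<epsilon>) (at x)) r M1"
    using uniformly_smooth_field_bounds[OF A] by blast
  have "\<exists>M\<ge>1. \<forall>\<epsilon>\<in>{0<..<1}. field_bounds (partials [j] (A \<epsilon>))
      (\<lambda>x. frechet_derivative (partials [j] (A \<epsilon>)) (at x)) r M" for j
    using uniformly_smooth_field_bounds[OF uniformly_smooth_partial[OF A, of "[j]"], of r] by metis
  then obtain L where L: "\<And>j. L j \<ge> 1" "\<And>j \<epsilon>. \<epsilon> \<in> {0<..<1} \<Longrightarrow> field_bounds (partials [j] (A \<epsilon>))
      (\<lambda>x. frechet_derivative (partials [j] (A \<epsilon>)) (at x)) r (L j)"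
    by metis
  define M2 where "M2 = (\<Sum>j\<in>UNIV. L j)"
  have Lp: "0 \<le> L j" for j using L(1)[of j] by linarith
  have M2: "0 \<le> M2" "L j \<le> M2" for j
    unfolding M2_def by (auto intro!: sum_nonneg member_le_sum Lp)
  show ?thesis
  proof (rule that[of "6 * M2 + 2 * M1"])
    show "0 \<le> 6 * M2 + 2 * M1" using M1 M2 by simp
    fix \<epsilon> :: real and x m d :: "real^3"
    assume e: "\<epsilon> \<in> {0<..<1}" and r: "norm x + norm m + norm d \<le> r"
    \<comment> \<open>The midpoint of the chord. About it the difference is odd in \<open>m\<close>,
      so its expansion has no quadratic term and the error is cubic; moving the derivative from
      \<open>z\<close> back to \<open>x\<close> costs \<open>norm m * norm d\<close>.\<close>
    define z where "z = x + d"
    define A' where "A' x = frechet_derivative (A \<epsilon>) (at x)" for x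
    have dA: "(A \<epsilon> has_derivative A' x) (at x)" for x
      using M1(2)[OF e] unfolding field_bounds_def A'_def by blast
    have lin: "linear (A' x)" for x using dA by (rule has_derivative_linear)
    have in_ball: "z + s *\<^sub>R m \<in> cball 0 r" if "\<bar>s\<bar> \<le> 1" for s
    proof -
      have "\<bar>s\<bar> * norm m \<le> norm m" using that by (simp add: mult_left_le_one_le)
      then show ?thesis
        using norm_triangle_ineq[of z "s *\<^sub>R m"] norm_triangle_ineq[of x d] r
        by (simp add: z_def)
    qed
    have xr: "x \<in> cball 0 r" "z \<in> cball 0 r"
      using order_trans[OF _ r, of "norm x"] in_ball[of 0] by auto
    \<comment> \<open>The derivative in s of the odd expression along the chord. It is a symmetric
      second difference of the partial derivatives, so their first-order Taylor terms
      cancel.\<close>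
    have second: "norm (A' (z + s *\<^sub>R m) m + A' (z - s *\<^sub>R m) m - 2 *\<^sub>R A' z m) \<le> 6 * M2 * (norm m)^3"
      if s: "s \<in> {0..1}" for s
    proof -
      have G: "norm (partials [j] (A \<epsilon>) (z + s *\<^sub>R m) + partials [j] (A \<epsilon>) (z - s *\<^sub>R m)
          - 2 *\<^sub>R partials [j] (A \<epsilon>) z) \<le> 2 * M2 * (norm m)\<^sup>2" for j
      proof -
        let ?G = "partials [j] (A \<epsilon>)" and ?G' = "frechet_derivative (partials [j] (A \<epsilon>)) (at z)"
        have linG: "linear ?G'"
          using L(2)[OF e, of j] has_derivative_linear unfolding field_bounds_def by blast
        have T: "norm (?G (z + c *\<^sub>R m) - ?G z - ?G' (c *\<^sub>R m)) \<le> M2 * (norm m)\<^sup>2" if "\<bar>c\<bar> \<le> 1" for c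
        proof -
          have "norm (?G (z + c *\<^sub>R m) - ?G z - ?G' (c *\<^sub>R m)) \<le> L j * (norm (c *\<^sub>R m))\<^sup>2"
            using L(2)[OF e] Lp xr(2) in_ball[OF that] by (rule field_bounds_taylor)
          also have "\<dots> \<le> M2 * (norm m)\<^sup>2"
            using M2 that by (intro mult_mono power_mono) (auto simp: mult_left_le_one_le)
          finally show ?thesis .
        qed
        have "?G (z + s *\<^sub>R m) + ?G (z - s *\<^sub>R m) - 2 *\<^sub>R ?G z
            = (?G (z + s *\<^sub>R m) - ?G z - ?G' (s *\<^sub>R m)) + (?G (z + (-s) *\<^sub>R m) - ?G z - ?G' ((-s) *\<^sub>R m))"
          by (simp add: linear_scale[OF linG] linear_neg[OF linG] scaleR_2 del: partials.simps)
        also have "norm \<dots> \<le> M2 * (norm m)\<^sup>2 + M2 * (norm m)\<^sup>2"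
          using s by (intro norm_triangle_le add_mono T) auto
        finally show ?thesis by simp
      qed
      have "A' (z + s *\<^sub>R m) m + A' (z - s *\<^sub>R m) m - 2 *\<^sub>R A' z m
          = (\<Sum>j\<in>UNIV. m $ j *\<^sub>R (partials [j] (A \<epsilon>) (z + s *\<^sub>R m) + partials [j] (A \<epsilon>) (z - s *\<^sub>R m)
             - 2 *\<^sub>R partials [j] (A \<epsilon>) z))"
        unfolding A'_def frechet_derivative_partials[OF uniformly_smooth_differentiable[OF A e]]
        by (simp add: sum_subtractf sum.distrib scaleR_right_diff_distrib scaleR_right_distrib
            scaleR_sum_right mult.commute)
      also have "norm \<dots> \<le> 3 * (2 * M2 * (norm m)\<^sup>2) * norm m"
        using G by (rule norm_sum_components)
      finally show ?thesis by (simp add: power2_eq_square power3_eq_cube mult.assoc)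
    qed
    have "norm ((A \<epsilon> (z + 1 *\<^sub>R m) - A \<epsilon> (z - 1 *\<^sub>R m) - 1 *\<^sub>R (2 *\<^sub>R A' z m))
        - (A \<epsilon> (z + 0 *\<^sub>R m) - A \<epsilon> (z - 0 *\<^sub>R m) - 0 *\<^sub>R (2 *\<^sub>R A' z m))) \<le> 6 * M2 * (norm m)^3 * (1 - 0)"
    proof (rule mvt_bound)
      fix s :: real assume s: "s \<in> {0..1}"
      have line: "((\<lambda>s. A \<epsilon> (z + (c * s) *\<^sub>R m)) has_vector_derivative c *\<^sub>R A' (z + (c * s) *\<^sub>R m) m)
          (at s within {0..1})" for c
      proof -
        have "((\<lambda>s. z + (c * s) *\<^sub>R m) has_derivative (\<lambda>t. t *\<^sub>R (c *\<^sub>R m))) (at s within {0..1})"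
          by (auto intro!: derivative_eq_intros simp: mult.commute)
        from has_derivative_compose[OF this dA]
        show ?thesis by (simp add: has_vector_derivative_def linear_scale[OF lin])
      qed
      have "((\<lambda>s. A \<epsilon> (z + (1 * s) *\<^sub>R m) - A \<epsilon> (z + (-1 * s) *\<^sub>R m) - s *\<^sub>R (2 *\<^sub>R A' z m)) has_vector_derivative
          1 *\<^sub>R A' (z + (1 * s) *\<^sub>R m) m - (-1) *\<^sub>R A' (z + (-1 * s) *\<^sub>R m) m - 1 *\<^sub>R (2 *\<^sub>R A' z m)) (at s within {0..1})"
        by (intro has_vector_derivative_diff line
            bounded_linear.has_vector_derivative[OF bounded_linear_scaleR_left] has_vector_derivative_id)
      then show "((\<lambda>s. A \<epsilon> (z + s *\<^sub>R m) - A \<epsilon> (z - s *\<^sub>R m) - s *\<^sub>R (2 *\<^sub>R A' z m)) has_vector_derivative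
          (A' (z + s *\<^sub>R m) m + A' (z - s *\<^sub>R m) m - 2 *\<^sub>R A' z m)) (at s within {0..1})"
        by simp
    qed (use second in auto)
    then have 1: "norm (A \<epsilon> (z + m) - A \<epsilon> (z - m) - 2 *\<^sub>R A' z m) \<le> 6 * M2 * (norm m)^3" by simp
    have 2: "norm (A' z m - A' x m) \<le> M1 * norm d * norm m"
    proof -
      have "norm (A' z m - A' x m) \<le> M1 * norm (z - x) * norm m"
        using M1(2)[OF e] xr unfolding field_bounds_def A'_def by blast
      then show ?thesis by (simp add: z_def)
    qed
    have "A \<epsilon> (x + m + d) - A \<epsilon> (x - m + d) - 2 *\<^sub>R A' x m
        = (A \<epsilon> (z + m) - A \<epsilon> (z - m) - 2 *\<^sub>R A' z m) + 2 *\<^sub>R (A' z m - A' x m)"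
      by (simp add: z_def algebra_simps)
    also have "norm \<dots> \<le> 6 * M2 * (norm m)^3 + 2 * (M1 * norm d * norm m)"
      using 1 2 by (intro norm_triangle_le) simp
    also have "\<dots> \<le> (6 * M2 + 2 * M1) * ((norm m)^3 + norm m * norm d)"
      using M1(1) M2(1) by (simp add: algebra_simps)
    finally show "norm (A \<epsilon> (x + m + d) - A \<epsilon> (x - m + d) - 2 *\<^sub>R frechet_derivative (A \<epsilon>) (at x) m)
        \<le> (6 * M2 + 2 * M1) * ((norm m)^3 + norm m * norm d)"
      by (simp add: A'_def)
  qed
qed

section \<open>Reduction of the methods to the two-step form\<close>

lemma par_proj_mult: "par_proj B0 *v a = (B0 \<bullet> a) *\<^sub>R B0"
  by (simp add: vec_eq_iff par_proj_def matrix_vector_mult_def inner_vec_def sum_3 forall_3 algebra_simps)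

lemma hat_mult: "hat B0 *v a = - (a \<times> B0)"
proof -
  have "linear (\<lambda>v. - (v \<times> B0))"
    by (intro linearI) (simp_all add: cross_add_left cross_mult_left)
  then show ?thesis unfolding hat_def by (simp add: matrix_works)
qed

lemma filter_mult:
  assumes unit: "norm B0 = 1"
  shows "(mat 1 + (1 - k) *\<^sub>R (hat B0 ** hat B0)) *v a = (B0 \<bullet> a) *\<^sub>R B0 + k *\<^sub>R perp B0 a"
proof -
  have "(hat B0 ** hat B0) *v a = - perp B0 a"
    by (simp add: matrix_vector_mul_assoc[symmetric] hat_mult cross_cross_unit[OF unit])
  then have "(mat 1 + (1 - k) *\<^sub>R (hat B0 ** hat B0)) *v a = a + (1 - k) *\<^sub>R (- perp B0 a)"
    by (simp add: matrix_vector_mult_add_rdistrib scaleR_matrix_vector_assoc[symmetric])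
  then show ?thesis using decomp[of a B0] by (simp add: perp_def algebra_simps)
qed

text \<open>The transposed Jacobian differs from the Jacobian by a skew matrix whose axial vector is
  the curl; this is how the variational methods contain the magnetic force.\<close>

lemma transpose_jacobian_mult:
  assumes "F differentiable (at x)"
  shows "transpose (jacobian F (at x)) *v v = frechet_derivative F (at x) v + v \<times> curl F x"
proof -
  have "jacobian F (at x) *v v = frechet_derivative F (at x) v"
    using assms by (simp add: jacobian_def matrix_works linear_frechet_derivative)
  moreover have "transpose J *v v = J *v v
      + v \<times> vector [J $ 3 $ 2 - J $ 2 $ 3, J $ 1 $ 3 - J $ 3 $ 1, J $ 2 $ 1 - J $ 1 $ 2]" for J :: "real^3^3"
    by (simp add: vec_eq_iff forall_3 matrix_vector_mult_def sum_3 transpose_def cross_components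
        vector_3 algebra_simps)
  ultimately show ?thesis by (simp add: curl_def Let_def)
qed

text \<open>The linear part of the potential is differenced exactly: the transposed Jacobian and the
  central difference each contribute half of the force of size 1 / \<epsilon> and leave no
  remainder. The remainder therefore comes from \<open>A1\<close> alone and carries no factor 1 /
  \<epsilon>.\<close>

lemma discrete_lorentz_force_eq:
  assumes A: "\<And>x. A1 differentiable (at x)"
  shows "discrete_lorentz_force (vector_potential B0 A1 \<epsilon>) E h x n
    = (1 / \<epsilon>) *\<^sub>R (central_diff h x n \<times> B0) + central_diff h x n \<times> curl A1 (x n) + E (x n)
      + (frechet_derivative A1 (at (x n)) (central_diff h x n) - (A1 (x (n + 1)) - A1 (x (n - 1))) /\<^sub>R (2 * h))"
proof -
  let ?l = "\<lambda>x. - (1 / (2 * \<epsilon>)) *\<^sub>R (x \<times> B0)" and ?v = "central_diff h x n"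
  have lin: "linear ?l"
    by (intro linearI) (simp_all add: cross_add_left cross_mult_left algebra_simps)
  have "(vector_potential B0 A1 \<epsilon> has_derivative (\<lambda>v. ?l v + frechet_derivative A1 (at (x n)) v)) (at (x n))"
    unfolding vector_potential_def[abs_def]
    by (intro has_derivative_add linear_imp_has_derivative lin) (use A frechet_derivative_works in blast)
  then have fd: "frechet_derivative (vector_potential B0 A1 \<epsilon>) (at (x n))
      = (\<lambda>v. ?l v + frechet_derivative A1 (at (x n)) v)"
    and diff: "vector_potential B0 A1 \<epsilon> differentiable (at (x n))"
    by (auto simp: frechet_derivative_at[symmetric] differentiable_def)
  have jac: "jacobian (vector_potential B0 A1 \<epsilon>) (at (x n)) = matrix ?l + jacobian A1 (at (x n))"
    unfolding jacobian_def fd by (simp add: matrix_def vec_eq_iff)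
  have "transpose (matrix ?l) *v v = (1 / (2 * \<epsilon>)) *\<^sub>R (v \<times> B0)" for v
    by (simp add: vec_eq_iff forall_3 matrix_vector_mult_def sum_3 transpose_def matrix_def
        cross_components axis_def algebra_simps diff_divide_distrib)
  then have "transpose (jacobian (vector_potential B0 A1 \<epsilon>) (at (x n))) *v ?v
      = (1 / (2 * \<epsilon>)) *\<^sub>R (?v \<times> B0) + (frechet_derivative A1 (at (x n)) ?v + ?v \<times> curl A1 (x n))"
    unfolding jac using transpose_jacobian_mult[OF A, of "x n" ?v]
    by (simp add: transpose_def vec_eq_iff matrix_vector_mult_def sum.distrib algebra_simps)
  moreover have "(vector_potential B0 A1 \<epsilon> (x (n + 1)) - vector_potential B0 A1 \<epsilon> (x (n - 1))) /\<^sub>R (2 * h)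
      = - ((1 / (2 * \<epsilon>)) *\<^sub>R (?v \<times> B0)) + (A1 (x (n + 1)) - A1 (x (n - 1))) /\<^sub>R (2 * h)"
    by (simp add: vector_potential_def central_diff_def cross_mult_left Cross3.left_diff_distrib algebra_simps)
  moreover have "(1 / (2 * \<epsilon>)) *\<^sub>R w + (1 / (2 * \<epsilon>)) *\<^sub>R w = (1 / \<epsilon>) *\<^sub>R w" for w :: "real^3"
    by (simp add: scaleR_left_distrib[symmetric])
  moreover have "t - s + e = b + c + e + (d - w)"
    if "t = a + (d + c)" "s = - a + w" "a + a = b" for a b c d e s t w :: "real^3"
    using that by (auto simp: algebra_simps)
  ultimately show ?thesis unfolding discrete_lorentz_force_def by metis
qed

lemma norm_divideR: "c > 0 \<Longrightarrow> norm (a /\<^sub>R c) = norm a / c"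
  unfolding norm_scaleR by (simp add: field_simps)

text \<open>Index 0 reaches back to the auxiliary point \<open>x (-1)\<close>, while the relation at
  n uses \<open>increment x (Suc n)\<close>, hence the point after time n h.\<close>

definition increment :: "(int \<Rightarrow> real^3) \<Rightarrow> nat \<Rightarrow> real^3" where
  "increment x k = x (int k) - x (int k - 1)"

lemma second_diff_increment: "second_diff h x (int n) = (increment x (Suc n) - increment x n) /\<^sub>R h\<^sup>2"
  by (simp add: second_diff_def increment_def algebra_simps scaleR_2)

lemma central_diff_increment: "central_diff h x (int n) = (increment x (Suc n) + increment x n) /\<^sub>R (2 * h)"
  by (simp add: central_diff_def increment_def algebra_simps)

text \<open>All three methods have this form, with \<open>k = 1\<close> for the first two and \<open>k = tanc (h / (2 \<epsilon>))\<close>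
  for the filtered one, so that \<open>\<tau> = k h / (2 \<epsilon>)\<close>.\<close>

lemma filtered_step:
  fixes \<omega>0 \<omega>1 f :: "real^3"
  assumes unit: "norm B0 = 1" and h: "h > 0" and eps: "\<epsilon> > 0"
    and z: "z = (1 / \<epsilon>) *\<^sub>R (((\<omega>1 + \<omega>0) /\<^sub>R (2 * h)) \<times> B0) + f"
    and step: "(\<omega>1 - \<omega>0) /\<^sub>R h\<^sup>2 = (B0 \<bullet> z) *\<^sub>R B0 + k *\<^sub>R perp B0 z"
  shows "B0 \<bullet> (\<omega>1 - \<omega>0) = h\<^sup>2 * (B0 \<bullet> f)"
    and "perp B0 (\<omega>1 - \<omega>0) = (k * (h / (2 * \<epsilon>))) *\<^sub>R ((\<omega>1 + \<omega>0) \<times> B0 + (2 * h * \<epsilon>) *\<^sub>R perp B0 f)"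
proof -
  have *: "\<omega>1 - \<omega>0 = h\<^sup>2 *\<^sub>R ((B0 \<bullet> z) *\<^sub>R B0 + k *\<^sub>R perp B0 z)"
    using h by (simp add: step[symmetric])
  have "B0 \<bullet> z = B0 \<bullet> f"
    by (simp add: z inner_add_right dot_cross_self)
  then show "B0 \<bullet> (\<omega>1 - \<omega>0) = h\<^sup>2 * (B0 \<bullet> f)"
    unfolding * by (simp add: inner_add_right inner_unit[OF unit] inner_perp[OF unit])
  have "perp B0 (perp B0 a) = perp B0 a" for a
    by (simp add: perp_def[of B0 "perp B0 a"] inner_perp[OF unit])
  then have "perp B0 (\<omega>1 - \<omega>0) = (h\<^sup>2 * k) *\<^sub>R perp B0 z"
    unfolding * by (simp add: perp_add perp_scaleR perp_self[OF unit])
  also have "perp B0 z = (1 / (\<epsilon> * (2 * h))) *\<^sub>R ((\<omega>1 + \<omega>0) \<times> B0) + perp B0 f"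
    by (simp add: z perp_add perp_scaleR cross_mult_left perp_of_cross[OF unit] divide_simps)
  also have "(h\<^sup>2 * k) *\<^sub>R \<dots> = (k * (h / (2 * \<epsilon>))) *\<^sub>R ((\<omega>1 + \<omega>0) \<times> B0 + (2 * h * \<epsilon>) *\<^sub>R perp B0 f)"
    using h eps by (simp add: scaleR_right_distrib power2_eq_square mult_ac)
  finally show "perp B0 (\<omega>1 - \<omega>0)
      = (k * (h / (2 * \<epsilon>))) *\<^sub>R ((\<omega>1 + \<omega>0) \<times> B0 + (2 * h * \<epsilon>) *\<^sub>R perp B0 f)" .
qed

text \<open>The refined bound on the remainder is conditional, because the Taylor estimate behind it
  needs the chord from x (n - 1) to x (n + 1) in a fixed ball, known only once the increments are
  short. The unconditional growth bound inside \<open>two_step\<close> is enough to prove that. The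
  velocity filter acts on perpendicular parts, so in all three methods the parallel part of
  \<open>v\<close> is that of the central difference.\<close>

definition two_step_method ::
  "real^3 \<Rightarrow> (real^3 \<Rightarrow> real^3) \<Rightarrow> (real^3 \<Rightarrow> real^3) \<Rightarrow> real \<Rightarrow> real \<Rightarrow> real \<Rightarrow> nat \<Rightarrow>
   (int \<Rightarrow> real^3) \<Rightarrow> (int \<Rightarrow> real^3) \<Rightarrow> bool" where
  "two_step_method B0 b e M h \<epsilon> N x v \<longleftrightarrow>
     (\<exists>\<tau> f. two_step B0 M h \<epsilon> \<tau> N (increment x) f \<and>
       (\<forall>n\<le>N. let s = increment x (Suc n) + increment x n; d = increment x (Suc n) - increment x n in
          B0 \<bullet> v (int n) = (B0 \<bullet> s) / (2 * h) \<and>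
          (norm (increment x n) \<le> 1 \<and> norm (increment x (Suc n)) \<le> 1 \<longrightarrow>
            norm (f n - ((s /\<^sub>R (2 * h)) \<times> b (x (int n)) + e (x (int n))))
              \<le> M * ((norm s)^3 + norm s * norm d) / h)))"

text \<open>The bounds on \<open>k\<close> are those on \<tau> = k h / (2 \<epsilon>) rewritten
  without \<tau>. Of the two bounds on the remainder \<open>r\<close>, the linear one feeds the
  growth condition on the force and the one of higher order is passed on.\<close>

lemma two_step_methodI:
  fixes B0 :: "real^3" and h :: real and x v :: "int \<Rightarrow> real^3" and r :: "nat \<Rightarrow> real^3"
  defines "cd \<equiv> (\<lambda>n. central_diff h x (int n))"
  assumes unit: "norm B0 = 1" and eps: "0 < \<epsilon>" "\<epsilon> \<le> h\<^sup>2" and h: "0 < h" "h \<le> 1" "6 * M * h \<le> 1"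
    and N: "real N * h \<le> M"
    and step: "\<And>n. n \<le> N \<Longrightarrow> second_diff h x (int n) = (B0 \<bullet> z n) *\<^sub>R B0 + k *\<^sub>R perp B0 (z n)"
    and z: "\<And>n. n \<le> N \<Longrightarrow>
      z n = (1 / \<epsilon>) *\<^sub>R (cd n \<times> B0) + (cd n \<times> b (x (int n)) + e (x (int n)) + r n)"
    and v: "\<And>n. n \<le> N \<Longrightarrow> B0 \<bullet> v (int n) = B0 \<bullet> cd n"
    and b: "\<And>n. n \<le> N \<Longrightarrow> norm (b (x (int n))) \<le> M0"
    and e: "\<And>n. n \<le> N \<Longrightarrow> norm (e (x (int n))) \<le> M0"
    and r1: "\<And>n. n \<le> N \<Longrightarrow> norm (r n) \<le> M0 * norm (increment x (Suc n) + increment x n) / h"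
    and r2: "\<And>n. n \<le> N \<Longrightarrow> norm (increment x n) \<le> 1 \<Longrightarrow> norm (increment x (Suc n)) \<le> 1 \<Longrightarrow>
      norm (r n) \<le> M * ((norm (increment x (Suc n) + increment x n))^3
        + norm (increment x (Suc n) + increment x n) * norm (increment x (Suc n) - increment x n)) / h"
    and k: "k \<noteq> 0" "2 * \<epsilon> \<le> M * (\<bar>k\<bar> * h)" "\<bar>k\<bar> \<le> 2 * M"
    and start: "\<bar>B0 \<bullet> cd 0\<bar> \<le> M0" "h * norm (perp B0 (cd 0)) \<le> D * \<epsilon>" "\<bar>k\<bar> * norm (perp B0 (cd 0)) \<le> D * \<epsilon>"
    and M: "0 \<le> M0" "2 * M0 \<le> M" "0 \<le> D" "2 * D \<le> M"
  shows "two_step_method B0 b e M h \<epsilon> N x v"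
proof -
  define f where "f n = cd n \<times> b (x (int n)) + e (x (int n)) + r n" for n
  define \<tau> where "\<tau> = k * (h / (2 * \<epsilon>))"
  let ?w = "increment x"
  have cd: "cd n = (?w (Suc n) + ?w n) /\<^sub>R (2 * h)" for n
    by (simp add: cd_def central_diff_increment)
  have s0: "?w (Suc 0) + ?w 0 = (2 * h) *\<^sub>R cd 0"
    using h by (simp add: cd)
  have fb: "norm (f n) \<le> M * (norm (?w (Suc n) + ?w n) / h + 1)" if n: "n \<le> N" for n
  proof -
    let ?s = "norm (?w (Suc n) + ?w n) / h"
    have "0 < 2 * h" using h by simp
    then have nc: "norm (cd n) = ?s / 2" unfolding cd norm_divideR[OF \<open>0 < 2 * h\<close>] by simp
    have "norm (f n) \<le> norm (cd n) * norm (b (x (int n))) + norm (e (x (int n))) + norm (r n)"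
      unfolding f_def using norm_cross_le by (intro norm_triangle_le add_mono) auto
    also have "\<dots> \<le> ?s / 2 * M0 + M0 + M0 * ?s"
      using b[OF n] e[OF n] r1[OF n] h by (intro add_mono mult_mono) (auto simp: nc)
    also have "\<dots> \<le> (2 * M0) * (?s + 1)"
    proof -
      have "t / 2 * M0 + M0 + M0 * t \<le> (2 * M0) * (t + 1)" if "0 \<le> t" for t
        using mult_nonneg_nonneg[OF M(1) that] M(1) by (simp add: algebra_simps)
      then show ?thesis by this (use h in simp)
    qed
    also have "\<dots> \<le> M * (?s + 1)"
      using M h by (intro mult_right_mono) auto
    finally show ?thesis .
  qed
  have "two_step B0 M h \<epsilon> \<tau> N ?w f"
    unfolding two_step_def
  proof (intro conjI allI impI)
    show "\<tau> \<noteq> 0" using k h eps by (simp add: \<tau>_def)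
    show "\<bar>1 / \<tau>\<bar> \<le> M" using k h eps by (simp add: \<tau>_def abs_mult field_simps)
    show "\<bar>\<tau>\<bar> * \<epsilon> \<le> M * h" using k h eps by (simp add: \<tau>_def abs_mult field_simps)
    have p: "norm (perp B0 (?w (Suc 0) + ?w 0)) = 2 * (h * norm (perp B0 (cd 0)))"
      unfolding s0 using h by (simp add: perp_scaleR)
    have De: "2 * (D * \<epsilon>) \<le> M * h\<^sup>2"
      using mult_mono[OF M(4) eps(2)] M eps by simp
    show "norm (perp B0 (?w 1 + ?w 0)) \<le> M * h\<^sup>2"
      using p start De by simp
    \<comment> \<open>\<tau> times the sum carries the unbounded factor h^2 / \<epsilon>; the
      \<epsilon> in the hypothesis on the starting velocity compensates it.\<close>
    have "\<bar>\<tau>\<bar> * norm (perp B0 (?w 1 + ?w 0)) = h\<^sup>2 / \<epsilon> * (\<bar>k\<bar> * norm (perp B0 (cd 0)))"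
      using p eps h by (simp add: \<tau>_def abs_mult power2_eq_square)
    also have "\<dots> \<le> h\<^sup>2 / \<epsilon> * (D * \<epsilon>)"
      using start eps by (intro mult_left_mono) auto
    also have "\<dots> = D * h\<^sup>2" using eps by simp
    also have "\<dots> \<le> M * h\<^sup>2" using M by (intro mult_right_mono) auto
    finally show "\<bar>\<tau>\<bar> * norm (perp B0 (?w 1 + ?w 0)) \<le> M * h\<^sup>2" .
    have "\<bar>B0 \<bullet> (?w 1 + ?w 0)\<bar> = 2 * h * \<bar>B0 \<bullet> cd 0\<bar>"
      using s0 h by (simp add: abs_mult)
    also have "\<dots> \<le> 2 * h * M0" using start h by (intro mult_left_mono) auto
    also have "\<dots> \<le> M * h" using M h by simp
    finally show "\<bar>B0 \<bullet> (?w 1 + ?w 0)\<bar> \<le> M * h" .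
  next
    fix n assume n: "n \<le> N"
    have st: "(?w (Suc n) - ?w n) /\<^sub>R h\<^sup>2 = (B0 \<bullet> z n) *\<^sub>R B0 + k *\<^sub>R perp B0 (z n)"
      using step[OF n] by (simp add: second_diff_increment)
    have zn: "z n = (1 / \<epsilon>) *\<^sub>R (((?w (Suc n) + ?w n) /\<^sub>R (2 * h)) \<times> B0) + f n"
      using z[OF n] unfolding cd f_def .
    show "B0 \<bullet> (?w (Suc n) - ?w n) = h\<^sup>2 * (B0 \<bullet> f n)"
      by (rule filtered_step(1)[OF unit h(1) eps(1) zn st])
    show "perp B0 (?w (Suc n) - ?w n) = \<tau> *\<^sub>R ((?w (Suc n) + ?w n) \<times> B0 + (2 * h * \<epsilon>) *\<^sub>R perp B0 (f n))"
      unfolding \<tau>_def by (rule filtered_step(2)[OF unit h(1) eps(1) zn st])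
    show "norm (f n) \<le> M * (norm (?w (Suc n) + ?w n) / h + 1)" by (rule fb[OF n])
  qed (use eps h N in auto)
  moreover have "B0 \<bullet> v (int n) = (B0 \<bullet> (?w (Suc n) + ?w n)) / (2 * h)" if "n \<le> N" for n
    using v[OF that] h unfolding cd inner_scaleR_right by (simp add: field_simps)
  moreover have "f n - (((?w (Suc n) + ?w n) /\<^sub>R (2 * h)) \<times> b (x (int n)) + e (x (int n))) = r n" for n
    by (simp add: f_def cd)
  ultimately show ?thesis
    unfolding two_step_method_def Let_def using r2 by (intro exI[of _ \<tau>] exI[of _ f]) simp
qed

section \<open>Starting values and the Boris method\<close>

lemma slow_start_velocity:
  assumes unit: "norm B0 = 1" and eps: "0 < \<epsilon>" and s: "slow_start B0 \<epsilon> c1 q0 u0 x0 v0"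
  shows "B0 \<bullet> v0 = B0 \<bullet> u0" and "norm (perp B0 v0) \<le> \<bar>c1\<bar> * \<epsilon>"
    and "norm (x0 - q0) \<le> norm u0 * \<epsilon>"
proof -
  obtain w where w: "v0 = par_proj B0 *v u0 + w" "par_proj B0 *v w = 0" "norm w \<le> c1 * \<epsilon>"
    using s by (auto simp: slow_start_def)
  have "B0 \<noteq> 0" using unit by auto
  then have "B0 \<bullet> w = 0" using w(2) by (simp add: par_proj_mult)
  then show "B0 \<bullet> v0 = B0 \<bullet> u0"
    by (simp add: w(1) par_proj_mult inner_add_right inner_unit[OF unit])
  have "perp B0 v0 = w"
    using \<open>B0 \<bullet> w = 0\<close>
    by (simp add: w(1) par_proj_mult perp_add perp_scaleR perp_self[OF unit]) (simp add: perp_def)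
  then have "norm (perp B0 v0) \<le> c1 * \<epsilon>" using w(3) by simp
  also have "\<dots> \<le> \<bar>c1\<bar> * \<epsilon>" using eps by simp
  finally show "norm (perp B0 v0) \<le> \<bar>c1\<bar> * \<epsilon>" .
  show "norm (x0 - q0) \<le> norm u0 * \<epsilon>"
    using s eps norm_cross_le[of u0 B0] unit by (auto simp: slow_start_def mult.commute)
qed

lemma boris_two_step_method:
  assumes unit: "norm B0 = 1" and eps: "0 < \<epsilon>" "\<epsilon> \<le> h\<^sup>2" and h: "0 < h" "h \<le> 1" "6 * M * h \<le> 1"
    and N: "real N * h \<le> T" "T \<le> M"
    and bor: "boris (magnetic_field B0 b \<epsilon>) e T h x v"
    and start: "slow_start B0 \<epsilon> c1 q0 u0 (x 0) (v 0)" "norm u0 \<le> M0"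
    and b: "\<And>n. n \<le> N \<Longrightarrow> norm (b (x (int n))) \<le> M0"
    and e: "\<And>n. n \<le> N \<Longrightarrow> norm (e (x (int n))) \<le> M0"
    and M: "M \<ge> 2" "2 * M0 \<le> M" "2 * \<bar>c1\<bar> \<le> M"
  shows "two_step_method B0 b e M h \<epsilon> N x v"
proof -
  have M0: "0 \<le> M0" using start(2) norm_ge_zero order_trans by blast
  have nT: "of_int (int n) * h \<le> T" if "n \<le> N" for n
  proof -
    have "real n * h \<le> real N * h" using that h by simp
    then show ?thesis using N by simp
  qed
  have eq: "second_diff h x (int n) = central_diff h x (int n) \<times> magnetic_field B0 b \<epsilon> (x (int n)) + e (x (int n))"
    "v (int n) = central_diff h x (int n)" if "n \<le> N" for n
    using bor nT[OF that] unfolding boris_def by auto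
  have v0: "v 0 = central_diff h x 0" using eq(2)[of 0] by simp
  define z where "z n = central_diff h x (int n) \<times> magnetic_field B0 b \<epsilon> (x (int n)) + e (x (int n))" for n
  have h2: "h\<^sup>2 \<le> h" using h by (simp add: power2_eq_square mult_left_le)
  note sv = slow_start_velocity[OF unit eps(1) start(1)]
  show ?thesis
  \<comment> \<open>The field itself enters, not differences of a potential, so there is no
    remainder; without a filter \<open>k\<close> is 1.\<close>
  proof (rule two_step_methodI[where z = z and k = 1 and r = "\<lambda>n. 0" and ?M0.0 = M0 and D = "\<bar>c1\<bar>"])
    show "second_diff h x (int n) = (B0 \<bullet> z n) *\<^sub>R B0 + 1 *\<^sub>R perp B0 (z n)" if "n \<le> N" for n
      using eq(1)[OF that] decomp[of "z n" B0] by (simp add: z_def)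
    show "z n = (1 / \<epsilon>) *\<^sub>R (central_diff h x (int n) \<times> B0)
      + (central_diff h x (int n) \<times> b (x (int n)) + e (x (int n)) + 0)" for n
      by (simp add: z_def magnetic_field_def cross_add_right cross_mult_right)
    show "2 * \<epsilon> \<le> M * (\<bar>1\<bar> * h)"
    proof -
      have "2 * \<epsilon> \<le> 2 * h" using eps h2 by simp
      also have "\<dots> \<le> M * h" using M h by simp
      finally show ?thesis by simp
    qed
    show "\<bar>B0 \<bullet> central_diff h x (int 0)\<bar> \<le> M0"
      using sv(1) v0 abs_inner_le[OF unit, of u0] start(2) by simp
    have p: "norm (perp B0 (central_diff h x (int 0))) \<le> \<bar>c1\<bar> * \<epsilon>" using sv(2) v0 by simp
    then show "\<bar>1\<bar> * norm (perp B0 (central_diff h x (int 0))) \<le> \<bar>c1\<bar> * \<epsilon>" by simp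
    show "h * norm (perp B0 (central_diff h x (int 0))) \<le> \<bar>c1\<bar> * \<epsilon>"
      using p h mult_left_le_one_le[of "norm (perp B0 (central_diff h x (int 0)))" h] by simp
  qed (use unit eps h N M M0 b e eq(2) in auto)
qed

section \<open>The two variational methods\<close>

definition potential_remainder ::
  "(real^3 \<Rightarrow> real^3) \<Rightarrow> real \<Rightarrow> (int \<Rightarrow> real^3) \<Rightarrow> nat \<Rightarrow> real^3" where
  "potential_remainder A h x n = frechet_derivative A (at (x (int n))) (central_diff h x (int n))
     - (A (x (int n + 1)) - A (x (int n - 1))) /\<^sub>R (2 * h)"

text \<open>The first bound needs only the Lipschitz constant and holds for increments of any length
  within the ball; the second exploits the symmetry of the chord and requires short
  increments.\<close>

lemma potential_remainder_bounds:
  fixes x :: "int \<Rightarrow> real^3"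
  assumes h: "0 < h" and M0: "0 \<le> M0"
    and fb: "field_bounds A (\<lambda>x. frechet_derivative A (at x)) r M0"
    and cdb: "\<And>y m d. norm y + norm m + norm d \<le> r \<Longrightarrow>
      norm (A (y + m + d) - A (y - m + d) - 2 *\<^sub>R frechet_derivative A (at y) m)
        \<le> M0 * ((norm m)^3 + norm m * norm d)"
    and x: "norm (x (int n)) \<le> r - 2" "norm (x (int n + 1)) \<le> r" "norm (x (int n - 1)) \<le> r"
  defines "s \<equiv> increment x (Suc n) + increment x n" and "d \<equiv> increment x (Suc n) - increment x n"
  shows "norm (potential_remainder A h x n) \<le> M0 * norm s / h"
    and "norm (increment x n) \<le> 1 \<Longrightarrow> norm (increment x (Suc n)) \<le> 1 \<Longrightarrow>
      norm (potential_remainder A h x n) \<le> M0 * ((norm s)^3 + norm s * norm d) / h"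
proof -
  let ?A' = "frechet_derivative A (at (x (int n)))"
  have xb: "x (int n) \<in> cball 0 r" "x (int n + 1) \<in> cball 0 r" "x (int n - 1) \<in> cball 0 r"
    using x by auto
  have dA: "(A has_derivative ?A') (at (x (int n)))" using fb by (auto simp: field_bounds_def)
  have lin: "linear ?A'" using dA by (rule has_derivative_linear)
  have h2: "0 < 2 * h" using h by simp
  have cd: "central_diff h x (int n) = s /\<^sub>R (2 * h)" by (simp add: s_def central_diff_increment)
  have s: "x (int n + 1) - x (int n - 1) = s" by (simp add: s_def increment_def add.commute)
  have rem: "potential_remainder A h x n
      = (?A' s - (A (x (int n + 1)) - A (x (int n - 1)))) /\<^sub>R (2 * h)"
    unfolding potential_remainder_def cd
    by (simp add: linear_scale[OF lin] scaleR_right_diff_distrib)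
  have "norm (?A' s - (A (x (int n + 1)) - A (x (int n - 1)))) \<le> norm (?A' s)
      + norm (A (x (int n + 1)) - A (x (int n - 1)))"
    by (rule norm_triangle_ineq4)
  also have "\<dots> \<le> M0 * norm s + M0 * norm s"
  proof (rule add_mono)
    show "norm (?A' s) \<le> M0 * norm s" using fb xb by (auto simp: field_bounds_def)
    show "norm (A (x (int n + 1)) - A (x (int n - 1))) \<le> M0 * norm s"
      using field_bounds_lipschitz[OF fb xb(2,3)] s by simp
  qed
  finally have "norm (potential_remainder A h x n) \<le> (M0 * norm s + M0 * norm s) / (2 * h)"
    unfolding rem norm_divideR[OF h2] using h by (intro divide_right_mono) auto
  then show "norm (potential_remainder A h x n) \<le> M0 * norm s / h" by simp
  assume small: "norm (increment x n) \<le> 1" "norm (increment x (Suc n)) \<le> 1"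
  \<comment> \<open>\<open>x n + d'\<close> is the midpoint of x (n - 1) and x (n + 1), and
    \<open>m'\<close> is half the vector joining them. Short increments give both a norm of at most
    1, which uses up the margin in \<open>r - 2\<close>.\<close>
  define m' where "m' = (1 / 2) *\<^sub>R s"
  define d' where "d' = (1 / 2) *\<^sub>R d"
  have "norm s \<le> 2" "norm d \<le> 2"
    unfolding s_def d_def using small norm_triangle_ineq[of "increment x (Suc n)" "increment x n"]
      norm_triangle_ineq4[of "increment x (Suc n)" "increment x n"] by linarith+
  then have md: "norm (x (int n)) + norm m' + norm d' \<le> r"
    using x(1) by (simp add: m'_def d'_def)
  have "m' + d' = (1 / 2) *\<^sub>R (s + d)" "- m' + d' = (1 / 2) *\<^sub>R (d - s)"
    by (simp_all add: m'_def d'_def scaleR_right_distrib scaleR_right_diff_distrib)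
  moreover have "s + d = 2 *\<^sub>R increment x (Suc n)" "d - s = - (2 *\<^sub>R increment x n)"
    by (simp_all add: s_def d_def scaleR_2)
  ultimately have "m' + d' = increment x (Suc n)" "- m' + d' = - increment x n"
    by simp_all
  then have "x (int n) + m' + d' = x (int n + 1)" "x (int n) - m' + d' = x (int n - 1)"
    by (simp_all add: increment_def algebra_simps)
  then have "norm ((A (x (int n + 1)) - A (x (int n - 1))) - ?A' s) \<le> M0 * ((norm m')^3 + norm m' * norm d')"
    using cdb[OF md] by (simp add: m'_def linear_scale[OF lin])
  also have "\<dots> \<le> M0 * ((norm s)^3 + norm s * norm d)"
    using M0 by (intro mult_left_mono add_mono mult_mono power_mono) (auto simp: m'_def d'_def)
  finally have "norm (potential_remainder A h x n) \<le> M0 * ((norm s)^3 + norm s * norm d) / (2 * h)"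
    unfolding rem norm_divideR[OF h2] norm_minus_commute[of "?A' s"] using h
    by (intro divide_right_mono) auto
  also have "\<dots> \<le> M0 * ((norm s)^3 + norm s * norm d) / h"
    using h M0 by (intro divide_left_mono) auto
  finally show "norm (potential_remainder A h x n) \<le> M0 * ((norm s)^3 + norm s * norm d) / h" .
qed

text \<open>Apart from algebra, the task is to place every point at which the potential is evaluated
  in the ball of radius r: the forward point by the branch condition, and \<open>x (-1)\<close>, on
  which no bound is assumed, through the starting velocity.\<close>

lemma variational_two_step_method:
  fixes x v :: "int \<Rightarrow> real^3"
  assumes unit: "norm B0 = 1" and eps: "0 < \<epsilon>" "\<epsilon> \<le> h\<^sup>2" and h: "0 < h" "h \<le> 1" "6 * M * h \<le> 1"
    and N: "real N * h \<le> M"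
    and step: "\<And>n. n \<le> N \<Longrightarrow>
      z n = discrete_lorentz_force (vector_potential B0 A \<epsilon>) e h x (int n) \<and>
      second_diff h x (int n) = (B0 \<bullet> z n) *\<^sub>R B0 + k *\<^sub>R perp B0 (z n)"
    and v: "\<And>n. n \<le> N \<Longrightarrow> B0 \<bullet> v (int n) = B0 \<bullet> central_diff h x (int n)"
    and near: "\<And>n. n \<le> N \<Longrightarrow> norm (x (int n + 1) - x (int n)) \<le> \<rho>"
    and xR: "\<And>n. n \<le> N \<Longrightarrow> norm (x (int n)) \<le> R" and r: "R + \<bar>\<rho>\<bar> + 2 \<le> r"
    and curl: "\<And>y. curl A y = b y"
    and b: "\<And>n. n \<le> N \<Longrightarrow> norm (b (x (int n))) \<le> M0"
    and e: "\<And>n. n \<le> N \<Longrightarrow> norm (e (x (int n))) \<le> M0"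
    and fb: "field_bounds A (\<lambda>x. frechet_derivative A (at x)) r M0"
    and cdb: "\<And>y m d. norm y + norm m + norm d \<le> r \<Longrightarrow>
      norm (A (y + m + d) - A (y - m + d) - 2 *\<^sub>R frechet_derivative A (at y) m)
        \<le> M0 * ((norm m)^3 + norm m * norm d)"
    and k: "k \<noteq> 0" "2 * \<epsilon> \<le> M * (\<bar>k\<bar> * h)" "\<bar>k\<bar> \<le> 2 * M"
    and start: "\<bar>B0 \<bullet> central_diff h x 0\<bar> \<le> M0" "h * norm (perp B0 (central_diff h x 0)) \<le> D * \<epsilon>"
      "\<bar>k\<bar> * norm (perp B0 (central_diff h x 0)) \<le> D * \<epsilon>"
    and M: "0 \<le> M0" "2 * M0 \<le> M" "0 \<le> D" "2 * D \<le> M"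
  shows "two_step_method B0 b e M h \<epsilon> N x v"
proof -
  have h2: "h\<^sup>2 \<le> h" using h by (simp add: power2_eq_square mult_left_le)
  have "h * norm (central_diff h x 0) \<le> h * \<bar>B0 \<bullet> central_diff h x 0\<bar> + h * norm (perp B0 (central_diff h x 0))"
    using mult_left_mono[OF norm_le_components[OF unit, of "central_diff h x 0"], of h] h
    by (simp add: distrib_left)
  also have "\<dots> \<le> h * M0 + D * h"
    using start h eps h2 M mult_left_mono[of \<epsilon> h D] mult_left_mono[OF start(1), of h] by linarith
  also have "\<dots> \<le> M * h"
    using mult_right_mono[of "2 * (M0 + D)" "2 * M" h] M h by (simp add: algebra_simps)
  finally have cd0: "2 * (h * norm (central_diff h x 0)) \<le> 1" using h by linarith
  have up: "norm (x (int n + 1)) \<le> r - 1" if "n \<le> N" for n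
    using near[OF that] xR[OF that] r norm_triangle_sub[of "x (int n + 1)" "x (int n)"] by linarith
  \<comment> \<open>For n > 0 the point x (n - 1) is an earlier iterate. \<open>x (-1)\<close> is
    reached from \<open>x 1\<close> by 2 h times the central difference, at most 1 in norm by
    \<open>cd0\<close>; this is why \<open>up\<close> gives r - 1 and not r.\<close>
  have down: "norm (x (int n - 1)) \<le> r" if "n \<le> N" for n
  proof (cases n)
    case 0
    have "x 1 - x (- 1) = (2 * h) *\<^sub>R central_diff h x 0"
      using h by (simp add: central_diff_def)
    then have "x (- 1) = x 1 - (2 * h) *\<^sub>R central_diff h x 0" by (simp add: algebra_simps)
    then have "norm (x (- 1)) \<le> norm (x 1) + 2 * (h * norm (central_diff h x 0))"
      using norm_triangle_ineq4[of "x 1" "(2 * h) *\<^sub>R central_diff h x 0"] h by simp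
    then show ?thesis using 0 cd0 up[of 0] by simp
  next
    case (Suc m)
    then show ?thesis using xR[of m] that r by simp
  qed
  have rem: "norm (potential_remainder A h x n) \<le> M0 * norm (increment x (Suc n) + increment x n) / h"
    "norm (increment x n) \<le> 1 \<Longrightarrow> norm (increment x (Suc n)) \<le> 1 \<Longrightarrow>
      norm (potential_remainder A h x n) \<le> M0 * ((norm (increment x (Suc n) + increment x n))^3
        + norm (increment x (Suc n) + increment x n) * norm (increment x (Suc n) - increment x n)) / h"
    if n: "n \<le> N" for n
  proof -
    have pts: "norm (x (int n)) \<le> r - 2" "norm (x (int n + 1)) \<le> r" "norm (x (int n - 1)) \<le> r"
      using xR[OF n] up[OF n] down[OF n] r by auto
    show "norm (potential_remainder A h x n) \<le> M0 * norm (increment x (Suc n) + increment x n) / h"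
      by (rule potential_remainder_bounds(1)[OF h(1) M(1) fb cdb pts])
    show "norm (potential_remainder A h x n) \<le> M0 * ((norm (increment x (Suc n) + increment x n))^3
        + norm (increment x (Suc n) + increment x n) * norm (increment x (Suc n) - increment x n)) / h"
      if "norm (increment x n) \<le> 1" "norm (increment x (Suc n)) \<le> 1"
      by (rule potential_remainder_bounds(2)[OF h(1) M(1) fb cdb pts that])
  qed
  have diff: "A differentiable (at y)" for y
    using fb unfolding field_bounds_def differentiable_def by blast
  show ?thesis
  proof (rule two_step_methodI[where z = z and k = k and r = "potential_remainder A h x" and ?M0.0 = M0 and D = D])
    show "z n = (1 / \<epsilon>) *\<^sub>R (central_diff h x (int n) \<times> B0)
        + (central_diff h x (int n) \<times> b (x (int n)) + e (x (int n)) + potential_remainder A h x n)"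
      if "n \<le> N" for n
      using step[OF that] discrete_lorentz_force_eq[OF diff, of B0 \<epsilon> e h x "int n"]
      by (simp add: curl potential_remainder_def)
    show "norm (potential_remainder A h x n) \<le> M * ((norm (increment x (Suc n) + increment x n))^3
        + norm (increment x (Suc n) + increment x n) * norm (increment x (Suc n) - increment x n)) / h"
      if "n \<le> N" "norm (increment x n) \<le> 1" "norm (increment x (Suc n)) \<le> 1" for n
      using rem(2)[OF that] by (rule order_trans) (use M h in \<open>auto intro!: divide_right_mono mult_right_mono\<close>)
  qed (use unit eps h N step v b e rem(1) k start M in auto)
qed

lemma standard_two_step_method:
  assumes unit: "norm B0 = 1" and eps: "0 < \<epsilon>" "\<epsilon> \<le> h\<^sup>2" and h: "0 < h" "h \<le> 1" "6 * M * h \<le> 1"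
    and N: "real N * h \<le> T" "T \<le> M"
    and std: "standard_variational (vector_potential B0 A \<epsilon>) e T h x v" and nb: "near_branch \<rho> T h x"
    and start: "slow_start B0 \<epsilon> c1 q0 u0 (x 0) (v 0)" "norm u0 \<le> M0"
    and xR: "\<And>n. n \<le> N \<Longrightarrow> norm (x (int n)) \<le> R" and r: "R + \<bar>\<rho>\<bar> + 2 \<le> r"
    and curl: "\<And>y. curl A y = b y"
    and b: "\<And>n. n \<le> N \<Longrightarrow> norm (b (x (int n))) \<le> M0"
    and e: "\<And>n. n \<le> N \<Longrightarrow> norm (e (x (int n))) \<le> M0"
    and fb: "field_bounds A (\<lambda>x. frechet_derivative A (at x)) r M0"
    and cdb: "\<And>y m d. norm y + norm m + norm d \<le> r \<Longrightarrow>
      norm (A (y + m + d) - A (y - m + d) - 2 *\<^sub>R frechet_derivative A (at y) m)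
        \<le> M0 * ((norm m)^3 + norm m * norm d)"
    and M: "M \<ge> 2" "2 * M0 \<le> M" "2 * \<bar>c1\<bar> \<le> M"
  shows "two_step_method B0 b e M h \<epsilon> N x v"
proof -
  have M0: "0 \<le> M0" using start(2) norm_ge_zero order_trans by blast
  have nT: "of_int (int n) * h \<le> T" if "n \<le> N" for n
  proof -
    have "real n * h \<le> real N * h" using that h by simp
    then show ?thesis using N by simp
  qed
  define z where "z n = discrete_lorentz_force (vector_potential B0 A \<epsilon>) e h x (int n)" for n
  have eq: "second_diff h x (int n) = z n" "v (int n) = central_diff h x (int n)" if "n \<le> N" for n
    using std nT[OF that] unfolding standard_variational_def z_def by auto
  have v0: "v 0 = central_diff h x 0" using eq(2)[of 0] by simp
  have h2: "h\<^sup>2 \<le> h" using h by (simp add: power2_eq_square mult_left_le)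
  note sv = slow_start_velocity[OF unit eps(1) start(1)]
  have p: "norm (perp B0 (central_diff h x 0)) \<le> \<bar>c1\<bar> * \<epsilon>" using sv(2) v0 by simp
  show ?thesis
  proof (rule variational_two_step_method[where z = z and k = 1 and ?M0.0 = M0 and D = "\<bar>c1\<bar>"
        and A = A and \<rho> = \<rho> and R = R and r = r])
    show "z n = discrete_lorentz_force (vector_potential B0 A \<epsilon>) e h x (int n) \<and>
      second_diff h x (int n) = (B0 \<bullet> z n) *\<^sub>R B0 + 1 *\<^sub>R perp B0 (z n)" if "n \<le> N" for n
      using eq(1)[OF that] decomp[of "z n" B0] by (simp add: z_def)
    show "norm (x (int n + 1) - x (int n)) \<le> \<rho>" if "n \<le> N" for n
      using nb nT[OF that] unfolding near_branch_def by auto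
    show "2 * \<epsilon> \<le> M * (\<bar>1\<bar> * h)"
    proof -
      have "2 * \<epsilon> \<le> 2 * h" using eps h2 by simp
      also have "\<dots> \<le> M * h" using M h by simp
      finally show ?thesis by simp
    qed
    show "\<bar>B0 \<bullet> central_diff h x 0\<bar> \<le> M0"
      using sv(1) v0 abs_inner_le[OF unit, of u0] start(2) by simp
    show "\<bar>1\<bar> * norm (perp B0 (central_diff h x 0)) \<le> \<bar>c1\<bar> * \<epsilon>" using p by simp
    show "h * norm (perp B0 (central_diff h x 0)) \<le> \<bar>c1\<bar> * \<epsilon>"
      using p h mult_left_le_one_le[of "norm (perp B0 (central_diff h x 0))" h] by simp
  qed ((rule cdb, assumption) | (use unit eps h N M M0 b e eq(2) xR r curl fb in auto)[1])+
qed

text \<open>Nonresonance keeps \<open>\<bar>tan \<mu>\<bar>\<close> between c and 1 / c, so \<tau> =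
  tan \<mu> is bounded in both directions. A starting velocity of size 1 is admissible because the
  velocity filter divides the perpendicular central difference by
  \<open>sinc (h / \<epsilon>)\<close>, which is at most \<epsilon> / h: that central difference is
  small although the perpendicular part of \<open>v 0\<close> is not.\<close>

lemma filtered_two_step_method:
  assumes unit: "norm B0 = 1" and eps: "0 < \<epsilon>" "\<epsilon> \<le> h\<^sup>2" and h: "0 < h" "h \<le> 1" "6 * M * h \<le> 1"
    and N: "real N * h \<le> T" "T \<le> M"
    and flt: "filtered_variational B0 \<epsilon> (vector_potential B0 A \<epsilon>) e T h x v" and nb: "near_branch \<rho> T h x"
    and c: "c > 0" "\<bar>sin (h / (2 * \<epsilon>))\<bar> \<ge> c" "\<bar>cos (h / (2 * \<epsilon>))\<bar> \<ge> c"
    and start: "norm (v 0) \<le> M0"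
    and xR: "\<And>n. n \<le> N \<Longrightarrow> norm (x (int n)) \<le> R" and r: "R + \<bar>\<rho>\<bar> + 2 \<le> r"
    and curl: "\<And>y. curl A y = b y"
    and b: "\<And>n. n \<le> N \<Longrightarrow> norm (b (x (int n))) \<le> M0"
    and e: "\<And>n. n \<le> N \<Longrightarrow> norm (e (x (int n))) \<le> M0"
    and fb: "field_bounds A (\<lambda>x. frechet_derivative A (at x)) r M0"
    and cdb: "\<And>y m d. norm y + norm m + norm d \<le> r \<Longrightarrow>
      norm (A (y + m + d) - A (y - m + d) - 2 *\<^sub>R frechet_derivative A (at y) m)
        \<le> M0 * ((norm m)^3 + norm m * norm d)"
    and M: "2 * M0 \<le> M" "1 / c \<le> M" "6 * (1 + 2 / c) * M0 \<le> M"
  shows "two_step_method B0 b e M h \<epsilon> N x v"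
proof -
  have M0: "0 \<le> M0" using start norm_ge_zero order_trans by blast
  have nT: "of_int (int n) * h \<le> T" if "n \<le> N" for n
  proof -
    have "real n * h \<le> real N * h" using that h by simp
    then show ?thesis using N by simp
  qed
  define z where "z n = discrete_lorentz_force (vector_potential B0 A \<epsilon>) e h x (int n)" for n
  define \<mu> where "\<mu> = h / (2 * \<epsilon>)"
  define k where "k = tanc \<mu>"
  define s where "s = sinc (h / \<epsilon>)"
  have mu: "\<mu> > 0" "h / \<epsilon> = 2 * \<mu>" "\<epsilon> = h / (2 * \<mu>)" using h eps by (auto simp: \<mu>_def)
  have cs: "\<bar>sin \<mu>\<bar> \<ge> c" "\<bar>cos \<mu>\<bar> \<ge> c" "\<bar>sin \<mu>\<bar> \<le> 1" "\<bar>cos \<mu>\<bar> \<le> 1" using c by (auto simp: \<mu>_def)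
  have nz: "sin \<mu> \<noteq> 0" "cos \<mu> \<noteq> 0" using cs c by auto
  have s_eq: "s = sin (2 * \<mu>) * (\<epsilon> / h)" using h eps by (simp add: s_def sinc_def mu(2)[symmetric])
  have s_nz: "s \<noteq> 0" using nz h eps by (simp add: s_eq sin_double)
  have h2: "h\<^sup>2 \<le> h" using h by (simp add: power2_eq_square mult_left_le)
  have eps_h: "\<epsilon> \<le> h" "\<epsilon> / h \<le> h" "\<epsilon> / h \<le> 1"
  proof -
    show "\<epsilon> \<le> h" using eps h2 by linarith
    then show "\<epsilon> / h \<le> 1" using h by simp
    show "\<epsilon> / h \<le> h" using eps h by (simp add: pos_divide_le_eq power2_eq_square)
  qed
  have s_le: "\<bar>s\<bar> \<le> \<epsilon> / h"
    using h eps mult_right_mono[of "\<bar>sin (2 * \<mu>)\<bar>" 1 "\<epsilon> / h"] by (simp add: s_eq abs_mult)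
  have k_eq: "k * h = tan \<mu> * (2 * \<epsilon>)" using mu h eps by (simp add: k_def tanc_def field_simps)
  have tan_le: "\<bar>tan \<mu>\<bar> \<le> 1 / c"
    unfolding tan_def abs_divide by (rule frac_le) (use cs c in auto)
  have tan_ge: "1 \<le> (1 / c) * \<bar>tan \<mu>\<bar>"
  proof -
    have "c * \<bar>cos \<mu>\<bar> \<le> c" using cs c by (simp add: mult_left_le)
    then have "c * \<bar>cos \<mu>\<bar> \<le> \<bar>sin \<mu>\<bar>" using cs by linarith
    then show ?thesis using c nz by (simp add: tan_def field_simps)
  qed
  have eq: "second_diff h x (int n) = filter_Psi B0 \<epsilon> h *v z n"
    "v (int n) = filter_Phi B0 \<epsilon> h *v central_diff h x (int n) + (\<epsilon> * (1 - inverse s)) *\<^sub>R (e (x (int n)) \<times> B0)"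
    if "n \<le> N" for n
    using flt nT[OF that] unfolding filtered_variational_def z_def s_def by auto
  have Psi: "filter_Psi B0 \<epsilon> h *v a = (B0 \<bullet> a) *\<^sub>R B0 + k *\<^sub>R perp B0 a" for a
    unfolding filter_Psi_def k_def \<mu>_def by (rule filter_mult[OF unit])
  have Phi: "filter_Phi B0 \<epsilon> h *v a = (B0 \<bullet> a) *\<^sub>R B0 + inverse s *\<^sub>R perp B0 a" for a
    unfolding filter_Phi_def s_def by (rule filter_mult[OF unit])
  have vpar: "B0 \<bullet> v (int n) = B0 \<bullet> central_diff h x (int n)" if "n \<le> N" for n
    unfolding eq(2)[OF that] Phi
    by (simp add: inner_add_right inner_unit[OF unit] inner_perp[OF unit] dot_cross_self)
  let ?p = "perp B0 (central_diff h x 0)"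
  have p: "h * norm ?p \<le> 3 * M0 * \<epsilon>"
  proof -
    have pp: "perp B0 (perp B0 a) = perp B0 a" for a
      by (simp add: perp_def[of B0 "perp B0 a"] inner_perp[OF unit])
    have "perp B0 (v 0) = inverse s *\<^sub>R ?p + (\<epsilon> * (1 - inverse s)) *\<^sub>R (e (x 0) \<times> B0)"
      using eq(2)[of 0] unfolding Phi
      by (simp add: perp_add perp_scaleR perp_self[OF unit] pp perp_of_cross[OF unit])
    \<comment> \<open>Multiplied by \<open>s\<close>, so that only the small \<open>s\<close> and
      never its large inverse has to be estimated.\<close>
    then have "s *\<^sub>R perp B0 (v 0) = ?p + (\<epsilon> * (s - 1)) *\<^sub>R (e (x 0) \<times> B0)"
    proof -
      have "s * (\<epsilon> * (1 - inverse s)) = \<epsilon> * (s - 1)" using s_nz by (simp add: field_simps)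
      then show ?thesis
        unfolding \<open>perp B0 (v 0) = _\<close> scaleR_right_distrib scaleR_scaleR using s_nz by simp
    qed
    then have "?p = s *\<^sub>R perp B0 (v 0) - (\<epsilon> * (s - 1)) *\<^sub>R (e (x 0) \<times> B0)"
      by (simp add: algebra_simps)
    then have "norm ?p \<le> \<bar>s\<bar> * norm (perp B0 (v 0)) + \<epsilon> * \<bar>s - 1\<bar> * norm (e (x 0) \<times> B0)"
      using norm_triangle_ineq4[of "s *\<^sub>R perp B0 (v 0)" "(\<epsilon> * (s - 1)) *\<^sub>R (e (x 0) \<times> B0)"] eps
      by (simp add: abs_mult)
    also have "\<dots> \<le> \<epsilon> / h * M0 + \<epsilon> * 2 * M0"
    proof (intro add_mono mult_mono)
      show "norm (perp B0 (v 0)) \<le> M0" using norm_perp_le[OF unit, of "v 0"] start by linarith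
      show "norm (e (x 0) \<times> B0) \<le> M0"
        using norm_cross_le[of "e (x 0)" B0] e[of 0] unit by simp
      show "\<bar>s - 1\<bar> \<le> 2" using s_le eps_h(3) by linarith
    qed (use s_le eps h in auto)
    finally have "h * norm ?p \<le> h * (\<epsilon> / h * M0 + \<epsilon> * 2 * M0)"
      using h by (intro mult_left_mono) auto
    also have "\<dots> = \<epsilon> * M0 + h * (\<epsilon> * 2 * M0)" using h by (simp add: field_simps)
    also have "h * (\<epsilon> * 2 * M0) \<le> 1 * (\<epsilon> * 2 * M0)" using h eps M0 by (intro mult_right_mono) auto
    finally show ?thesis by (simp add: algebra_simps)
  qed
  show ?thesis
  \<comment> \<open>\<open>D\<close> covers both starting conditions: \<open>3 * M0\<close> for the
    one with the factor h and \<open>6 * M0 / c\<close> for the one with the factor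
    \<open>k\<close>.\<close>
  proof (rule variational_two_step_method[where z = z and k = k and ?M0.0 = M0 and D = "3 * (1 + 2 / c) * M0"
        and A = A and \<rho> = \<rho> and R = R and r = r])
    show "z n = discrete_lorentz_force (vector_potential B0 A \<epsilon>) e h x (int n) \<and>
      second_diff h x (int n) = (B0 \<bullet> z n) *\<^sub>R B0 + k *\<^sub>R perp B0 (z n)" if "n \<le> N" for n
      using eq(1)[OF that] by (simp add: z_def Psi)
    show "norm (x (int n + 1) - x (int n)) \<le> \<rho>" if "n \<le> N" for n
      using nb nT[OF that] unfolding near_branch_def by auto
    show "k \<noteq> 0" using mu nz by (simp add: k_def tanc_def tan_def)
    have "2 * \<epsilon> * 1 \<le> 2 * \<epsilon> * (1 / c * \<bar>tan \<mu>\<bar>)"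
      using eps by (intro mult_left_mono[OF tan_ge]) simp
    also have "\<dots> = 1 / c * (\<bar>k\<bar> * h)"
      using k_eq h eps by (metis abs_mult abs_of_pos mult.assoc mult.commute zero_less_mult_iff zero_less_numeral)
    also have "\<dots> \<le> M * (\<bar>k\<bar> * h)" using M h by (intro mult_right_mono) auto
    finally show "2 * \<epsilon> \<le> M * (\<bar>k\<bar> * h)" by simp
    have k_abs: "\<bar>k\<bar> = \<bar>tan \<mu>\<bar> * (2 * (\<epsilon> / h))"
      using arg_cong[OF k_eq, of abs] h eps by (simp add: abs_mult field_simps)
    also have "\<dots> \<le> 1 / c * (2 * 1)"
      using tan_le eps_h(3) eps h c by (intro mult_mono) auto
    finally show "\<bar>k\<bar> \<le> 2 * M" using M by simp
    show "\<bar>B0 \<bullet> central_diff h x 0\<bar> \<le> M0"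
      using vpar[of 0] abs_inner_le[OF unit, of "v 0"] start by simp
    have "3 * M0 * \<epsilon> \<le> (3 * (1 + 2 / c) * M0) * \<epsilon>"
      using M0 eps c by (intro mult_right_mono) (auto simp: algebra_simps)
    then show "h * norm ?p \<le> 3 * (1 + 2 / c) * M0 * \<epsilon>" using p by linarith
    \<comment> \<open>\<open>k\<close> is of size \<epsilon> / h, so next to the quantity bounded in
      \<open>p\<close> there stands the factor \<epsilon> / h^2 \<le> 1.\<close>
    have "\<bar>k\<bar> * norm ?p = \<bar>tan \<mu>\<bar> * (2 * (\<epsilon> / h\<^sup>2)) * (h * norm ?p)"
      using h unfolding k_abs by (simp add: power2_eq_square)
    also have "\<dots> \<le> 1 / c * (2 * 1) * (3 * M0 * \<epsilon>)"
      by (rule mult_mono[OF mult_mono[OF tan_le] p]) (use eps h c M0 in \<open>auto simp: pos_divide_le_eq\<close>)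
    also have "\<dots> \<le> 3 * (1 + 2 / c) * M0 * \<epsilon>"
      using M0 eps c by (simp add: algebra_simps)
    finally show "\<bar>k\<bar> * norm ?p \<le> 3 * (1 + 2 / c) * M0 * \<epsilon>" .
    show "0 \<le> 3 * (1 + 2 / c) * M0" using M0 c by simp
    show "2 * (3 * (1 + 2 / c) * M0) \<le> M" using M(3) by (simp add: algebra_simps)
  qed ((rule cdb, assumption) | (use unit eps h N M M0 b e vpar xR r curl fb in auto)[1])+
qed

section \<open>Comparison of the slow variables\<close>

text \<open>In leapfrog order the velocity error is driven by the new position error
  \<open>d (Suc n)\<close>. Inserting the first inequality into the second gives a single one for
  \<open>d n + e n\<close>; defects h^3 over O(1 / h) steps leave h^2.\<close>

lemma coupled_gronwall:
  fixes d e :: "nat \<Rightarrow> real"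
  assumes G: "G \<ge> 1" and h: "0 < h" "h \<le> 1" and Nh: "real N * h \<le> G"
    and nonneg: "\<And>n. 0 \<le> d n" "\<And>n. 0 \<le> e n"
    and d: "\<And>n. n < N \<Longrightarrow> d (Suc n) \<le> d n + h * e n + 2 * G * h^3"
    and e: "\<And>n. n < N \<Longrightarrow> e (Suc n) \<le> e n + h * G * (G * h\<^sup>2 + d (Suc n)) + 2 * G * h^3"
    and init: "d 0 \<le> G * h\<^sup>2" "e 0 \<le> G * h\<^sup>2"
    and n: "n \<le> N"
  shows "d n + e n \<le> exp (2 * G\<^sup>2) * (2 * G + 7 * G^3) * h\<^sup>2"
proof -
  define s where "s n = d n + e n" for n
  have step: "s (Suc n) \<le> (1 + 2 * G * h) * s n + 7 * G\<^sup>2 * h^3" if "n < N" for n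
  proof -
    have "h * G * d (Suc n) \<le> h * G * (d n + h * e n + 2 * G * h^3)"
      using d[OF that] h G by (intro mult_left_mono) auto
    also have "\<dots> = h * G * d n + h * (h * G * e n) + h * (2 * G\<^sup>2 * h^3)"
      by (simp add: algebra_simps power2_eq_square)
    also have "\<dots> \<le> h * G * d n + 1 * (h * G * e n) + 1 * (2 * G\<^sup>2 * h^3)"
      using h G nonneg by (intro add_mono mult_right_mono) auto
    finally have 1: "h * G * d (Suc n) \<le> h * G * d n + h * G * e n + 2 * G\<^sup>2 * h^3" by simp
    have 2: "h * e n \<le> h * G * e n"
      using h G nonneg mult_right_mono[of 1 G "h * e n"] by (simp add: algebra_simps)
    have 3: "G * h^3 \<le> G\<^sup>2 * h^3"
      using h G by (intro mult_right_mono) (auto simp: power2_eq_square)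
    have 4: "h * G * (G * h\<^sup>2) = G\<^sup>2 * h^3" by (simp add: power2_eq_square power3_eq_cube)
    have 5: "0 \<le> h * G * d n" using h G nonneg by simp
    \<comment> \<open>The 7 collects the two local defects (2 + 2), the term from
      \<open>G * h\<^sup>2\<close> (1) and the position defect passed on to the velocity
      (2).\<close>
    have "s (Suc n) \<le> d n + h * e n + 2 * (G * h^3) + e n + h * G * (G * h\<^sup>2) + h * G * d (Suc n) + 2 * (G * h^3)"
      using d[OF that] e[OF that] by (simp add: s_def distrib_left)
    also have "\<dots> \<le> (d n + e n) + 2 * (h * G * d n) + 2 * (h * G * e n) + 7 * (G\<^sup>2 * h^3)"
      using 1 2 3 4 5 by linarith
    also have "\<dots> = (1 + 2 * G * h) * s n + 7 * G\<^sup>2 * h^3"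
      by (simp add: s_def algebra_simps)
    finally show ?thesis .
  qed
  have nh: "real n * h \<le> G"
  proof -
    have "real n * h \<le> real N * h" using n h by simp
    then show ?thesis using Nh by linarith
  qed
  have "s n \<le> exp (2 * G * h * real n) * (s 0 + 7 * G\<^sup>2 * h^3 * real n)"
    using step h G nonneg n by (intro discrete_gronwall[of N]) (auto simp: s_def)
  also have "\<dots> \<le> exp (2 * G\<^sup>2) * (2 * G * h\<^sup>2 + 7 * G^3 * h\<^sup>2)"
  proof (intro mult_mono)
    have "2 * G * (real n * h) \<le> 2 * G * G" using nh G by (intro mult_left_mono) auto
    then show "exp (2 * G * h * real n) \<le> exp (2 * G\<^sup>2)"
      by (simp add: algebra_simps power2_eq_square)
    have "7 * G\<^sup>2 * h\<^sup>2 * (real n * h) \<le> 7 * G\<^sup>2 * h\<^sup>2 * G" using nh G by (intro mult_left_mono) auto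
    then show "s 0 + 7 * G\<^sup>2 * h^3 * real n \<le> 2 * G * h\<^sup>2 + 7 * G^3 * h\<^sup>2"
      using init by (simp add: s_def algebra_simps power2_eq_square power3_eq_cube)
  qed (use nonneg h G in \<open>auto simp: s_def\<close>)
  finally show ?thesis by (simp add: s_def algebra_simps)
qed

section \<open>Error estimate as long as the exact solution stays in the ball\<close>

lemma solution_restrict:
  assumes "charged_particle_solution B E T q u" "T' \<le> T"
  shows "charged_particle_solution B E T' q u"
  unfolding charged_particle_solution_def
proof (intro ballI conjI)
  fix t assume t: "t \<in> {0..T'}"
  have sub: "{0..T'} \<subseteq> {0..T}" using assms(2) by auto
  show "(q has_vector_derivative u t) (at t within {0..T'})"
    "(u has_vector_derivative (u t \<times> B (q t) + E (q t))) (at t within {0..T'})"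
    using assms(1) t sub unfolding charged_particle_solution_def
    by (auto intro!: has_vector_derivative_within_subset[OF _ sub])
qed

text \<open>\<open>T\<close> and \<open>N\<close> are quantified after the constants, so the
  estimate applies on every shorter interval [0, s] with the same \<open>C\<close>, as the exit
  argument requires. The radius r - 1 for \<open>q\<close> leaves room for the guiding center, at
  most 1 away from it.\<close>

lemma method_error:
  assumes unit: "norm B0 = 1" and M: "M \<ge> 1"
  obtains C H where "C \<ge> 0" "H \<ge> 0"
    "\<And>b b' e e' r h \<epsilon> N x v q u T n.
      two_step_method B0 b e M h \<epsilon> N x v \<Longrightarrow> H * h \<le> 1 \<Longrightarrow>
      field_bounds b b' r M \<Longrightarrow> field_bounds e e' r M \<Longrightarrow>
      (\<And>n. n \<le> N \<Longrightarrow> norm (x (int n)) \<le> r) \<Longrightarrow>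
      charged_particle_solution (magnetic_field B0 b \<epsilon>) e T q u \<Longrightarrow>
      (\<And>t. t \<in> {0..T} \<Longrightarrow> norm (q t) \<le> r - 1) \<Longrightarrow>
      0 \<le> T \<Longrightarrow> T \<le> M \<Longrightarrow> real N * h \<le> T \<Longrightarrow> norm (u 0) \<le> M \<Longrightarrow>
      norm (x 0 - q 0) \<le> M * h\<^sup>2 \<Longrightarrow> B0 \<bullet> v 0 = B0 \<bullet> u 0 \<Longrightarrow> n \<le> N \<Longrightarrow>
      norm (x (int n) - q (real n * h)) \<le> C * h\<^sup>2 \<and>
      \<bar>B0 \<bullet> v (int n) - B0 \<bullet> u (real n * h)\<bar> \<le> C * h\<^sup>2"
proof -
  obtain K1 where K1: "K1 \<ge> M"
    "\<And>h \<epsilon> \<tau> N \<omega> f n. two_step B0 M h \<epsilon> \<tau> N \<omega> f \<Longrightarrow> n \<le> Suc N \<Longrightarrow> norm (\<omega> n) \<le> K1 * h"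
    "\<And>h \<epsilon> \<tau> N \<omega> f n. two_step B0 M h \<epsilon> \<tau> N \<omega> f \<Longrightarrow> n \<le> Suc N \<Longrightarrow> norm (perp B0 (\<omega> n)) \<le> K1 * h\<^sup>2"
    "\<And>h \<epsilon> \<tau> N \<omega> f n. two_step B0 M h \<epsilon> \<tau> N \<omega> f \<Longrightarrow> n \<le> N \<Longrightarrow> norm (\<omega> (Suc n) - \<omega> n) \<le> K1 * h\<^sup>2"
    "\<And>h \<epsilon> \<tau> N \<omega> f n. two_step B0 M h \<epsilon> \<tau> N \<omega> f \<Longrightarrow> n \<le> N \<Longrightarrow> norm (f n) \<le> K1"
    using two_step_apriori[OF unit M] by blast
  \<comment> \<open>\<open>K\<close> absorbs the remainder: with increments \<le> K1 h and
    differences \<le> K1 h^2 the cubic expression is at most (8 K1^3 + 2 K1^2) h^3, and one power of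
    h is divided out. \<open>U\<close> is the velocity bound up to time M, \<open>L\<close> the
    constant of the guiding center system, and \<open>G\<close> dominates the local defects,
    Lipschitz constants and initial errors.\<close>
  define K where "K = K1 + M * (8 * K1^3 + 2 * K1\<^sup>2)"
  define U where "U = 1 + M + M * M"
  define L where "L = 4 * M\<^sup>2 * U\<^sup>2"
  define G where "G = 3 * K^4 + 7 * L^3 + 2 * K^3 + 4 * L\<^sup>2 + M * (M + L) + K\<^sup>2 + M + L"
  define Cg where "Cg = exp (2 * G\<^sup>2) * (2 * G + 7 * G^3)"
  define C where "C = G + G * (G + Cg) + Cg + 2 * G"
  have K1p: "1 \<le> K1" using K1 M by linarith
  have K: "K1 \<le> K" "1 \<le> K" "M \<le> K" "M * (8 * K1^3 + 2 * K1\<^sup>2) \<le> K" proof -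
    have "0 \<le> M * (8 * K1^3 + 2 * K1\<^sup>2)" using M K1p by simp
    then show "K1 \<le> K" "1 \<le> K" "M \<le> K" "M * (8 * K1^3 + 2 * K1\<^sup>2) \<le> K"
      using K1(1) K1p by (simp_all add: K_def)
  qed
  have U: "1 \<le> U" using M by (simp add: U_def)
  have "1 \<le> M\<^sup>2" "1 \<le> U\<^sup>2" using M U by (simp_all add: one_le_power)
  then have "M * 1 \<le> M\<^sup>2 * U\<^sup>2" using M by (intro mult_mono) (auto simp: power2_eq_square)
  then have L: "1 \<le> L" "M \<le> L" using M by (auto simp: L_def)
  have G: "1 \<le> G" "2 * K^3 \<le> G" "3 * K^4 \<le> G" "4 * L\<^sup>2 \<le> G" "7 * L^3 \<le> G" "K\<^sup>2 \<le> G" "M \<le> G" "L \<le> G"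
    "K\<^sup>2 + M + L \<le> G" "2 * K^3 + L + M * (M + L) \<le> G"
    using K M L by (auto simp: G_def add_increasing add_increasing2)
  have Cg: "0 \<le> Cg" using G by (simp add: Cg_def)
  show ?thesis
  \<comment> \<open>In \<open>H\<close>, the part K1 makes the increments short enough for the
    refined remainder bound, and L keeps the guiding center within distance 1 of
    \<open>q\<close>.\<close>
  proof (rule that[of C "K1 + L"])
    show "0 \<le> C" using G(1) Cg by (simp add: C_def)
    show "0 \<le> K1 + L" using K1p L by simp
    fix b b' e e' r h \<epsilon> N x v q u T n
    assume tsm: "two_step_method B0 b e M h \<epsilon> N x v" and H: "(K1 + L) * h \<le> 1"
      and fb: "field_bounds b b' r M" and fe: "field_bounds e e' r M"
      and xr: "\<And>n. n \<le> N \<Longrightarrow> norm (x (int n)) \<le> r"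
      and sol: "charged_particle_solution (magnetic_field B0 b \<epsilon>) e T q u"
      and qr: "\<And>t. t \<in> {0..T} \<Longrightarrow> norm (q t) \<le> r - 1"
      and T: "0 \<le> T" "T \<le> M" "real N * h \<le> T" and u0: "norm (u 0) \<le> M"
      and x0: "norm (x 0 - q 0) \<le> M * h\<^sup>2" and v0: "B0 \<bullet> v 0 = B0 \<bullet> u 0" and n: "n \<le> N"
    let ?w = "increment x"
    obtain \<tau> f where ts: "two_step B0 M h \<epsilon> \<tau> N ?w f"
      and vf: "\<And>n. n \<le> N \<Longrightarrow> B0 \<bullet> v (int n) = (B0 \<bullet> (?w (Suc n) + ?w n)) / (2 * h)"
      and rf: "\<And>n. n \<le> N \<Longrightarrow> norm (?w n) \<le> 1 \<Longrightarrow> norm (?w (Suc n)) \<le> 1 \<Longrightarrow>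
            norm (f n - (((?w (Suc n) + ?w n) /\<^sub>R (2 * h)) \<times> b (x (int n)) + e (x (int n))))
              \<le> M * ((norm (?w (Suc n) + ?w n))^3 + norm (?w (Suc n) + ?w n) * norm (?w (Suc n) - ?w n)) / h"
      using tsm unfolding two_step_method_def Let_def by blast
    have h: "0 < h" "h \<le> 1" and eps: "0 < \<epsilon>" "\<epsilon> \<le> h\<^sup>2" and tau: "\<tau> \<noteq> 0" "\<bar>1 / \<tau>\<bar> \<le> M"
      using ts by (auto simp: two_step_def)
    have h2: "h\<^sup>2 \<le> h" using h by (simp add: power2_eq_square mult_left_le)
    have "K1 * h \<ge> 0" "L * h \<ge> 0" using K1p L h by auto
    then have Hh: "K1 * h \<le> 1" "L * h \<le> 1" using H by (auto simp: distrib_right)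
    have eps1: "\<epsilon> \<le> 1" "L * \<epsilon> \<le> L * h\<^sup>2" "L * \<epsilon> \<le> 1"
    proof -
      show "\<epsilon> \<le> 1" using eps h2 h by linarith
      show "L * \<epsilon> \<le> L * h\<^sup>2" using eps L by (intro mult_left_mono) auto
      have "L * \<epsilon> \<le> L * h" using eps h2 L by (intro mult_left_mono) auto
      then show "L * \<epsilon> \<le> 1" using Hh by linarith
    qed
    have Kh: "K1 * h \<le> K * h" "K1 * h\<^sup>2 \<le> K * h\<^sup>2" using K h by (auto intro: mult_right_mono)
    define X where "X = slow_position B0 \<tau> (\<lambda>n. x (int n)) ?w"
    define Q where "Q = slow_velocity B0 h \<tau> ?w (\<lambda>n. b (x (int n)))"
    have remainder: "norm (f n - (((?w (Suc n) + ?w n) /\<^sub>R (2 * h)) \<times> b (x (int n)) + e (x (int n)))) \<le> K * h\<^sup>2"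
      if n: "n \<le> N" for n
    proof -
      have w: "norm (?w n) \<le> K1 * h" "norm (?w (Suc n)) \<le> K1 * h" using K1(2)[OF ts] n by auto
      then have s: "norm (?w (Suc n) + ?w n) \<le> 2 * (K1 * h)"
        using norm_triangle_ineq[of "?w (Suc n)" "?w n"] by linarith
      have d: "norm (?w (Suc n) - ?w n) \<le> K1 * h\<^sup>2" by (rule K1(4)[OF ts n])
      have "norm (f n - (((?w (Suc n) + ?w n) /\<^sub>R (2 * h)) \<times> b (x (int n)) + e (x (int n))))
          \<le> M * ((norm (?w (Suc n) + ?w n))^3 + norm (?w (Suc n) + ?w n) * norm (?w (Suc n) - ?w n)) / h"
        using w Hh by (intro rf[OF n]) auto
      also have "\<dots> \<le> M * ((2 * (K1 * h))^3 + 2 * (K1 * h) * (K1 * h\<^sup>2)) / h"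
        using s d M h K1p by (intro divide_right_mono mult_left_mono add_mono power_mono mult_mono) auto
      also have "\<dots> = M * (8 * K1^3 + 2 * K1\<^sup>2) * h\<^sup>2"
        using h by (simp add: field_simps power2_eq_square power3_eq_cube)
      also have "\<dots> \<le> K * h\<^sup>2" using K by (intro mult_right_mono) auto
      finally show ?thesis .
    qed
    have bb: "norm (b y) \<le> M" "norm (e y) \<le> M" if "norm y \<le> r" for y
      using fb fe that by (auto simp: field_bounds_def)
    have blip: "norm (b y - b z) \<le> M * norm (y - z)" "norm (e y - e z) \<le> M * norm (y - z)"
      if "norm y \<le> r" "norm z \<le> r" for y z
      using field_bounds_lipschitz[OF fb, of y z] field_bounds_lipschitz[OF fe, of y z] that by auto
    have slow: "\<And>n. n \<le> Suc N \<Longrightarrow> norm (X n - x (int n)) \<le> K^2 * h\<^sup>2"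
      "\<And>n. Suc n \<le> N \<Longrightarrow> \<bar>Q (Suc n) - Q n - h * (B0 \<bullet> e (x (int (Suc n))))\<bar> \<le> 3 * K^4 * h^3"
      "\<And>n. n \<le> N \<Longrightarrow> norm (X (Suc n) - X n - (h * Q n) *\<^sub>R B0) \<le> 2 * K^3 * h^3"
      "\<And>n. n \<le> N \<Longrightarrow>
        \<bar>(B0 \<bullet> (?w (Suc n) + ?w n)) / (2 * h) - (Q n - h / 2 * (B0 \<bullet> e (x (int n))))\<bar> \<le> 2 * K^3 * h\<^sup>2"
    proof -
      have par: "B0 \<bullet> (?w (Suc n) - ?w n) = h\<^sup>2 * (B0 \<bullet> f n)"
        and prp: "perp B0 (?w (Suc n) - ?w n)
                = \<tau> *\<^sub>R ((?w (Suc n) + ?w n) \<times> B0 + (2 * h * \<epsilon>) *\<^sub>R perp B0 (f n))" if "n \<le> N" for n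
        using ts that by (auto simp: two_step_def)
      have t: "\<bar>1 / \<tau>\<bar> \<le> K" using tau K by linarith
      have xs: "x (int (Suc n)) = x (int n) + ?w (Suc n)" for n
        by (simp add: increment_def)
      have om: "norm (?w n) \<le> K * h" if "n \<le> Suc N" for n using K1(2)[OF ts that] Kh by linarith
      have omp: "norm (perp B0 (?w n)) \<le> K * h\<^sup>2" if "n \<le> Suc N" for n using K1(3)[OF ts that] Kh by linarith
      have fK: "norm (f n) \<le> K" if "n \<le> N" for n using K1(5)[OF ts that] K by linarith
      have bK: "norm (b (x (int n))) \<le> K" if "n \<le> N" for n using bb(1)[OF xr[OF that]] K by linarith
      have bd: "norm (b (x (int (Suc n))) - b (x (int n))) \<le> K * norm (?w (Suc n))" if "Suc n \<le> N" for n
      proof -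
        have "norm (b (x (int (Suc n))) - b (x (int n))) \<le> M * norm (x (int (Suc n)) - x (int n))"
          using that by (intro blip(1) xr) auto
        also have "\<dots> \<le> K * norm (?w (Suc n))"
          unfolding xs using K by (auto intro: mult_right_mono)
        finally show ?thesis .
      qed
      note sv = slow_variables[where x = "\<lambda>n. x (int n)" and b = "\<lambda>n. b (x (int n))" and g = "\<lambda>n. e (x (int n))",
          OF unit K(2) h eps tau(1) t par prp xs om omp fK bK bd remainder, folded X_def Q_def]
      show "\<And>n. n \<le> Suc N \<Longrightarrow> norm (X n - x (int n)) \<le> K^2 * h\<^sup>2"
        "\<And>n. Suc n \<le> N \<Longrightarrow> \<bar>Q (Suc n) - Q n - h * (B0 \<bullet> e (x (int (Suc n))))\<bar> \<le> 3 * K^4 * h^3"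
        "\<And>n. n \<le> N \<Longrightarrow> norm (X (Suc n) - X n - (h * Q n) *\<^sub>R B0) \<le> 2 * K^3 * h^3"
        "\<And>n. n \<le> N \<Longrightarrow>
          \<bar>(B0 \<bullet> (?w (Suc n) + ?w n)) / (2 * h) - (Q n - h / 2 * (B0 \<bullet> e (x (int n))))\<bar> \<le> 2 * K^3 * h\<^sup>2"
        by (rule sv; assumption)+
    qed
    define y where "y = guiding_center B0 \<epsilon> q u"
    define p where "p = guiding_velocity B0 \<epsilon> b q u"
    define P where "P t = p t + h / 2 * (B0 \<bullet> e (y t))" for t
    have qr': "norm (q t) \<le> r" if "t \<in> {0..T}" for t using qr[OF that] by linarith
    have ub: "norm (u t) \<le> U" if t: "t \<in> {0..T}" for t
    proof -
      have "norm (u t) \<le> 1 + norm (u 0) + M * t"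
        using bb(2) qr' t by (intro velocity_bound[OF sol]) auto
      also have "M * t \<le> M * M" using t T M by (intro mult_left_mono) auto
      finally show ?thesis using u0 by (simp add: U_def)
    qed
    \<comment> \<open>This crude bound must precede \<open>guiding_center_system\<close>, whose
      Lipschitz hypothesis on \<open>e\<close> requires \<open>y\<close> in the ball.\<close>
    have yq0: "norm (y t - q t) \<le> 1" if "t \<in> {0..T}" for t
    proof -
      have "norm (y t - q t) \<le> \<epsilon> * norm (u t)"
        using norm_cross_le[of "u t" B0] unit eps by (simp add: y_def guiding_center_def)
      also have "\<dots> \<le> \<epsilon> * L"
      proof -
        have "1 * (U * 1) \<le> 4 * M\<^sup>2 * (U * U)"
          using U \<open>1 \<le> M\<^sup>2\<close> by (intro mult_mono) auto
        then have "U \<le> L" by (simp add: L_def power2_eq_square)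
        then show ?thesis using ub[OF that] eps by (intro mult_left_mono) auto
      qed
      finally show ?thesis using eps1 by (simp add: mult.commute)
    qed
    have yr: "norm (y t) \<le> r" if "t \<in> {0..T}" for t
      using yq0[OF that] qr[OF that] norm_triangle_sub[of "y t" "q t"] by linarith
    have db: "\<And>x. (b has_derivative b' x) (at x)" and de: "\<And>x. (e has_derivative e' x) (at x)"
      using fb fe by (auto simp: field_bounds_def)
    obtain y' p' where
      dy: "\<And>t. t \<in> {0..T} \<Longrightarrow> (y has_vector_derivative y' t) (at t within {0..T})" and
      dp: "\<And>t. t \<in> {0..T} \<Longrightarrow> (p has_vector_derivative p' t) (at t within {0..T})" and
      y': "\<And>t. t \<in> {0..T} \<Longrightarrow> norm (y' t - p t *\<^sub>R B0) \<le> L * \<epsilon>" and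
      p': "\<And>t. t \<in> {0..T} \<Longrightarrow> \<bar>p' t - B0 \<bullet> e (y t)\<bar> \<le> L * \<epsilon>" and
      yq: "\<And>t. t \<in> {0..T} \<Longrightarrow> norm (y t - q t) \<le> L * \<epsilon>" and
      pu: "\<And>t. t \<in> {0..T} \<Longrightarrow> \<bar>p t - B0 \<bullet> u t\<bar> \<le> L * \<epsilon>" and
      pL: "\<And>t. t \<in> {0..T} \<Longrightarrow> \<bar>p t\<bar> \<le> L"
    proof (rule guiding_center_system[of B0 M U L \<epsilon> b e T q u b', folded y_def p_def])
      show "4 * M\<^sup>2 * U\<^sup>2 \<le> L" by (simp add: L_def)
      show "norm (b' (q t) w) \<le> M * norm w" if "t \<in> {0..T}" for t w
        using fb qr'[OF that] by (auto simp: field_bounds_def)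
      show "norm (e (q t) - e (y t)) \<le> M * norm (q t - y t)" if "t \<in> {0..T}" for t
        using qr'[OF that] yr[OF that] by (rule blip(2))
    qed ((rule that; (assumption | blast)) | (use unit M U eps eps1 sol db ub bb qr' in \<open>auto; fail\<close>))+
    have local: "norm (y (t + h) - y t - (h * P t) *\<^sub>R B0) \<le> 4 * L\<^sup>2 * h^3"
      "\<bar>P (t + h) - P t - h * (B0 \<bullet> e (y (t + h)))\<bar> \<le> 7 * L^3 * h^3"
      if t: "0 \<le> t" "t + h \<le> T" for t
    proof -
      have eL: "norm (e (y t)) \<le> L" if "t \<in> {0..T}" for t using bb(2)[OF yr[OF that]] L by linarith
      have eL': "norm (e' (y t) w) \<le> L * norm w" if "t \<in> {0..T}" for t w
      proof -
        have "norm (e' (y t) w) \<le> M * norm w" using fe yr[OF that] by (auto simp: field_bounds_def)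
        also have "\<dots> \<le> L * norm w" using L by (intro mult_right_mono) auto
        finally show ?thesis .
      qed
      have eL'': "norm (e' (y t) w - e' (y s) w) \<le> L * norm (y t - y s) * norm w"
        if "t \<in> {0..T}" "s \<in> {0..T}" for t s w
      proof -
        have "norm (e' (y t) w - e' (y s) w) \<le> M * norm (y t - y s) * norm w"
          using fe yr[OF that(1)] yr[OF that(2)] by (auto simp: field_bounds_def)
        also have "\<dots> \<le> L * norm (y t - y s) * norm w" using L by (intro mult_right_mono) auto
        finally show ?thesis .
      qed
      note le = slow_system_local_error[OF unit L(1) h eps dy dp y' p' pL de eL eL' eL'' t]
      show "norm (y (t + h) - y t - (h * P t) *\<^sub>R B0) \<le> 4 * L\<^sup>2 * h^3"
        unfolding P_def by (rule le(1))
      show "\<bar>P (t + h) - P t - h * (B0 \<bullet> e (y (t + h)))\<bar> \<le> 7 * L^3 * h^3"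
        unfolding P_def by (rule le(2))
    qed
    define t where "t n = real n * h" for n
    have tT: "t n \<in> {0..T}" if "n \<le> N" for n
    proof -
      have "real n * h \<le> real N * h" using that h by simp
      then have "real n * h \<le> T" using T by linarith
      then show ?thesis using h by (simp add: t_def)
    qed
    have tS: "t (Suc n) = t n + h" for n by (simp add: t_def algebra_simps)
    define d where "d n = norm (X n - y (t n))" for n
    define \<delta> where "\<delta> n = \<bar>Q n - P (t n)\<bar>" for n
    have nonneg: "0 \<le> d n" "0 \<le> \<delta> n" for n by (simp_all add: d_def \<delta>_def)
    have tri3: "norm (a + b + c) \<le> norm a + norm b + norm c" for a b c :: "real^3"
      using norm_triangle_ineq[of "a + b" c] norm_triangle_ineq[of a b] by linarith
    have tri4: "norm (a + b + (c - k)) \<le> norm a + norm b + (norm c + norm k)" for a b c k :: "real^3"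
      using tri3[of a b "c - k"] norm_triangle_ineq4[of c k] by linarith
    have up: "c * h^3 \<le> G * h^3" if "c \<le> G" for c using that h by (intro mult_right_mono) auto
    have up2: "c * h\<^sup>2 \<le> G * h\<^sup>2" if "c \<le> G" for c using that by (intro mult_right_mono) auto
    \<comment> \<open>The method evaluates the force at \<open>x n\<close>, not at the slow position
      \<open>X n\<close>. The two differ by O(h^2), hence the summand
      \<open>G * h\<^sup>2\<close>.\<close>
    have eQ: "\<bar>B0 \<bullet> e (x (int n)) - B0 \<bullet> e (y (t n))\<bar> \<le> G * (G * h\<^sup>2 + d n)" if n: "n \<le> N" for n
    proof -
      have "\<bar>B0 \<bullet> (e (x (int n)) - e (y (t n)))\<bar> \<le> M * norm (x (int n) - y (t n))"
        using abs_inner_le[OF unit] blip(2)[OF xr[OF n] yr[OF tT[OF n]]] order_trans by blast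
      also have "norm (x (int n) - y (t n)) \<le> norm (X n - x (int n)) + d n"
        using norm_triangle_ineq[of "x (int n) - X n" "X n - y (t n)"]
        by (simp add: d_def norm_minus_commute)
      also have "\<dots> \<le> G * h\<^sup>2 + d n" using slow(1)[of n] n up2[OF G(6)] by linarith
      also have "M * (G * h\<^sup>2 + d n) \<le> G * (G * h\<^sup>2 + d n)"
        using G by (intro mult_right_mono) (auto simp: d_def)
      finally show ?thesis using M by (simp add: inner_diff_right mult_left_mono)
    qed
    have init_d: "d 0 \<le> (K\<^sup>2 + M + L) * h\<^sup>2"
    proof -
      have "norm (X 0 - y 0) \<le> norm (X 0 - x 0) + norm (x 0 - q 0) + norm (y 0 - q 0)"
        using norm_triangle_ineq[of "X 0 - x 0" "x 0 - y 0"] norm_triangle_ineq4[of "x 0 - q 0" "y 0 - q 0"]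
        by simp
      then show ?thesis
        using slow(1)[of 0] x0 yq[of 0] T eps1 by (simp add: d_def t_def distrib_right)
    qed
    \<comment> \<open>Undoing the half kick in \<open>Q 0\<close> gives the parallel part of
      \<open>v 0\<close> up to O(h^2), and in \<open>P 0\<close> that of \<open>u 0\<close> up to
      O(\<epsilon>). These coincide, so what remains is the difference of the two half kicks, at
      points O(h^2) apart.\<close>
    have init_e: "\<delta> 0 \<le> (2 * K^3 + L + M * (M + L)) * h\<^sup>2"
    proof -
      have "\<bar>B0 \<bullet> (e (x 0) - e (y 0))\<bar> \<le> M * norm (x 0 - y 0)"
        using abs_inner_le[OF unit] blip(2)[of "x 0" "y 0"] xr[of 0] yr[of 0] T order_trans by fastforce
      also have "norm (x 0 - y 0) \<le> (M + L) * h\<^sup>2"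
        using norm_triangle_ineq4[of "x 0 - q 0" "y 0 - q 0"] x0 yq[of 0] T eps1 by (simp add: distrib_right)
      finally have 1: "\<bar>B0 \<bullet> e (x 0) - B0 \<bullet> e (y 0)\<bar> \<le> M * ((M + L) * h\<^sup>2)"
        using M by (simp add: inner_diff_right mult_left_mono)
      have 2: "\<bar>h / 2 * (B0 \<bullet> e (x 0) - B0 \<bullet> e (y 0))\<bar> \<le> M * ((M + L) * h\<^sup>2)"
      proof -
        have "\<bar>h / 2 * (B0 \<bullet> e (x 0) - B0 \<bullet> e (y 0))\<bar> \<le> 1 * \<bar>B0 \<bullet> e (x 0) - B0 \<bullet> e (y 0)\<bar>"
          unfolding abs_mult using h by (intro mult_right_mono) auto
        also have "\<dots> \<le> M * ((M + L) * h\<^sup>2)" using 1 by simp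
        finally show ?thesis .
      qed
      have "\<bar>B0 \<bullet> u 0 - (Q 0 - h / 2 * (B0 \<bullet> e (x 0)))\<bar> \<le> 2 * K^3 * h\<^sup>2"
        using slow(4)[of 0] vf[of 0] v0 by simp
      moreover have "\<bar>p 0 - B0 \<bullet> u 0\<bar> \<le> L * h\<^sup>2" using pu[of 0] T eps1 by simp
      moreover have "Q 0 - P 0 = - (B0 \<bullet> u 0 - (Q 0 - h / 2 * (B0 \<bullet> e (x 0)))) - (p 0 - B0 \<bullet> u 0)
          + h / 2 * (B0 \<bullet> e (x 0) - B0 \<bullet> e (y 0))"
        by (simp add: P_def algebra_simps)
      moreover have "\<bar>- a - b + c\<bar> \<le> A + B + C" if "\<bar>a\<bar> \<le> A" "\<bar>b\<bar> \<le> B" "\<bar>c\<bar> \<le> C"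
        for a b c A B C :: real using that by linarith
      ultimately have "\<bar>Q 0 - P 0\<bar> \<le> 2 * K^3 * h\<^sup>2 + L * h\<^sup>2 + M * ((M + L) * h\<^sup>2)"
        using 2 by presburger
      then show ?thesis by (simp add: \<delta>_def t_def algebra_simps)
    qed
    have main: "d n + \<delta> n \<le> Cg * h\<^sup>2" if "n \<le> N" for n
      unfolding Cg_def
    proof (rule coupled_gronwall[OF G(1) h _ _ _ _ _ _ _ that])
      show "real N * h \<le> G" using T G by linarith
      show "d 0 \<le> G * h\<^sup>2" using init_d up2[OF G(9)] by linarith
      show "\<delta> 0 \<le> G * h\<^sup>2" using init_e up2[OF G(10)] by linarith
    next
      fix n assume n: "n < N"
      have tn: "0 \<le> t n" "t n + h \<le> T" using tT[of n] tT[of "Suc n"] n tS[of n] by auto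
      have "X (Suc n) - y (t (Suc n)) = (X n - y (t n)) + (h * (Q n - P (t n))) *\<^sub>R B0
          + ((X (Suc n) - X n - (h * Q n) *\<^sub>R B0) - (y (t n + h) - y (t n) - (h * P (t n)) *\<^sub>R B0))"
        by (simp add: tS algebra_simps)
      then have "d (Suc n) \<le> norm (X n - y (t n)) + norm ((h * (Q n - P (t n))) *\<^sub>R B0)
          + (norm (X (Suc n) - X n - (h * Q n) *\<^sub>R B0) + norm (y (t n + h) - y (t n) - (h * P (t n)) *\<^sub>R B0))"
        unfolding d_def by (simp only: tri4)
      also have "\<dots> \<le> d n + h * \<delta> n + (G * h^3 + G * h^3)"
      proof (intro add_mono)
        show "norm (X (Suc n) - X n - (h * Q n) *\<^sub>R B0) \<le> G * h^3"
          using slow(3)[of n] n up[OF G(2)] by simp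
        show "norm (y (t n + h) - y (t n) - (h * P (t n)) *\<^sub>R B0) \<le> G * h^3"
          using local(1)[OF tn] up[OF G(4)] by simp
      qed (use unit h in \<open>auto simp: d_def \<delta>_def abs_mult\<close>)
      finally show "d (Suc n) \<le> d n + h * \<delta> n + 2 * G * h^3" by simp
      have "\<bar>h * (B0 \<bullet> e (x (int (Suc n))) - B0 \<bullet> e (y (t (Suc n))))\<bar> \<le> h * (G * (G * h\<^sup>2 + d (Suc n)))"
        unfolding abs_mult using eQ[of "Suc n"] n h by (intro mult_mono) auto
      moreover have "Q (Suc n) - P (t (Suc n)) = (Q n - P (t n))
          + h * (B0 \<bullet> e (x (int (Suc n))) - B0 \<bullet> e (y (t (Suc n))))
          + (Q (Suc n) - Q n - h * (B0 \<bullet> e (x (int (Suc n)))))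
          - (P (t n + h) - P (t n) - h * (B0 \<bullet> e (y (t n + h))))"
        by (simp add: tS algebra_simps)
      moreover have "\<bar>Q (Suc n) - Q n - h * (B0 \<bullet> e (x (int (Suc n))))\<bar> \<le> G * h^3"
        using slow(2)[of n] n up[OF G(3)] by simp
      moreover have "\<bar>P (t n + h) - P (t n) - h * (B0 \<bullet> e (y (t n + h)))\<bar> \<le> G * h^3"
        using local(2)[OF tn] up[OF G(5)] by simp
      moreover have "\<bar>a + b + c - k\<bar> \<le> \<bar>a\<bar> + A + B + B" if "\<bar>b\<bar> \<le> A" "\<bar>c\<bar> \<le> B" "\<bar>k\<bar> \<le> B"
        for a b c k A B :: real using that by linarith
      ultimately have "\<bar>Q (Suc n) - P (t (Suc n))\<bar>
          \<le> \<bar>Q n - P (t n)\<bar> + h * (G * (G * h\<^sup>2 + d (Suc n))) + G * h^3 + G * h^3"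
        by presburger
      then show "\<delta> (Suc n) \<le> \<delta> n + h * G * (G * h\<^sup>2 + d (Suc n)) + 2 * G * h^3"
        by (simp add: \<delta>_def algebra_simps)
    qed (auto simp: d_def \<delta>_def)
    have dn: "d n \<le> Cg * h\<^sup>2" "\<delta> n \<le> Cg * h\<^sup>2" using main[OF n] nonneg[of n] by linarith+
    have pos: "norm (x (int n) - q (t n)) \<le> (G + Cg + G) * h\<^sup>2"
    proof -
      have "x (int n) - q (t n) = (x (int n) - X n) + (X n - y (t n)) + (y (t n) - q (t n))" by simp
      then have "norm (x (int n) - q (t n)) \<le> norm (x (int n) - X n) + d n + norm (y (t n) - q (t n))"
        unfolding d_def by (simp only: tri3)
      then show ?thesis
        using slow(1)[of n] n dn yq[OF tT[OF n]] eps1 up2[OF G(6)] up2[OF G(8)]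
        by (simp add: distrib_right norm_minus_commute)
    qed
    have vel: "\<bar>B0 \<bullet> v (int n) - B0 \<bullet> u (t n)\<bar> \<le> (G + Cg + G * (G + Cg) + G) * h\<^sup>2"
    proof -
      have "\<bar>h / 2 * (B0 \<bullet> e (x (int n)) - B0 \<bullet> e (y (t n)))\<bar> \<le> 1 * (G * (G * h\<^sup>2 + d n))"
        unfolding abs_mult using eQ[OF n] h by (intro mult_mono) auto
      also have "\<dots> \<le> 1 * (G * (G * h\<^sup>2 + Cg * h\<^sup>2))"
        using dn G by (intro mult_left_mono) auto
      finally have 1: "\<bar>h / 2 * (B0 \<bullet> e (x (int n)) - B0 \<bullet> e (y (t n)))\<bar> \<le> G * (G + Cg) * h\<^sup>2"
        by (simp add: algebra_simps)
      have "B0 \<bullet> v (int n) - B0 \<bullet> u (t n) = (B0 \<bullet> v (int n) - (Q n - h / 2 * (B0 \<bullet> e (x (int n)))))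
          + (Q n - P (t n)) - h / 2 * (B0 \<bullet> e (x (int n)) - B0 \<bullet> e (y (t n))) + (p (t n) - B0 \<bullet> u (t n))"
        by (simp add: P_def algebra_simps)
      moreover have "\<bar>B0 \<bullet> v (int n) - (Q n - h / 2 * (B0 \<bullet> e (x (int n))))\<bar> \<le> G * h\<^sup>2"
        using slow(4)[OF n] vf[OF n] up2[OF G(2)] by simp
      moreover have "\<bar>p (t n) - B0 \<bullet> u (t n)\<bar> \<le> G * h\<^sup>2"
        using pu[OF tT[OF n]] eps1 up2[OF G(8)] by linarith
      moreover have "\<bar>a + b - c + k\<bar> \<le> A + B + C + A" if "\<bar>a\<bar> \<le> A" "\<bar>b\<bar> \<le> B" "\<bar>c\<bar> \<le> C" "\<bar>k\<bar> \<le> A"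
        for a b c k A B C :: real using that by linarith
      ultimately have "\<bar>B0 \<bullet> v (int n) - B0 \<bullet> u (t n)\<bar> \<le> G * h\<^sup>2 + Cg * h\<^sup>2 + G * (G + Cg) * h\<^sup>2 + G * h\<^sup>2"
        using 1 dn(2) unfolding \<delta>_def by presburger
      then show ?thesis by (simp only: distrib_right)
    qed
    have "(G + Cg + G) * h\<^sup>2 \<le> C * h\<^sup>2" "(G + Cg + G * (G + Cg) + G) * h\<^sup>2 \<le> C * h\<^sup>2"
      using G(1) Cg by (auto simp: C_def intro!: mult_right_mono)
    then show "norm (x (int n) - q (real n * h)) \<le> C * h\<^sup>2 \<and>
      \<bar>B0 \<bullet> v (int n) - B0 \<bullet> u (real n * h)\<bar> \<le> C * h\<^sup>2"
      using pos vel unfolding t_def by linarith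
  qed
qed

text \<open>At the first time when \<phi> equals c, which exists by the intermediate value theorem
  and compactness, the premise of \<open>step\<close> holds and its strict conclusion fails.
  Strictness is what allows an estimate valid only inside the ball to be continued.\<close>

lemma bounded_until_exit:
  fixes \<phi> :: "real \<Rightarrow> real"
  assumes cont: "continuous_on {0..T} \<phi>" and init: "\<phi> 0 < c"
    and step: "\<And>s. s \<in> {0..T} \<Longrightarrow> (\<And>r. r \<in> {0..s} \<Longrightarrow> \<phi> r \<le> c) \<Longrightarrow> \<phi> s < c"
    and t: "t \<in> {0..T}"
  shows "\<phi> t \<le> c"
proof (rule ccontr)
  assume "\<not> \<phi> t \<le> c"
  have hit: "\<exists>s. 0 \<le> s \<and> s \<le> r \<and> \<phi> s = c" if "r \<in> {0..T}" "\<phi> r > c" for r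
    using init that by (intro IVT' continuous_on_subset[OF cont]) auto
  define S where "S = {0..T} \<inter> \<phi> -` {c}"
  have "closed S"
    unfolding S_def by (rule continuous_closed_preimage[OF cont]) auto
  then have "compact S"
    by (auto simp: compact_eq_bounded_closed S_def intro: bounded_subset[of "{0..T}"])
  moreover have "S \<noteq> {}"
    using hit[OF t] \<open>\<not> \<phi> t \<le> c\<close> t by (force simp: S_def)
  ultimately obtain s where s: "s \<in> S" "\<And>r. r \<in> S \<Longrightarrow> s \<le> r"
    using compact_attains_inf by metis
  have "\<phi> r \<le> c" if r: "r \<in> {0..s}" for r
  proof (rule ccontr)
    assume "\<not> \<phi> r \<le> c"
    then obtain r' where r': "0 \<le> r'" "r' \<le> r" "\<phi> r' = c"
      using hit[of r] r s(1) by (auto simp: S_def)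
    then have "r' \<in> S" using r s(1) by (auto simp: S_def)
    then have "r' = r" using s(2) r' r by force
    then show False using r' \<open>\<not> \<phi> r \<le> c\<close> by simp
  qed
  then have "\<phi> s < c" using s(1) by (intro step) (auto simp: S_def)
  then show False using s(1) by (simp add: S_def)
qed

unbundle no cross3_syntax

theorem theorem5p1:
  fixes B0 :: "real^3"
    and B1 E A1 :: "real \<Rightarrow> real^3 \<Rightarrow> real^3"
    and K :: "(real^3) set"
    and T C0 C1 c1 c \<rho> :: real
    and N :: nat
  assumes "norm B0 = 1"
    and "uniformly_smooth B1" and "uniformly_smooth E" and "uniformly_smooth A1"
    and "\<forall>\<epsilon>\<in>{0<..<1}. \<forall>x. curl (A1 \<epsilon>) x = B1 \<epsilon> x"
    and "T > 0" and "compact K" and "N \<ge> 1" and "c > 0"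
  shows "\<exists>h0 C. h0 > 0 \<and>
    (\<forall>\<epsilon> h q u x v.
       0 < \<epsilon> \<and> \<epsilon> \<le> h\<^sup>2 \<and> 0 < h \<and> h \<le> h0 \<and>
       charged_particle_solution (magnetic_field B0 (B1 \<epsilon>) \<epsilon>) (E \<epsilon>) T q u \<and>
       norm (q 0) \<le> C0 \<and> norm (u 0) \<le> C1 \<and>
       (boris (magnetic_field B0 (B1 \<epsilon>) \<epsilon>) (E \<epsilon>) T h x v
            \<and> slow_start B0 \<epsilon> c1 (q 0) (u 0) (x 0) (v 0)
        \<or> standard_variational (vector_potential B0 (A1 \<epsilon>) \<epsilon>) (E \<epsilon>) T h x v
            \<and> near_branch \<rho> T h x
            \<and> slow_start B0 \<epsilon> c1 (q 0) (u 0) (x 0) (v 0)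
        \<or> filtered_variational B0 \<epsilon> (vector_potential B0 (A1 \<epsilon>) \<epsilon>) (E \<epsilon>) T h x v
            \<and> near_branch \<rho> T h x
            \<and> nonresonant N c \<epsilon> h
            \<and> x 0 = q 0 \<and> v 0 = u 0) \<and>
       (\<forall>n::int. 0 \<le> n \<and> of_int n * h \<le> T \<longrightarrow> x n \<in> K)
       \<longrightarrow>
       (\<forall>n::int. 0 \<le> n \<and> of_int n * h \<le> T \<longrightarrow>
          norm (x n - q (of_int n * h)) \<le> C * h\<^sup>2 \<and>
          norm (par_proj B0 *v v n - par_proj B0 *v u (of_int n * h)) \<le> C * h\<^sup>2))"
proof -
  obtain R where R: "\<And>y. y \<in> K \<Longrightarrow> norm y \<le> R"
    using compact_imp_bounded[OF \<open>compact K\<close>] unfolding bounded_iff by blast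
  \<comment> \<open>\<open>R\<close> and \<rho> with a margin of 2 contain the points used by the
    variational methods, and \<open>C0\<close> places \<open>q 0\<close> inside. The error estimate
    will confine \<open>q\<close> to radius \<bar>R\<bar> + 2, which has to lie below r - 1; hence
    the 4.\<close>
  define r where "r = \<bar>R\<bar> + \<bar>\<rho>\<bar> + \<bar>C0\<bar> + 4"
  note unit = \<open>norm B0 = 1\<close>
  obtain Mb where Mb: "Mb \<ge> 1" "\<And>\<epsilon>. \<epsilon> \<in> {0<..<1} \<Longrightarrow>
      field_bounds (B1 \<epsilon>) (\<lambda>x. frechet_derivative (B1 \<epsilon>) (at x)) r Mb"
    using uniformly_smooth_field_bounds[OF \<open>uniformly_smooth B1\<close>] by blast
  obtain Me where Me: "Me \<ge> 1" "\<And>\<epsilon>. \<epsilon> \<in> {0<..<1} \<Longrightarrow>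
      field_bounds (E \<epsilon>) (\<lambda>x. frechet_derivative (E \<epsilon>) (at x)) r Me"
    using uniformly_smooth_field_bounds[OF \<open>uniformly_smooth E\<close>] by blast
  obtain Ma where Ma: "Ma \<ge> 1" "\<And>\<epsilon>. \<epsilon> \<in> {0<..<1} \<Longrightarrow>
      field_bounds (A1 \<epsilon>) (\<lambda>x. frechet_derivative (A1 \<epsilon>) (at x)) r Ma"
    using uniformly_smooth_field_bounds[OF \<open>uniformly_smooth A1\<close>] by blast
  obtain Md where Md: "Md \<ge> 0" "\<And>\<epsilon> y m d. \<epsilon> \<in> {0<..<1} \<Longrightarrow> norm y + norm m + norm d \<le> r \<Longrightarrow>
      norm (A1 \<epsilon> (y + m + d) - A1 \<epsilon> (y - m + d) - 2 *\<^sub>R frechet_derivative (A1 \<epsilon>) (at y) m)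
        \<le> Md * ((norm m)^3 + norm m * norm d)"
    using uniformly_smooth_central_difference[OF \<open>uniformly_smooth A1\<close>, of r] by blast
  define M0 where "M0 = Mb + Me + Ma + Md + \<bar>C1\<bar>"
  have M0: "Mb \<le> M0" "Me \<le> M0" "Ma \<le> M0" "Md \<le> M0" "\<bar>C1\<bar> \<le> M0" "1 \<le> M0"
    using Mb Me Ma Md by (auto simp: M0_def)
  \<comment> \<open>The summands with \<open>c\<close> serve the filtered method: 1 / c bounds
    \<tau> and its inverse, and the last summand its starting value.\<close>
  define M where "M = 2 + T + 2 * M0 + 2 * \<bar>c1\<bar> + 1 / c + 6 * (1 + 2 / c) * M0"
  have M: "2 \<le> M" "T \<le> M" "2 * M0 \<le> M" "2 * \<bar>c1\<bar> \<le> M" "1 / c \<le> M" "6 * (1 + 2 / c) * M0 \<le> M"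
    using M0 \<open>T > 0\<close> \<open>c > 0\<close> by (auto simp: M_def add_increasing add_increasing2)
  have M1: "1 \<le> M" "M0 \<le> M" using M M0 by linarith+
  obtain C H where C: "C \<ge> 0" "H \<ge> 0" and err:
    "\<And>b b' e e' r h \<epsilon> N x v q u T n.
      two_step_method B0 b e M h \<epsilon> N x v \<Longrightarrow> H * h \<le> 1 \<Longrightarrow>
      field_bounds b b' r M \<Longrightarrow> field_bounds e e' r M \<Longrightarrow>
      (\<And>n. n \<le> N \<Longrightarrow> norm (x (int n)) \<le> r) \<Longrightarrow>
      charged_particle_solution (magnetic_field B0 b \<epsilon>) e T q u \<Longrightarrow>
      (\<And>t. t \<in> {0..T} \<Longrightarrow> norm (q t) \<le> r - 1) \<Longrightarrow>
      0 \<le> T \<Longrightarrow> T \<le> M \<Longrightarrow> real N * h \<le> T \<Longrightarrow> norm (u 0) \<le> M \<Longrightarrow>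
      norm (x 0 - q 0) \<le> M * h\<^sup>2 \<Longrightarrow> B0 \<bullet> v 0 = B0 \<bullet> u 0 \<Longrightarrow> n \<le> N \<Longrightarrow>
      norm (x (int n) - q (real n * h)) \<le> C * h\<^sup>2 \<and>
      \<bar>B0 \<bullet> v (int n) - B0 \<bullet> u (real n * h)\<bar> \<le> C * h\<^sup>2"
    using method_error[OF unit M1(1)] by blast
  define U where "U = 1 + M + M * M"
  have U: "0 \<le> U" using M1 by (simp add: U_def)
  \<comment> \<open>Chosen so that h times each summand is at most 1; the 2 gives h \<le> 1 / 2 and
    with it \<epsilon> < 1.\<close>
  define h0 where "h0 = 1 / (2 + H + 6 * M + 2 * C + 2 * U)"
  have h0: "0 < h0" using C M U by (simp add: h0_def add_pos_nonneg)
  have small: "a * h \<le> 1" if "0 \<le> a" "a \<le> 2 + H + 6 * M + 2 * C + 2 * U" "0 < h" "h \<le> h0" for a h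
  proof -
    have "a * h \<le> (2 + H + 6 * M + 2 * C + 2 * U) * h0"
      using that by (intro mult_mono) auto
    then show ?thesis using C M U by (simp add: h0_def)
  qed
  have bound: "norm (x (int m) - q (real m * h)) \<le> C * h\<^sup>2 \<and>
      norm (par_proj B0 *v v (int m) - par_proj B0 *v u (real m * h)) \<le> C * h\<^sup>2"
    if eps: "0 < \<epsilon>" "\<epsilon> \<le> h\<^sup>2" and h: "0 < h" "h \<le> h0"
      and sol: "charged_particle_solution (magnetic_field B0 (B1 \<epsilon>) \<epsilon>) (E \<epsilon>) T q u"
      and init: "norm (q 0) \<le> C0" "norm (u 0) \<le> C1"
      and meth: "boris (magnetic_field B0 (B1 \<epsilon>) \<epsilon>) (E \<epsilon>) T h x v
            \<and> slow_start B0 \<epsilon> c1 (q 0) (u 0) (x 0) (v 0)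
        \<or> standard_variational (vector_potential B0 (A1 \<epsilon>) \<epsilon>) (E \<epsilon>) T h x v
            \<and> near_branch \<rho> T h x
            \<and> slow_start B0 \<epsilon> c1 (q 0) (u 0) (x 0) (v 0)
        \<or> filtered_variational B0 \<epsilon> (vector_potential B0 (A1 \<epsilon>) \<epsilon>) (E \<epsilon>) T h x v
            \<and> near_branch \<rho> T h x
            \<and> nonresonant N c \<epsilon> h
            \<and> x 0 = q 0 \<and> v 0 = u 0"
      and xK: "\<And>n::int. 0 \<le> n \<Longrightarrow> of_int n * h \<le> T \<Longrightarrow> x n \<in> K" and m: "real m * h \<le> T"
    for \<epsilon> h q u x v m
  proof -
    have hs: "H * h \<le> 1" "6 * M * h \<le> 1" "2 * C * h \<le> 1" "2 * U * h \<le> 1" "2 * h \<le> 1"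
      using small[OF _ _ h] C M U by auto
    have h1: "h \<le> 1" "h\<^sup>2 \<le> h" using hs h by (auto simp: power2_eq_square mult_left_le)
    have e1: "\<epsilon> \<in> {0<..<1}" using eps h1 hs h by auto
    have fb: "field_bounds (B1 \<epsilon>) (\<lambda>x. frechet_derivative (B1 \<epsilon>) (at x)) r M0"
      and fe: "field_bounds (E \<epsilon>) (\<lambda>x. frechet_derivative (E \<epsilon>) (at x)) r M0"
      and fa: "field_bounds (A1 \<epsilon>) (\<lambda>x. frechet_derivative (A1 \<epsilon>) (at x)) r M0"
      using Mb(2) Me(2) Ma(2) e1 M0 field_bounds_mono by blast+
    have cdb: "norm (A1 \<epsilon> (y + m + d) - A1 \<epsilon> (y - m + d) - 2 *\<^sub>R frechet_derivative (A1 \<epsilon>) (at y) m)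
        \<le> M0 * ((norm m)^3 + norm m * norm d)" if "norm y + norm m + norm d \<le> r" for y m d
    proof -
      have "norm (A1 \<epsilon> (y + m + d) - A1 \<epsilon> (y - m + d) - 2 *\<^sub>R frechet_derivative (A1 \<epsilon>) (at y) m)
        \<le> Md * ((norm m)^3 + norm m * norm d)" by (rule Md(2)[OF e1 that])
      also have "\<dots> \<le> M0 * ((norm m)^3 + norm m * norm d)" using M0 by (intro mult_right_mono) auto
      finally show ?thesis .
    qed
    have curl: "curl (A1 \<epsilon>) y = B1 \<epsilon> y" for y using assms(5) e1 by blast
    have nT: "real n * h \<le> T" if "real N' * h \<le> T" "n \<le> N'" for n N'
    proof -
      have "real n * h \<le> real N' * h" using that h by simp
      then show ?thesis using that by linarith
    qed
    have xR: "norm (x (int n)) \<le> \<bar>R\<bar>" if "real n * h \<le> T" for n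
      using R[OF xK[of "int n"]] that by simp
    have xr: "norm (x (int n)) \<le> r" if "real n * h \<le> T" for n
      using xR[OF that] by (simp add: r_def)
    have bE: "norm (B1 \<epsilon> y) \<le> M0" "norm (E \<epsilon> y) \<le> M0" if "norm y \<le> r" for y
      using fb fe that by (auto simp: field_bounds_def)
    have u0: "norm (u 0) \<le> M0" using init M0 by linarith
    \<comment> \<open>Stated for every N' within the time range, because the exit argument also runs
      on shorter intervals.\<close>
    have reduced: "two_step_method B0 (B1 \<epsilon>) (E \<epsilon>) M h \<epsilon> N' x v" if N': "real N' * h \<le> T" for N'
    proof -
      note nT' = nT[OF N']
      have xR': "norm (x (int n)) \<le> \<bar>R\<bar>" and bn: "norm (B1 \<epsilon> (x (int n))) \<le> M0"
        and en: "norm (E \<epsilon> (x (int n))) \<le> M0" if "n \<le> N'" for n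
        using xR[OF nT'[OF that]] bE xr[OF nT'[OF that]] by auto
      have rr: "\<bar>R\<bar> + \<bar>\<rho>\<bar> + 2 \<le> r" by (simp add: r_def)
      from meth consider
        (boris) "boris (magnetic_field B0 (B1 \<epsilon>) \<epsilon>) (E \<epsilon>) T h x v" "slow_start B0 \<epsilon> c1 (q 0) (u 0) (x 0) (v 0)"
      | (standard) "standard_variational (vector_potential B0 (A1 \<epsilon>) \<epsilon>) (E \<epsilon>) T h x v"
            "near_branch \<rho> T h x" "slow_start B0 \<epsilon> c1 (q 0) (u 0) (x 0) (v 0)"
      | (filtered) "filtered_variational B0 \<epsilon> (vector_potential B0 (A1 \<epsilon>) \<epsilon>) (E \<epsilon>) T h x v"
            "near_branch \<rho> T h x" "nonresonant N c \<epsilon> h" "v 0 = u 0"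
        by blast
      then show ?thesis
      proof cases
        case boris
        show ?thesis
          by (rule boris_two_step_method[OF unit eps h(1) h1(1) hs(2) N' M(2) boris u0 bn en M(1) M(3) M(4)])
      next
        case standard
        show ?thesis
          by (rule standard_two_step_method[OF unit eps h(1) h1(1) hs(2) N' M(2) standard u0 xR' rr curl
              bn en fa cdb M(1) M(3) M(4)])
      next
        case filtered
        have "1 \<in> {1..N}" using \<open>N \<ge> 1\<close> by simp
        then have "\<bar>sin (real 1 * h / (2 * \<epsilon>))\<bar> \<ge> c \<and> \<bar>cos (real 1 * h / (2 * \<epsilon>))\<bar> \<ge> c"
          using filtered(3) unfolding nonresonant_def by blast
        then have sc: "\<bar>sin (h / (2 * \<epsilon>))\<bar> \<ge> c" "\<bar>cos (h / (2 * \<epsilon>))\<bar> \<ge> c" by simp_all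
        have v0: "norm (v 0) \<le> M0" using filtered(4) u0 by simp
        show ?thesis
          by (rule filtered_two_step_method[OF unit eps h(1) h1(1) hs(2) N' M(2) filtered(1,2) \<open>c > 0\<close> sc v0
              xR' rr curl bn en fa cdb M(3) M(5) M(6)])
      qed
    qed
    have x0: "norm (x 0 - q 0) \<le> M * h\<^sup>2" and v0: "B0 \<bullet> v 0 = B0 \<bullet> u 0"
    proof -
      have "norm (x 0 - q 0) \<le> norm (u 0) * \<epsilon> \<and> B0 \<bullet> v 0 = B0 \<bullet> u 0"
        using meth slow_start_velocity[OF unit eps(1)] eps by fastforce
      moreover have "norm (u 0) * \<epsilon> \<le> M * h\<^sup>2" using u0 M1 eps by (intro mult_mono) auto
      ultimately show "norm (x 0 - q 0) \<le> M * h\<^sup>2" "B0 \<bullet> v 0 = B0 \<bullet> u 0" by linarith+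
    qed
    have fbM: "field_bounds (B1 \<epsilon>) (\<lambda>x. frechet_derivative (B1 \<epsilon>) (at x)) r M"
      and feM: "field_bounds (E \<epsilon>) (\<lambda>x. frechet_derivative (E \<epsilon>) (at x)) r M"
      using fb fe M1(2) field_bounds_mono by blast+
    \<comment> \<open>Conditional on \<open>q\<close> staying in the ball up to time s;
      \<open>qr\<close> removes the condition.\<close>
    have local_err: "norm (x (int n) - q (real n * h)) \<le> C * h\<^sup>2"
        "\<bar>B0 \<bullet> v (int n) - B0 \<bullet> u (real n * h)\<bar> \<le> C * h\<^sup>2"
      if s: "s \<in> {0..T}" and qs: "\<And>t. t \<in> {0..s} \<Longrightarrow> norm (q t) \<le> r - 1" and n: "real n * h \<le> s" for s n
    proof -
      have "s \<le> T" "0 \<le> s" using s by auto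
      have nT': "real n * h \<le> T" using n \<open>s \<le> T\<close> by linarith
      have u0M: "norm (u 0) \<le> M" "s \<le> M" using u0 M1 M \<open>s \<le> T\<close> by linarith+
      have xrn: "norm (x (int k)) \<le> r" if "k \<le> n" for k using xr[OF nT[OF nT' that]] .
      note le = err[OF reduced[OF nT'] hs(1) fbM feM xrn solution_restrict[OF sol \<open>s \<le> T\<close>] qs
          \<open>0 \<le> s\<close> u0M(2) n u0M(1) x0 v0 order_refl]
      show "norm (x (int n) - q (real n * h)) \<le> C * h\<^sup>2"
        "\<bar>B0 \<bullet> v (int n) - B0 \<bullet> u (real n * h)\<bar> \<le> C * h\<^sup>2"
        using le by auto
    qed
    have qr: "norm (q t) \<le> r - 1" if t: "t \<in> {0..T}" for t
    proof (rule bounded_until_exit[of T "\<lambda>t. norm (q t)", OF _ _ _ t])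
      have "continuous_on {0..T} q"
        unfolding continuous_on_eq_continuous_within
        using sol has_vector_derivative_continuous unfolding charged_particle_solution_def by blast
      then show "continuous_on {0..T} (\<lambda>t. norm (q t))" by (rule continuous_on_norm)
      show "norm (q 0) < r - 1" using init by (simp add: r_def)
    next
      fix s assume s: "s \<in> {0..T}" and qs: "\<And>t. t \<in> {0..s} \<Longrightarrow> norm (q t) \<le> r - 1"
      \<comment> \<open>The last grid point before s. From there to s the solution moves at most U
        h, with U independent of \<epsilon>, and its value there is within C h^2 of
        \<open>x (int k)\<close>, a point of K. Both distances are at most 1, so \<open>q s\<close>
        cannot have reached the boundary.\<close>
      define k where "k = nat \<lfloor>s / h\<rfloor>"
      have "0 \<le> s / h" using s h by simp
      then have "real k \<le> s / h" "s / h \<le> real k + 1" by (auto simp: k_def)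
      then have k: "real k * h \<le> s" "s - real k * h \<le> h"
        using h by (auto simp: field_simps)
      have kT: "real k * h \<le> T" using k s by auto
      have ub: "norm (u t) \<le> U" if t: "t \<in> {0..s}" for t
      proof -
        have "norm (u t) \<le> 1 + norm (u 0) + M0 * t"
        proof (rule velocity_bound[OF solution_restrict[OF sol]])
          show "norm (E \<epsilon> (q t)) \<le> M0" if "t \<in> {0..s}" for t
            using qs[OF that] by (intro bE(2)) linarith
        qed (use s t in auto)
        also have "M0 * t \<le> M * M" using t s M M1 M0 by (intro mult_mono) auto
        finally show ?thesis using u0 M1 by (simp add: U_def)
      qed
      have "norm (q s - q (real k * h)) \<le> U * (s - real k * h)"
      proof (rule mvt_bound[OF k(1)])
        fix t assume "t \<in> {real k * h..s}"
        then have t: "t \<in> {0..s}" "t \<in> {0..T}" and sub: "{real k * h..s} \<subseteq> {0..T}"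
          using s h by (auto intro: order_trans[of 0 "real k * h"])
        show "(q has_vector_derivative u t) (at t within {real k * h..s})"
          by (rule has_vector_derivative_within_subset[OF _ sub])
            (use sol t in \<open>auto simp: charged_particle_solution_def\<close>)
        show "norm (u t) \<le> U" by (rule ub[OF t(1)])
      qed
      also have "\<dots> \<le> U * h" using k U by (intro mult_left_mono) auto
      finally have "norm (q s - q (real k * h)) \<le> 1" using hs(4) U h by linarith
      moreover have "norm (x (int k) - q (real k * h)) \<le> 1"
      proof -
        have "C * h\<^sup>2 \<le> C * h" using h1 C by (intro mult_left_mono) auto
        then show ?thesis using local_err(1)[OF s qs k(1)] hs(3) C h by linarith
      qed
      ultimately have "norm (q s) \<le> \<bar>R\<bar> + 2"
        using xR[OF kT] norm_triangle_sub[of "q s" "q (real k * h)"]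
          norm_triangle_sub[of "q (real k * h)" "x (int k)"] by (simp add: norm_minus_commute)
      then show "norm (q s) < r - 1" by (simp add: r_def)
    qed
    have "T \<in> {0..T}" using \<open>T > 0\<close> by simp
    note final = local_err[OF this qr m]
    have "norm (par_proj B0 *v v (int m) - par_proj B0 *v u (real m * h))
        = \<bar>B0 \<bullet> v (int m) - B0 \<bullet> u (real m * h)\<bar>"
      using unit by (simp add: par_proj_mult scaleR_left_diff_distrib[symmetric])
    then show ?thesis using final by simp
  qed
  show ?thesis
  proof (intro exI conjI allI impI)
    show "0 < h0" by (rule h0)
  next
    fix \<epsilon> h :: real and q u and x v :: "int \<Rightarrow> real^3" and n :: int
    assume hyp: "0 < \<epsilon> \<and> \<epsilon> \<le> h\<^sup>2 \<and> 0 < h \<and> h \<le> h0 \<and>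
       charged_particle_solution (magnetic_field B0 (B1 \<epsilon>) \<epsilon>) (E \<epsilon>) T q u \<and>
       norm (q 0) \<le> C0 \<and> norm (u 0) \<le> C1 \<and>
       (boris (magnetic_field B0 (B1 \<epsilon>) \<epsilon>) (E \<epsilon>) T h x v
            \<and> slow_start B0 \<epsilon> c1 (q 0) (u 0) (x 0) (v 0)
        \<or> standard_variational (vector_potential B0 (A1 \<epsilon>) \<epsilon>) (E \<epsilon>) T h x v
            \<and> near_branch \<rho> T h x
            \<and> slow_start B0 \<epsilon> c1 (q 0) (u 0) (x 0) (v 0)
        \<or> filtered_variational B0 \<epsilon> (vector_potential B0 (A1 \<epsilon>) \<epsilon>) (E \<epsilon>) T h x v
            \<and> near_branch \<rho> T h x
            \<and> nonresonant N c \<epsilon> h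
            \<and> x 0 = q 0 \<and> v 0 = u 0) \<and>
       (\<forall>n::int. 0 \<le> n \<and> of_int n * h \<le> T \<longrightarrow> x n \<in> K)"
      and n: "0 \<le> n \<and> of_int n * h \<le> T"
    obtain m where m: "n = int m" using n nonneg_int_cases by blast
    have "norm (x (int m) - q (real m * h)) \<le> C * h\<^sup>2 \<and>
      norm (par_proj B0 *v v (int m) - par_proj B0 *v u (real m * h)) \<le> C * h\<^sup>2"
      using hyp n m by (intro bound[of \<epsilon>]) auto
    then show "norm (x n - q (of_int n * h)) \<le> C * h\<^sup>2"
      "norm (par_proj B0 *v v n - par_proj B0 *v u (of_int n * h)) \<le> C * h\<^sup>2"
      by (simp_all add: m)
  qed
qed

end
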